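(* Let $A=T(V)/I$ be a graded algebra, let $g\in A$ be a homogeneous element of degree 1 that is both normal and regular in $A$, and let $B=A/gA$. If the algebra $B$ is $\mathcal{K}_2$, then the algebra $A$ is $\mathcal{K}_2$.
   Context: Conventions. $K$ is a field. A "graded algebra" is a connected $\mathbb{N}$-graded $K$-algebra of the form $A=T(V)/I$, where $V$ is a finite-dimensional $K$-vector space placed in degree 1, $T(V)$ is its tensor algebra, and $I$ is an ideal generated by a (minimal) finite set of homogeneous elements of degree at least 2 (not necessarily all of the same degree). The field $K$ is identified with the trivial $A$-module $A/A_+$. The bigraded Yoneda algebra is $E(A)=\bigoplus_{n,m} E^{n,m}(A)$ with $E^{n,m}(A)=\mathrm{Ext}_A^{n}(K,K)_{-m}$ ($n$ is the cohomological degree, $-m$ the internal degree; Ext is computed in the category of $\mathbb{Z}$-graded locally finite $A$-modules with graded Hom spaces), with the Yoneda (cup) product; $E^n(A)=\bigoplus_m E^{n,m}(A)$. The graded algebra $A$ is called $\mathcal{K}_2$ if $E(A)$ is generated as an algebra by $E^1(A)$ and $E^2(A)$. An element $g\in A$ is normal if $gA=Ag$, and regular if it is neither a left nor a right zero divisor. *)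

theory Defs
  imports Complex_Main "HOL-Library.Poly_Mapping"
begin

section \<open>The tensor algebra\<close>

text \<open>
  Lists under concatenation, wrapped so that the convolution product of \<open>Poly_Mapping\<close> turns
  finitely supported functions on words into the free algebra.
\<close>

datatype 'x fword = FWord (letters: "'x list")

instantiation fword :: (type) monoid_add
begin

definition zero_fword :: "'a fword" where
  "0 = FWord []"

definition plus_fword :: "'a fword \<Rightarrow> 'a fword \<Rightarrow> 'a fword" where
  "u + v = FWord (letters u @ letters v)"

instance
  by standard (simp_all add: zero_fword_def plus_fword_def)

end

text \<open>\<open>T(V)\<close> for the vector space \<open>V\<close> with basis \<open>'x\<close>.\<close>

type_synonym ('x, 'k) tensor_algebra = "'x fword \<Rightarrow>\<^sub>0 'k"

definition tensor_scale :: "'k::field \<Rightarrow> ('x, 'k) tensor_algebra \<Rightarrow> ('x, 'k) tensor_algebra" where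
  "tensor_scale c t = Poly_Mapping.map (\<lambda>b. c * b) t"

definition tensor_component :: "nat \<Rightarrow> ('x, 'k::field) tensor_algebra set" where
  "tensor_component n = {t. \<forall>w \<in> Poly_Mapping.keys t. length (letters w) = n}"


section \<open>Ideals, quotients, normal and regular elements\<close>

definition two_sided_ideal :: "'a::ring_1 set \<Rightarrow> bool" where
  "two_sided_ideal I \<longleftrightarrow>
     0 \<in> I \<and> (\<forall>x\<in>I. \<forall>y\<in>I. x + y \<in> I) \<and> (\<forall>x\<in>I. \<forall>a. a * x \<in> I \<and> x * a \<in> I)"

definition algebra_hom ::
  "('k \<Rightarrow> 'a \<Rightarrow> 'a) \<Rightarrow> ('k \<Rightarrow> 'b \<Rightarrow> 'b) \<Rightarrow> ('a::ring_1 \<Rightarrow> 'b::ring_1) \<Rightarrow> bool" where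
  "algebra_hom sA sB f \<longleftrightarrow>
     f 1 = 1 \<and> (\<forall>x y. f (x + y) = f x + f y) \<and> (\<forall>x y. f (x * y) = f x * f y) \<and>
     (\<forall>c x. f (sA c x) = sB c (f x))"

text \<open>\<open>f\<close> exhibits its codomain as the quotient algebra of its domain by \<open>I\<close>.\<close>

definition quotient_map ::
  "('k \<Rightarrow> 'a \<Rightarrow> 'a) \<Rightarrow> ('k \<Rightarrow> 'b \<Rightarrow> 'b) \<Rightarrow> ('a::ring_1 \<Rightarrow> 'b::ring_1) \<Rightarrow> 'a set \<Rightarrow> bool" where
  "quotient_map sA sB f I \<longleftrightarrow> algebra_hom sA sB f \<and> surj f \<and> {x. f x = 0} = I"

definition normal_element :: "'a::ring_1 \<Rightarrow> bool" where
  "normal_element g \<longleftrightarrow> range (\<lambda>a. g * a) = range (\<lambda>a. a * g)"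

definition regular_element :: "'a::ring_1 \<Rightarrow> bool" where
  "regular_element g \<longleftrightarrow> (\<forall>a. g * a = 0 \<longrightarrow> a = 0) \<and> (\<forall>a. a * g = 0 \<longrightarrow> a = 0)"


section \<open>The bigraded Yoneda algebra of a connected graded algebra\<close>

text \<open>
  A graded free resolution of \<open>K\<close>: the \<open>n\<close>-th module is the free left module on the basis
  \<open>gens n\<close>, the basis element \<open>x\<close> having internal degree \<open>gdeg n x\<close>; \<open>diff n\<close> goes from the
  module with index \<open>Suc n\<close> to the one with index \<open>n\<close>.  As \<open>K\<close> is concentrated in degree \<open>0\<close> and
  the algebra in nonnegative degrees, generators in nonnegative degrees suffice; as the modules
  are locally finite, so does the countable index type.
\<close>

record (overloaded) ('a::zero, 'k) free_complex =
  gens :: "nat \<Rightarrow> nat set"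
  gdeg :: "nat \<Rightarrow> nat \<Rightarrow> nat"
  diff :: "nat \<Rightarrow> (nat \<Rightarrow>\<^sub>0 'a) \<Rightarrow> (nat \<Rightarrow>\<^sub>0 'a)"
  augm :: "(nat \<Rightarrow>\<^sub>0 'a) \<Rightarrow> 'k"

locale connected_graded_algebra = vector_space scale
  for scale :: "'k::field \<Rightarrow> 'a::ring_1 \<Rightarrow> 'a" +
  fixes G :: "nat \<Rightarrow> 'a set"
  assumes scale_mult_left: "scale c a * b = scale c (a * b)"
    and scale_mult_right: "a * scale c b = scale c (a * b)"
    and subspace_component: "subspace (G n)"
    and component_mult: "a \<in> G m \<Longrightarrow> b \<in> G n \<Longrightarrow> a * b \<in> G (m + n)"
    and decomposition:
      "\<exists>!f. (\<forall>n. f n \<in> G n) \<and> finite {n. f n \<noteq> 0} \<and> a = (\<Sum>n\<in>{n. f n \<noteq> 0}. f n)"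
    and connected: "G 0 = range (\<lambda>c. scale c 1)"
begin

definition augmentation_ideal :: "'a set" where
  "augmentation_ideal = span (\<Union>n\<in>{1..}. G n)"

text \<open>The projection of the algebra onto \<open>K\<close>, through which it acts on the trivial module \<open>K\<close>.\<close>

definition aug :: "'a \<Rightarrow> 'k" where
  "aug a = (THE c. a - scale c 1 \<in> augmentation_ideal)"

definition smult :: "'a \<Rightarrow> (nat \<Rightarrow>\<^sub>0 'a) \<Rightarrow> (nat \<Rightarrow>\<^sub>0 'a)" where
  "smult a u = Poly_Mapping.map (\<lambda>b. a * b) u"

definition free_module :: "('a, 'k) free_complex \<Rightarrow> nat \<Rightarrow> (nat \<Rightarrow>\<^sub>0 'a) set" where
  "free_module P n = {u. Poly_Mapping.keys u \<subseteq> gens P n}"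

definition free_component :: "('a, 'k) free_complex \<Rightarrow> nat \<Rightarrow> nat \<Rightarrow> (nat \<Rightarrow>\<^sub>0 'a) set" where
  "free_component P n j =
     {u \<in> free_module P n.
        \<forall>x \<in> Poly_Mapping.keys u. \<exists>i. gdeg P n x + i = j \<and> Poly_Mapping.lookup u x \<in> G i}"

definition module_hom ::
  "('a, 'k) free_complex \<Rightarrow> nat \<Rightarrow> nat \<Rightarrow> ((nat \<Rightarrow>\<^sub>0 'a) \<Rightarrow> (nat \<Rightarrow>\<^sub>0 'a)) \<Rightarrow> bool" where
  "module_hom P n i \<phi> \<longleftrightarrow>
     (\<forall>u \<in> free_module P n. \<phi> u \<in> free_module P i) \<and>
     (\<forall>u \<in> free_module P n. \<forall>v \<in> free_module P n. \<phi> (u + v) = \<phi> u + \<phi> v) \<and>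
     (\<forall>a. \<forall>u \<in> free_module P n. \<phi> (smult a u) = smult a (\<phi> u))"

definition module_hom_K ::
  "('a, 'k) free_complex \<Rightarrow> nat \<Rightarrow> ((nat \<Rightarrow>\<^sub>0 'a) \<Rightarrow> 'k) \<Rightarrow> bool" where
  "module_hom_K P n f \<longleftrightarrow>
     (\<forall>u \<in> free_module P n. \<forall>v \<in> free_module P n. f (u + v) = f u + f v) \<and>
     (\<forall>a. \<forall>u \<in> free_module P n. f (smult a u) = aug a * f u)"

definition free_resolution :: "('a, 'k) free_complex \<Rightarrow> bool" where
  "free_resolution P \<longleftrightarrow>
     (\<forall>n j. finite {x \<in> gens P n. gdeg P n x = j}) \<and>
     (\<forall>n. module_hom P (Suc n) n (diff P n)) \<and>
     (\<forall>n j. diff P n ` free_component P (Suc n) j \<subseteq> free_component P n j) \<and>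
     module_hom_K P 0 (augm P) \<and>
     (\<forall>j>0. \<forall>u \<in> free_component P 0 j. augm P u = 0) \<and>
     augm P ` free_module P 0 = UNIV \<and>
     {u \<in> free_module P 0. augm P u = 0} = diff P 0 ` free_module P (Suc 0) \<and>
     (\<forall>n. {u \<in> free_module P (Suc n). diff P n u = 0} = diff P (Suc n) ` free_module P (Suc (Suc n)))"

text \<open>
  Homomorphisms out of the \<open>n\<close>-th module only matter on that module; they are normalised to
  vanish elsewhere.
\<close>

definition restrict0 ::
  "('a, 'k) free_complex \<Rightarrow> nat \<Rightarrow> ((nat \<Rightarrow>\<^sub>0 'a) \<Rightarrow> 'k) \<Rightarrow> (nat \<Rightarrow>\<^sub>0 'a) \<Rightarrow> 'k" where
  "restrict0 P n f = (\<lambda>u. if u \<in> free_module P n then f u else 0)"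

text \<open>
  The part of internal degree \<open>-m\<close> of the graded space \<open>Hom(P\<^sub>n, K)\<close>: a map of degree \<open>-m\<close> sends the
  component of degree \<open>j\<close> to the component of degree \<open>j - m\<close> of \<open>K\<close>, which is \<open>0\<close> unless \<open>j = m\<close>.
\<close>

definition cochains :: "('a, 'k) free_complex \<Rightarrow> nat \<Rightarrow> nat \<Rightarrow> ((nat \<Rightarrow>\<^sub>0 'a) \<Rightarrow> 'k) set" where
  "cochains P n m =
     {f. module_hom_K P n f \<and> restrict0 P n f = f \<and>
         (\<forall>j. j \<noteq> m \<longrightarrow> (\<forall>u \<in> free_component P n j. f u = 0))}"

definition cocycles :: "('a, 'k) free_complex \<Rightarrow> nat \<Rightarrow> nat \<Rightarrow> ((nat \<Rightarrow>\<^sub>0 'a) \<Rightarrow> 'k) set" where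
  "cocycles P n m = {f \<in> cochains P n m. \<forall>u \<in> free_module P (Suc n). f (diff P n u) = 0}"

fun coboundaries :: "('a, 'k) free_complex \<Rightarrow> nat \<Rightarrow> nat \<Rightarrow> ((nat \<Rightarrow>\<^sub>0 'a) \<Rightarrow> 'k) set" where
  "coboundaries P 0 m = {\<lambda>u. 0}"
| "coboundaries P (Suc n) m = (\<lambda>f. restrict0 P (Suc n) (f \<circ> diff P n)) ` cochains P n m"

definition ext_class ::
  "('a, 'k) free_complex \<Rightarrow> nat \<Rightarrow> nat \<Rightarrow> ((nat \<Rightarrow>\<^sub>0 'a) \<Rightarrow> 'k) \<Rightarrow> ((nat \<Rightarrow>\<^sub>0 'a) \<Rightarrow> 'k) set" where
  "ext_class P n m f = {f' \<in> cocycles P n m. (\<lambda>u. f' u - f u) \<in> coboundaries P n m}"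

text \<open>\<open>E\<^sup>n\<^sup>,\<^sup>m\<close>, as a set of cohomology classes.\<close>

definition Ext :: "('a, 'k) free_complex \<Rightarrow> nat \<Rightarrow> nat \<Rightarrow> ((nat \<Rightarrow>\<^sub>0 'a) \<Rightarrow> 'k) set set" where
  "Ext P n m = ext_class P n m ` cocycles P n m"

text \<open>
  \<open>\<Phi>\<close> is a chain map \<open>P\<^sub>\<bullet>\<^sub>+\<^sub>q \<rightarrow> P\<^sub>\<bullet>\<close> of internal degree \<open>-m\<close> lifting the cocycle \<open>h : P\<^sub>q \<rightarrow> K\<close>.
\<close>

definition chain_lift ::
  "('a, 'k) free_complex \<Rightarrow> nat \<Rightarrow> nat \<Rightarrow> ((nat \<Rightarrow>\<^sub>0 'a) \<Rightarrow> 'k) \<Rightarrow>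
   (nat \<Rightarrow> (nat \<Rightarrow>\<^sub>0 'a) \<Rightarrow> (nat \<Rightarrow>\<^sub>0 'a)) \<Rightarrow> bool" where
  "chain_lift P q m h \<Phi> \<longleftrightarrow>
     (\<forall>i. module_hom P (i + q) i (\<Phi> i)) \<and>
     (\<forall>i j. \<Phi> i ` free_component P (i + q) (j + m) \<subseteq> free_component P i j) \<and>
     (\<forall>i j. j < m \<longrightarrow> \<Phi> i ` free_component P (i + q) j \<subseteq> {0}) \<and>
     (\<forall>u \<in> free_module P q. augm P (\<Phi> 0 u) = h u) \<and>
     (\<forall>i. \<forall>u \<in> free_module P (Suc i + q). diff P i (\<Phi> (Suc i) u) = \<Phi> i (diff P (i + q) u))"

text \<open>
  The Yoneda product \<open>E\<^sup>p\<^sup>,\<^sup>l \<times> E\<^sup>q\<^sup>,\<^sup>m \<rightarrow> E\<^sup>p\<^sup>+\<^sup>q\<^sup>,\<^sup>l\<^sup>+\<^sup>m\<close>: compose a cocycle of the first class with a lift of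
  a cocycle of the second.  The class obtained does not depend on these choices.  Other sign
  conventions change the product by a sign depending on the bidegrees only, which does not
  affect generated subalgebras.
\<close>

definition yoneda_product ::
  "('a, 'k) free_complex \<Rightarrow> nat \<Rightarrow> nat \<Rightarrow> ((nat \<Rightarrow>\<^sub>0 'a) \<Rightarrow> 'k) set \<Rightarrow>
   nat \<Rightarrow> nat \<Rightarrow> ((nat \<Rightarrow>\<^sub>0 'a) \<Rightarrow> 'k) set \<Rightarrow> ((nat \<Rightarrow>\<^sub>0 'a) \<Rightarrow> 'k) set" where
  "yoneda_product P p l \<alpha> q m \<beta> =
     {z. \<exists>f\<in>\<alpha>. \<exists>h\<in>\<beta>. \<exists>\<Phi>. chain_lift P q m h \<Phi> \<and>
           z \<in> ext_class P (p + q) (l + m) (restrict0 P (p + q) (f \<circ> \<Phi> p))}"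

text \<open>
  The bihomogeneous elements of the (unital) subalgebra of the Yoneda algebra generated by \<open>E\<^sup>1\<close>
  and \<open>E\<^sup>2\<close>.  Since \<open>E\<^sup>1\<close> and \<open>E\<^sup>2\<close> are spanned by bihomogeneous elements, so is this subalgebra.
  The unit is the class of the augmentation, in bidegree \<open>(0, 0)\<close>.
\<close>

inductive generated ::
  "('a, 'k) free_complex \<Rightarrow> nat \<Rightarrow> nat \<Rightarrow> ((nat \<Rightarrow>\<^sub>0 'a) \<Rightarrow> 'k) set \<Rightarrow> bool"
  for P :: "('a, 'k) free_complex"
where
  one: "generated P 0 0 (ext_class P 0 0 (restrict0 P 0 (augm P)))"
| E1: "\<alpha> \<in> Ext P 1 m \<Longrightarrow> generated P 1 m \<alpha>"
| E2: "\<alpha> \<in> Ext P 2 m \<Longrightarrow> generated P 2 m \<alpha>"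
| zero: "generated P n m (ext_class P n m (\<lambda>u. 0))"
| lincomb: "f \<in> cocycles P n m \<Longrightarrow> h \<in> cocycles P n m \<Longrightarrow>
    generated P n m (ext_class P n m f) \<Longrightarrow> generated P n m (ext_class P n m h) \<Longrightarrow>
    generated P n m (ext_class P n m (\<lambda>u. a * f u + b * h u))"
| mult: "generated P p l \<alpha> \<Longrightarrow> generated P q m \<beta> \<Longrightarrow>
    generated P (p + q) (l + m) (yoneda_product P p l \<alpha> q m \<beta>)"

end

text \<open>
  The Yoneda algebra does not depend, up to isomorphism of bigraded algebras, on the resolution
  used to compute it, so it makes no difference which one is taken.
\<close>

definition K2_algebra :: "('k::field \<Rightarrow> 'a::ring_1 \<Rightarrow> 'a) \<Rightarrow> (nat \<Rightarrow> 'a set) \<Rightarrow> bool" where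
  "K2_algebra scale G \<longleftrightarrow>
     connected_graded_algebra scale G \<and>
     (\<exists>P :: ('a, 'k) free_complex.
        connected_graded_algebra.free_resolution scale G P \<and>
        (\<forall>n m. \<forall>\<alpha> \<in> connected_graded_algebra.Ext scale G P n m.
           connected_graded_algebra.generated scale G P n m \<alpha>))"

end

theory Submission
  imports Defs
begin

text \<open>
  Write \<open>B = A/gA\<close> and let \<open>Q\<close> be a graded free resolution of \<open>K\<close> over \<open>B\<close>.  Behind the theorem is the
  Gysin sequence of the change of rings from \<open>A\<close> to \<open>B\<close>.  As \<open>g\<close> is normal and regular of degree 1,
  \<open>B\<close> has over \<open>A\<close> the resolution \<open>0 \<rightarrow> A(-1) \<rightarrow> A \<rightarrow> B \<rightarrow> 0\<close>, and the long exact sequence that results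
  breaks up into short ones,
  \<open>0 \<rightarrow> E\<^sup>n(B) \<rightarrow> E\<^sup>n(A) \<rightarrow> E\<^sup>n\<^sup>-\<^sup>1(B) \<rightarrow> 0\<close>, the last map lowering the internal degree by 1: the connecting
  map is given by a class in \<open>E\<^sup>2\<^sup>,\<^sup>1(B)\<close>, a space that is zero.  The first map, inflation, is a
  homomorphism of algebras, and the second sends some \<open>\<gamma> \<in> E\<^sup>1\<^sup>,\<^sup>1(A)\<close> to \<open>1\<close>.  Hence
  \<open>E(A) = E(B) + \<gamma> E(B)\<close>; if \<open>E(B)\<close> is generated in cohomological degrees 1 and 2, so is \<open>E(A)\<close>.

  The proof makes this explicit on cochains, so that neither spectral sequences nor minimal
  resolutions enter.  Lift the differentials of \<open>Q\<close> to maps between free \<open>A\<close>-modules \<open>F n\<close> on the same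
  bases.  The lifts compose to zero only modulo \<open>g\<close>, but what vanishes modulo \<open>g\<close> can be divided by \<open>g\<close>
  on the right, uniquely, since \<open>gA = Ag\<close> and \<open>g\<close> is regular.  Adding to \<open>F n\<close> a shifted copy \<open>E n\<close> of
  \<open>F (n - 1)\<close>, the generators of which are sent to multiples of \<open>g\<close>, gives a resolution \<open>P\<close> of \<open>K\<close> over \<open>A\<close>
  (\<open>P_resolution\<close>).  Every component of a map into the odd part \<open>E n\<close> is a quotient by \<open>g\<close>, and every
  identity between such components follows by multiplying by \<open>g\<close> and cancelling.

  A chain map that lifts a cocycle over \<open>Q\<close> extends to \<open>P\<close> strictly compatibly with the reduction
  \<open>P \<rightarrow> Q\<close> (\<open>chain_lift_inflate\<close>).  Since the Yoneda product may be computed with any lift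
  (\<open>yoneda_product_class\<close>), inflation therefore carries generated classes to generated classes
  (\<open>inflate_generated\<close>).  The restriction of a cocycle of \<open>P\<close> to the odd part is a cocycle of \<open>Q\<close>
  (\<open>odd_part_cocycle\<close>); the product of \<open>\<gamma>\<close> with its inflation has the same odd part
  (\<open>gamma_times_inflate\<close>), and a cocycle without odd part is inflated (\<open>uninflate\<close>).
\<close>

section \<open>Homogeneous components\<close>

abbreviation coord :: "('x \<Rightarrow>\<^sub>0 'a::zero) \<Rightarrow> 'x \<Rightarrow> 'a" where
  "coord \<equiv> Poly_Mapping.lookup"

abbreviation supp :: "('x \<Rightarrow>\<^sub>0 'a::zero) \<Rightarrow> 'x set" where
  "supp \<equiv> Poly_Mapping.keys"

abbreviation basis :: "nat \<Rightarrow> (nat \<Rightarrow>\<^sub>0 'a::ring_1)" where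
  "basis x \<equiv> Poly_Mapping.single x 1"

context connected_graded_algebra
begin

lemma G_zero [simp]: "0 \<in> G n"
  using subspace_0[OF subspace_component] .

lemma G_add: "a \<in> G n \<Longrightarrow> b \<in> G n \<Longrightarrow> a + b \<in> G n"
  using subspace_add[OF subspace_component] .

lemma G_diff: "a \<in> G n \<Longrightarrow> b \<in> G n \<Longrightarrow> a - b \<in> G n"
  using subspace_diff[OF subspace_component] .

lemma G_scale: "a \<in> G n \<Longrightarrow> scale c a \<in> G n"
  using subspace_scale[OF subspace_component] .

lemma G_one: "1 \<in> G 0"
  unfolding connected by (metis rangeI scale_one)

definition hpart :: "'a \<Rightarrow> nat \<Rightarrow> 'a" where
  "hpart a = (THE f. (\<forall>n. f n \<in> G n) \<and> finite {n. f n \<noteq> 0} \<and> a = (\<Sum>n\<in>{n. f n \<noteq> 0}. f n))"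

lemma hpart_props:
  "(\<forall>n. hpart a n \<in> G n) \<and> finite {n. hpart a n \<noteq> 0} \<and> a = (\<Sum>n\<in>{n. hpart a n \<noteq> 0}. hpart a n)"
  unfolding hpart_def by (rule theI'[OF decomposition])

lemma hpart_in: "hpart a n \<in> G n"
  and hpart_finite: "finite {n. hpart a n \<noteq> 0}"
  and hpart_sum: "(\<Sum>n\<in>{n. hpart a n \<noteq> 0}. hpart a n) = a"
  using hpart_props by auto

lemma hpart_eqI:
  assumes "\<And>n. f n \<in> G n" "finite S" "\<And>n. n \<notin> S \<Longrightarrow> f n = 0" "a = sum f S"
  shows "hpart a = f"
proof -
  have sub: "{n. f n \<noteq> 0} \<subseteq> S" using assms(3) by auto
  then have "finite {n. f n \<noteq> 0}" using assms(2) finite_subset by blast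
  moreover have "a = (\<Sum>n\<in>{n. f n \<noteq> 0}. f n)"
    unfolding assms(4) using sub assms(2) by (intro sum.mono_neutral_right) auto
  ultimately show ?thesis
    using decomposition[of a] hpart_props[of a] assms(1) by blast
qed

lemma hpart_sum_superset:
  assumes "finite S" "{n. hpart a n \<noteq> 0} \<subseteq> S"
  shows "sum (hpart a) S = a"
  using assms by (subst (2) hpart_sum[symmetric], intro sum.mono_neutral_right) auto

lemma hpart_homogeneous: "a \<in> G n \<Longrightarrow> hpart a = (\<lambda>k. if k = n then a else 0)"
  by (rule hpart_eqI[where S = "{n}"]) auto

lemma homogeneousI: "(\<And>k. k \<noteq> n \<Longrightarrow> hpart a k = 0) \<Longrightarrow> a \<in> G n"
  using hpart_sum_superset[of "{n}" a] hpart_in[of a n] by fastforce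

lemma hpart_zero [simp]: "hpart 0 n = 0"
  using hpart_homogeneous[OF G_zero] by simp

lemma hpart_add: "hpart (a + b) n = hpart a n + hpart b n"
proof -
  let ?S = "{n. hpart a n \<noteq> 0} \<union> {n. hpart b n \<noteq> 0}"
  have fin: "finite ?S" using hpart_finite by blast
  have "hpart (a + b) = (\<lambda>n. hpart a n + hpart b n)"
  proof (rule hpart_eqI[OF _ fin])
    show "a + b = (\<Sum>n\<in>?S. hpart a n + hpart b n)"
      using hpart_sum_superset[OF fin, of a] hpart_sum_superset[OF fin, of b]
      by (simp add: sum.distrib)
  qed (auto intro: G_add hpart_in)
  then show ?thesis by simp
qed

lemma hpart_diff: "hpart (a - b) n = hpart a n - hpart b n"
  using hpart_add[of "a - b" b n] by (simp add: algebra_simps)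

lemma homogeneous_induct [case_names zero homogeneous add]:
  assumes "P 0" "\<And>a n. a \<in> G n \<Longrightarrow> P a" "\<And>a b. P a \<Longrightarrow> P b \<Longrightarrow> P (a + b)"
  shows "P a"
proof -
  have "P (sum (hpart a) S)" if "finite S" for S
    using that
  proof induction
    case (insert x F)
    then show ?case using assms(2)[OF hpart_in] assms(3) by simp
  qed (simp add: assms(1))
  then show ?thesis using hpart_finite[of a] hpart_sum[of a] by metis
qed

lemma hpart_mult_right:
  assumes "b \<in> G m"
  shows "hpart (a * b) k = (if m \<le> k then hpart a (k - m) * b else 0)"
proof (induction a rule: homogeneous_induct)
  case (homogeneous a n)
  then have "a * b \<in> G (n + m)" using assms component_mult by blast
  then show ?case using homogeneous by (auto simp: hpart_homogeneous)
qed (auto simp: hpart_add algebra_simps)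

lemma hpart_mult_left:
  assumes "b \<in> G m"
  shows "hpart (b * a) k = (if m \<le> k then b * hpart a (k - m) else 0)"
proof (induction a rule: homogeneous_induct)
  case (homogeneous a n)
  then have "b * a \<in> G (m + n)" using assms component_mult by blast
  then show ?case using homogeneous by (auto simp: hpart_homogeneous)
qed (auto simp: hpart_add algebra_simps)

lemma hpart_mult_0: "hpart (a * b) 0 = hpart a 0 * hpart b 0"
proof (induction b rule: homogeneous_induct)
  case (homogeneous b n)
  then show ?case by (auto simp: hpart_mult_right[OF homogeneous] hpart_homogeneous)
qed (auto simp: hpart_add algebra_simps)

lemma hpart_mult_1: "hpart (a * b) 1 = hpart a 0 * hpart b 1 + hpart a 1 * hpart b 0"
proof (induction b rule: homogeneous_induct)
  case (homogeneous b n)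
  then consider "n = 0" | "n = 1" | "n > 1" by linarith
  then show ?case by cases (auto simp: hpart_mult_right[OF homogeneous] hpart_homogeneous[OF homogeneous])
qed (auto simp: hpart_add algebra_simps)

lemma scale_one_cancel [simp]: "scale c (1::'a) = scale d 1 \<longleftrightarrow> c = d"
  by (simp add: scale_cancel_right)

text \<open>
  The augmentation and its multiplicativity are easiest to handle through the component of
  degree 0, which lies in \<open>K 1\<close>; this identifies the kernel.
\<close>

lemma augmentation_ideal_iff: "a \<in> augmentation_ideal \<longleftrightarrow> hpart a 0 = 0"
proof
  have "subspace {a. hpart a 0 = 0}"
    unfolding subspace_def
  proof (intro conjI allI impI ballI; clarsimp simp: hpart_add)
    fix c a assume "hpart a 0 = 0"
    have "hpart (scale c 1 * a) 0 = hpart (scale c 1) 0 * hpart a 0" by (rule hpart_mult_0)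
    then show "hpart (scale c a) 0 = 0"
      using \<open>hpart a 0 = 0\<close> by (simp add: scale_mult_left)
  qed
  moreover have "(\<Union>n\<in>{1..}. G n) \<subseteq> {a. hpart a 0 = 0}"
    by (auto simp: hpart_homogeneous)
  ultimately have "augmentation_ideal \<subseteq> {a. hpart a 0 = 0}"
    unfolding augmentation_ideal_def by (rule span_minimal[rotated])
  then show "a \<in> augmentation_ideal \<Longrightarrow> hpart a 0 = 0" by blast
next
  assume "hpart a 0 = 0"
  then have "hpart a n \<in> span (\<Union>n\<in>{1..}. G n)" for n
    by (cases "n = 0") (auto intro!: span_base bexI[of _ n] simp: span_zero hpart_in)
  then have "sum (hpart a) {n. hpart a n \<noteq> 0} \<in> augmentation_ideal"
    unfolding augmentation_ideal_def by (intro span_sum)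
  then show "a \<in> augmentation_ideal" by (simp add: hpart_sum)
qed

lemma hpart_0_eq: "hpart a 0 = scale (aug a) 1"
proof -
  obtain c where c: "hpart a 0 = scale c 1"
    using hpart_in[of a 0] unfolding connected by auto
  have "hpart (scale d 1) 0 = scale d 1" for d
    using hpart_homogeneous[OF G_scale[OF G_one]] by simp
  then have "a - scale d 1 \<in> augmentation_ideal \<longleftrightarrow> d = c" for d
    by (auto simp: augmentation_ideal_iff hpart_diff c)
  then show ?thesis unfolding aug_def c by simp
qed

lemma aug_eqI: "hpart a 0 = scale c 1 \<Longrightarrow> aug a = c"
  by (simp add: hpart_0_eq)

lemma aug_zero [simp]: "aug 0 = 0"
  by (rule aug_eqI) simp

lemma aug_add: "aug (a + b) = aug a + aug b"
  by (rule aug_eqI) (metis hpart_add hpart_0_eq scale_left_distrib)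

lemma aug_mult: "aug (a * b) = aug a * aug b"
  by (rule aug_eqI) (metis hpart_mult_0 hpart_0_eq scale_mult_left mult_1_left scale_scale)

lemma aug_scale_one: "aug (scale c 1) = c"
  by (rule aug_eqI) (simp add: hpart_homogeneous[OF G_scale[OF G_one]])

lemma aug_one [simp]: "aug 1 = 1"
  using aug_scale_one[of 1] by simp

lemma aug_pos: "a \<in> G n \<Longrightarrow> n > 0 \<Longrightarrow> aug a = 0"
  by (rule aug_eqI) (simp add: hpart_homogeneous)

section \<open>Free modules\<close>

lemma coord_smult [simp]: "coord (smult a u) x = a * coord u x"
  unfolding smult_def by (simp add: Poly_Mapping.map.rep_eq when_def)

lemma smult_zero [simp]: "smult a 0 = 0" "smult 0 u = 0"
  by (simp_all add: poly_mapping_eq_iff fun_eq_iff)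

lemma smult_add: "smult a (u + v) = smult a u + smult a v"
  by (simp add: poly_mapping_eq_iff fun_eq_iff lookup_add algebra_simps)

lemma smult_add_left: "smult (a + b) u = smult a u + smult b u"
  by (simp add: poly_mapping_eq_iff fun_eq_iff lookup_add algebra_simps)

lemma smult_smult: "smult a (smult b u) = smult (a * b) u"
  by (simp add: poly_mapping_eq_iff fun_eq_iff algebra_simps)

lemma smult_one [simp]: "smult 1 u = u"
  by (simp add: poly_mapping_eq_iff fun_eq_iff)

lemma smult_minus_one: "smult (- 1) u = - u"
  by (simp add: poly_mapping_eq_iff fun_eq_iff)

lemma smult_uminus: "smult a (- u) = - smult a u"
  by (simp add: poly_mapping_eq_iff fun_eq_iff)

lemma smult_sum: "smult a (sum f S) = (\<Sum>x\<in>S. smult a (f x))"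
  by (induction S rule: infinite_finite_induct) (auto simp: smult_add)

lemma basis_expansion:
  assumes "finite S" "supp u \<subseteq> S"
  shows "u = (\<Sum>x\<in>S. smult (coord u x) (basis x))"
proof (rule poly_mapping_eqI)
  fix k
  have "coord (\<Sum>x\<in>S. smult (coord u x) (basis x)) k = (\<Sum>x\<in>S. if x = k then coord u k else 0)"
    unfolding lookup_sum by (rule sum.cong) (auto simp: lookup_single when_def)
  also have "\<dots> = coord u k" using assms by (auto simp: sum.delta in_keys_iff)
  finally show "coord u k = coord (\<Sum>x\<in>S. smult (coord u x) (basis x)) k" by simp
qed

lemma free_module_iff: "u \<in> free_module X n \<longleftrightarrow> (\<forall>x. coord u x \<noteq> 0 \<longrightarrow> x \<in> gens X n)"
  by (auto simp: free_module_def in_keys_iff)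

lemma free_module_zero [simp]: "0 \<in> free_module X n"
  by (simp add: free_module_iff)

lemma free_module_add: "u \<in> free_module X n \<Longrightarrow> v \<in> free_module X n \<Longrightarrow> u + v \<in> free_module X n"
  unfolding free_module_iff lookup_add by (metis add_0)

lemma free_module_diff: "u \<in> free_module X n \<Longrightarrow> v \<in> free_module X n \<Longrightarrow> u - v \<in> free_module X n"
  unfolding free_module_iff lookup_minus by (metis diff_0_right)

lemma free_module_smult: "u \<in> free_module X n \<Longrightarrow> smult a u \<in> free_module X n"
  unfolding free_module_iff coord_smult by (metis mult_zero_right)

lemma free_module_uminus: "u \<in> free_module X n \<Longrightarrow> - u \<in> free_module X n"
  by (auto simp: free_module_iff)

lemma free_module_sum: "(\<And>x. x \<in> S \<Longrightarrow> f x \<in> free_module X n) \<Longrightarrow> sum f S \<in> free_module X n"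
  by (induction S rule: infinite_finite_induct) (auto intro: free_module_add)

lemma basis_in_free_module: "x \<in> gens X n \<Longrightarrow> basis x \<in> free_module X n"
  by (auto simp: free_module_iff lookup_single when_def)

lemma free_module_induct [consumes 1, case_names zero basis add]:
  assumes "u \<in> free_module X n"
    and "P 0"
    and "\<And>a x. x \<in> gens X n \<Longrightarrow> P (smult a (basis x))"
    and "\<And>u v. u \<in> free_module X n \<Longrightarrow> v \<in> free_module X n \<Longrightarrow> P u \<Longrightarrow> P v \<Longrightarrow> P (u + v)"
  shows "P u"
proof -
  have "P (\<Sum>x\<in>S. smult (coord u x) (basis x))" if "finite S" "S \<subseteq> gens X n" for S
    using that
  proof induction
    case (insert x S)
    then show ?case
      by (auto intro!: assms(3,4) free_module_smult free_module_sum basis_in_free_module)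
  qed (simp add: assms(2))
  from this[of "supp u"] show ?thesis
    using assms(1) basis_expansion[of "supp u" u] by (simp add: free_module_def)
qed

text \<open>
  The component of degree \<open>j\<close> of the free module \<open>A(-d)\<close> on one generator of degree \<open>d\<close>.
\<close>

definition shifted :: "nat \<Rightarrow> nat \<Rightarrow> 'a set" where
  "shifted d j = (if d \<le> j then G (j - d) else {0})"

lemma shifted_zero [simp]: "0 \<in> shifted d j"
  by (simp add: shifted_def)

lemma shifted_add: "a \<in> shifted d j \<Longrightarrow> b \<in> shifted d j \<Longrightarrow> a + b \<in> shifted d j"
  by (auto simp: shifted_def G_add split: if_splits)

lemma shifted_uminus: "a \<in> shifted d j \<Longrightarrow> - a \<in> shifted d j"
  using G_diff[OF G_zero] by (fastforce simp: shifted_def split: if_splits)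

lemma shifted_mult: "a \<in> G i \<Longrightarrow> b \<in> shifted d j \<Longrightarrow> a * b \<in> shifted d (i + j)"
  using component_mult[of a i b "j - d"] by (auto simp: shifted_def split: if_splits)

lemma free_component_iff:
  "u \<in> free_component X n j \<longleftrightarrow>
     u \<in> free_module X n \<and> (\<forall>x. coord u x \<in> shifted (gdeg X n x) j)"
proof -
  have "(\<exists>i. gdeg X n x + i = j \<and> a \<in> G i) \<longleftrightarrow> gdeg X n x \<le> j \<and> a \<in> G (j - gdeg X n x)" for x a
    by (auto intro: exI[of _ "j - gdeg X n x"])
  then show ?thesis
    unfolding free_component_def shifted_def by (auto simp: in_keys_iff)
qed

lemma free_component_subset: "u \<in> free_component X n j \<Longrightarrow> u \<in> free_module X n"
  by (simp add: free_component_def)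

lemma free_component_zero [simp]: "0 \<in> free_component X n j"
  by (simp add: free_component_iff)

lemma free_component_add:
  "u \<in> free_component X n j \<Longrightarrow> v \<in> free_component X n j \<Longrightarrow> u + v \<in> free_component X n j"
  by (simp add: free_component_iff lookup_add free_module_add shifted_add)

lemma free_component_uminus: "u \<in> free_component X n j \<Longrightarrow> - u \<in> free_component X n j"
  by (simp add: free_component_iff free_module_uminus shifted_uminus)

lemma free_component_sum:
  "(\<And>x. x \<in> S \<Longrightarrow> f x \<in> free_component X n j) \<Longrightarrow> sum f S \<in> free_component X n j"
  by (induction S rule: infinite_finite_induct) (auto intro: free_component_add)

lemma free_component_smult:
  "a \<in> G i \<Longrightarrow> u \<in> free_component X n j \<Longrightarrow> smult a u \<in> free_component X n (i + j)"
  by (simp add: free_component_iff free_module_smult shifted_mult)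

lemma basis_in_free_component: "x \<in> gens X n \<Longrightarrow> basis x \<in> free_component X n (gdeg X n x)"
  by (auto simp: free_component_iff basis_in_free_module lookup_single when_def G_one shifted_def)

definition module_part :: "('a, 'k) free_complex \<Rightarrow> nat \<Rightarrow> nat \<Rightarrow> (nat \<Rightarrow>\<^sub>0 'a) \<Rightarrow> (nat \<Rightarrow>\<^sub>0 'a)" where
  "module_part X n j u =
     Poly_Mapping.mapp (\<lambda>x a. if gdeg X n x \<le> j then hpart a (j - gdeg X n x) else 0) u"

lemma coord_module_part:
  "coord (module_part X n j u) x = (if gdeg X n x \<le> j then hpart (coord u x) (j - gdeg X n x) else 0)"
  by (auto simp: module_part_def lookup_mapp when_def in_keys_iff)

lemma module_part_add: "module_part X n j (u + v) = module_part X n j u + module_part X n j v"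
  by (simp add: poly_mapping_eq_iff fun_eq_iff lookup_add coord_module_part hpart_add)

lemma module_part_zero [simp]: "module_part X n j 0 = 0"
  by (simp add: poly_mapping_eq_iff fun_eq_iff coord_module_part)

lemma module_part_sum: "module_part X n j (sum f S) = (\<Sum>x\<in>S. module_part X n j (f x))"
  by (induction S rule: infinite_finite_induct) (auto simp: module_part_add)

lemma module_part_in: "u \<in> free_module X n \<Longrightarrow> module_part X n j u \<in> free_component X n j"
  unfolding free_component_iff free_module_iff coord_module_part shifted_def
  using hpart_in by (auto split: if_splits) (metis hpart_zero)

lemma module_part_homogeneous:
  assumes "u \<in> free_component X n i"
  shows "module_part X n j u = (if i = j then u else 0)"
proof (rule poly_mapping_eqI)
  fix x
  have x: "coord u x \<in> shifted (gdeg X n x) i"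
    using assms by (simp add: free_component_iff)
  show "coord (module_part X n j u) x = coord (if i = j then u else 0) x"
  proof (cases "gdeg X n x \<le> i")
    case True
    then have "coord u x \<in> G (i - gdeg X n x)" using x by (simp add: shifted_def)
    from hpart_homogeneous[OF this] show ?thesis using True by (auto simp: coord_module_part)
  next
    case False
    then have "coord u x = 0" using x by (simp add: shifted_def)
    then show ?thesis by (auto simp: coord_module_part)
  qed
qed

lemma module_part_expansion: "\<exists>N. \<forall>M\<ge>N. u = (\<Sum>j<M. module_part X n j u)"
proof -
  let ?D = "\<lambda>x. Max (insert 0 {n. hpart (coord u x) n \<noteq> 0})"
  define N where "N = Suc (\<Sum>x\<in>supp u. gdeg X n x + ?D x)"
  have bound: "gdeg X n x + i < N" if "hpart (coord u x) i \<noteq> 0" for x i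
  proof -
    have "x \<in> supp u" using that by (auto simp: in_keys_iff)
    then have "gdeg X n x + ?D x \<le> (\<Sum>x\<in>supp u. gdeg X n x + ?D x)"
      by (intro member_le_sum) auto
    moreover have "i \<le> ?D x" using that by (intro Max_ge) (auto simp: hpart_finite)
    ultimately show ?thesis by (simp add: N_def)
  qed
  have "u = (\<Sum>j<M. module_part X n j u)" if "M \<ge> N" for M
  proof (rule poly_mapping_eqI)
    fix x
    let ?a = "coord u x" and ?d = "gdeg X n x"
    have "(\<Sum>j<M. coord (module_part X n j u) x) = (\<Sum>j\<in>{?d..<M}. hpart ?a (j - ?d))"
      by (rule sum.mono_neutral_cong_right) (auto simp: coord_module_part)
    also have "\<dots> = (\<Sum>i\<in>{i. ?d + i < M}. hpart ?a i)"
      by (rule sum.reindex_bij_witness[where i = "\<lambda>i. ?d + i" and j = "\<lambda>j. j - ?d"]) auto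
    also have "\<dots> = ?a"
      by (rule hpart_sum_superset) (auto dest!: bound intro: finite_subset[of _ "{..<M}"] less_le_trans[OF _ that])
    finally show "?a = coord (\<Sum>j<M. module_part X n j u) x" by (simp add: lookup_sum)
  qed
  then show ?thesis by blast
qed

section \<open>Graded homomorphisms\<close>

text \<open>
  Maps of internal degree \<open>-m\<close>.  As degrees are natural numbers, components of degree below \<open>m\<close> have
  nowhere to go, so that they must be killed.  The domain and the codomain may belong to different
  complexes: the summands of a resolution are compared with the resolution itself.
\<close>

definition graded_hom ::
  "('a, 'k) free_complex \<Rightarrow> nat \<Rightarrow> ('a, 'k) free_complex \<Rightarrow> nat \<Rightarrow> nat \<Rightarrow>
   ((nat \<Rightarrow>\<^sub>0 'a) \<Rightarrow> (nat \<Rightarrow>\<^sub>0 'a)) \<Rightarrow> bool" where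
  "graded_hom X n Y i m \<phi> \<longleftrightarrow>
     (\<forall>u \<in> free_module X n. \<phi> u \<in> free_module Y i) \<and>
     (\<forall>u \<in> free_module X n. \<forall>v \<in> free_module X n. \<phi> (u + v) = \<phi> u + \<phi> v) \<and>
     (\<forall>a. \<forall>u \<in> free_module X n. \<phi> (smult a u) = smult a (\<phi> u)) \<and>
     (\<forall>j. \<forall>u \<in> free_component X n (j + m). \<phi> u \<in> free_component Y i j) \<and>
     (\<forall>j<m. \<forall>u \<in> free_component X n j. \<phi> u = 0)"

lemma graded_homD:
  assumes "graded_hom X n Y i m \<phi>"
  shows "\<And>u. u \<in> free_module X n \<Longrightarrow> \<phi> u \<in> free_module Y i"
    and "\<And>u v. u \<in> free_module X n \<Longrightarrow> v \<in> free_module X n \<Longrightarrow> \<phi> (u + v) = \<phi> u + \<phi> v"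
    and "\<And>a u. u \<in> free_module X n \<Longrightarrow> \<phi> (smult a u) = smult a (\<phi> u)"
    and "\<And>u j. u \<in> free_component X n (j + m) \<Longrightarrow> \<phi> u \<in> free_component Y i j"
    and "\<And>u j. u \<in> free_component X n j \<Longrightarrow> j < m \<Longrightarrow> \<phi> u = 0"
    and "\<phi> 0 = 0"
    and "\<And>u v. u \<in> free_module X n \<Longrightarrow> v \<in> free_module X n \<Longrightarrow> \<phi> (u - v) = \<phi> u - \<phi> v"
    and "\<And>u. u \<in> free_module X n \<Longrightarrow> \<phi> (- u) = - \<phi> u"
proof -
  note d = assms[unfolded graded_hom_def]
  show *: "\<And>u. u \<in> free_module X n \<Longrightarrow> \<phi> u \<in> free_module Y i"
    "\<And>u v. u \<in> free_module X n \<Longrightarrow> v \<in> free_module X n \<Longrightarrow> \<phi> (u + v) = \<phi> u + \<phi> v"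
    "\<And>a u. u \<in> free_module X n \<Longrightarrow> \<phi> (smult a u) = smult a (\<phi> u)"
    "\<And>u j. u \<in> free_component X n (j + m) \<Longrightarrow> \<phi> u \<in> free_component Y i j"
    "\<And>u j. u \<in> free_component X n j \<Longrightarrow> j < m \<Longrightarrow> \<phi> u = 0"
    using d by blast+
  show "\<phi> 0 = 0" using *(3)[of 0 0] by simp
  show "\<phi> (u - v) = \<phi> u - \<phi> v" if "u \<in> free_module X n" "v \<in> free_module X n" for u v
    using *(2)[of "u - v" v] that by (simp add: free_module_diff)
  show "\<phi> (- u) = - \<phi> u" if "u \<in> free_module X n" for u
    using *(3)[OF that, of "- 1"] by (simp add: smult_minus_one)
qed

lemma graded_hom_sum:
  assumes "graded_hom X n Y i m \<phi>" "\<And>x. x \<in> S \<Longrightarrow> f x \<in> free_module X n"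
  shows "\<phi> (sum f S) = (\<Sum>x\<in>S. \<phi> (f x))"
  using assms(2)
  by (induction S rule: infinite_finite_induct)
    (auto simp: graded_homD[OF assms(1)] free_module_sum)

lemma graded_hom_basis:
  assumes "graded_hom X n Y i m \<phi>" "u \<in> free_module X n"
  shows "\<phi> u = (\<Sum>x\<in>supp u. smult (coord u x) (\<phi> (basis x)))"
proof -
  have b: "basis x \<in> free_module X n" if "x \<in> supp u" for x
    using that assms(2) by (auto intro: basis_in_free_module simp: free_module_def)
  have "\<phi> u = \<phi> (\<Sum>x\<in>supp u. smult (coord u x) (basis x))"
    using basis_expansion[of "supp u" u] by simp
  also have "\<dots> = (\<Sum>x\<in>supp u. \<phi> (smult (coord u x) (basis x)))"
    by (rule graded_hom_sum[OF assms(1)]) (simp add: b free_module_smult)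
  also have "\<dots> = (\<Sum>x\<in>supp u. smult (coord u x) (\<phi> (basis x)))"
    by (rule sum.cong) (simp_all add: b graded_homD(3)[OF assms(1)])
  finally show ?thesis .
qed

lemma graded_hom_zero: "graded_hom X n Y i m (\<lambda>u. 0)"
  by (simp add: graded_hom_def)

lemma graded_hom_add:
  "graded_hom X n Y i m \<phi> \<Longrightarrow> graded_hom X n Y i m \<psi> \<Longrightarrow> graded_hom X n Y i m (\<lambda>u. \<phi> u + \<psi> u)"
  unfolding graded_hom_def by (simp add: free_module_add free_component_add smult_add)

lemma graded_hom_uminus:
  "graded_hom X n Y i m \<phi> \<Longrightarrow> graded_hom X n Y i m (\<lambda>u. - \<phi> u)"
  unfolding graded_hom_def
  by (simp add: free_module_uminus free_component_uminus smult_uminus)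

lemma graded_hom_diff:
  "graded_hom X n Y i m \<phi> \<Longrightarrow> graded_hom X n Y i m \<psi> \<Longrightarrow> graded_hom X n Y i m (\<lambda>u. \<phi> u - \<psi> u)"
  using graded_hom_add[OF _ graded_hom_uminus] by fastforce

lemma graded_hom_comp:
  assumes "graded_hom X n Y i m \<phi>" "graded_hom Y i Z k l \<psi>"
  shows "graded_hom X n Z k (m + l) (\<lambda>u. \<psi> (\<phi> u))"
proof -
  have "\<psi> (\<phi> u) \<in> free_component Z k j" if "u \<in> free_component X n (j + (m + l))" for u j
    using graded_homD(4)[OF assms(1), of u "j + l"] graded_homD(4)[OF assms(2), of "\<phi> u" j] that
    by (simp add: ac_simps)
  moreover have "\<psi> (\<phi> u) = 0" if "u \<in> free_component X n j" "j < m + l" for u j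
  proof (cases "j < m")
    case True
    then show ?thesis using graded_homD[OF assms(1)] graded_homD[OF assms(2)] that by metis
  next
    case False
    then have "\<phi> u \<in> free_component Y i (j - m)" "j - m < l"
      using graded_homD(4)[OF assms(1), of u "j - m"] that by auto
    then show ?thesis using graded_homD(5)[OF assms(2)] by blast
  qed
  ultimately show ?thesis
    using assms unfolding graded_hom_def by simp
qed

text \<open>
  Both sides are additive in \<open>u\<close>, and on homogeneous elements the claim is the definition of the degree.
  Consequently preimages of homogeneous elements can be chosen homogeneous.
\<close>

lemma graded_hom_module_part:
  assumes "graded_hom X n Y i m \<phi>" "u \<in> free_module X n"
  shows "module_part Y i j (\<phi> u) = \<phi> (module_part X n (j + m) u)"
proof -
  obtain N where N: "\<And>M. M \<ge> N \<Longrightarrow> u = (\<Sum>k<M. module_part X n k u)"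
    using module_part_expansion[where X = X and n = n and u = u] by blast
  define M where "M = N + j + m + 1"
  have c: "module_part X n k u \<in> free_component X n k" for k
    using module_part_in[OF assms(2)] .
  have "\<phi> u = (\<Sum>k<M. \<phi> (module_part X n k u))"
    by (subst N[of M], simp add: M_def, intro graded_hom_sum[OF assms(1)] free_component_subset[OF c])
  moreover have "module_part Y i j (\<phi> (module_part X n k u)) = (if k = j + m then \<phi> (module_part X n k u) else 0)" for k
  proof (cases "k < m")
    case True
    then show ?thesis using graded_homD(5)[OF assms(1) c[of k]] by simp
  next
    case False
    then have "\<phi> (module_part X n k u) \<in> free_component Y i (k - m)"
      using graded_homD(4)[OF assms(1), of "module_part X n k u" "k - m"] c[of k] by simp
    then show ?thesis using False by (auto simp: module_part_homogeneous)
  qed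
  ultimately have "module_part Y i j (\<phi> u) = (\<Sum>k<M. if k = j + m then \<phi> (module_part X n k u) else 0)"
    by (simp add: module_part_sum)
  also have "\<dots> = \<phi> (module_part X n (j + m) u)" by (simp add: sum.delta M_def)
  finally show ?thesis .
qed

definition extend_linear :: "(nat \<Rightarrow> (nat \<Rightarrow>\<^sub>0 'a)) \<Rightarrow> (nat \<Rightarrow>\<^sub>0 'a) \<Rightarrow> (nat \<Rightarrow>\<^sub>0 'a)" where
  "extend_linear W u = (\<Sum>x\<in>supp u. smult (coord u x) (W x))"

lemma extend_linear_superset:
  assumes "finite S" "supp u \<subseteq> S"
  shows "extend_linear W u = (\<Sum>x\<in>S. smult (coord u x) (W x))"
  unfolding extend_linear_def using assms by (intro sum.mono_neutral_left) (auto simp: in_keys_iff)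

lemma extend_linear_add: "extend_linear W (u + v) = extend_linear W u + extend_linear W v"
proof -
  have "supp (u + v) \<subseteq> supp u \<union> supp v" by (rule keys_add)
  then show ?thesis
    using extend_linear_superset[of "supp u \<union> supp v"] by (simp add: lookup_add smult_add_left sum.distrib)
qed

lemma extend_linear_smult: "extend_linear W (smult a u) = smult a (extend_linear W u)"
proof -
  have "supp (smult a u) \<subseteq> supp u" by (auto simp: in_keys_iff)
  then show ?thesis
    using extend_linear_superset[of "supp u"] by (simp add: smult_sum smult_smult)
qed

lemma extend_linear_basis: "extend_linear W (basis x) = W x"
  by (simp add: extend_linear_def)

lemma graded_hom_extend_linear:
  assumes "\<And>x. x \<in> gens X n \<Longrightarrow> m \<le> gdeg X n x \<Longrightarrow> W x \<in> free_component Y i (gdeg X n x - m)"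
    and "\<And>x. x \<in> gens X n \<Longrightarrow> gdeg X n x < m \<Longrightarrow> W x = 0"
  shows "graded_hom X n Y i m (extend_linear W)"
proof -
  have W: "W x \<in> free_module Y i" if "x \<in> gens X n" for x
    using assms[of x] that free_component_subset by (cases "m \<le> gdeg X n x") auto
  have term_in: "smult (coord u x) (W x) \<in> free_component Y i j"
    if u: "u \<in> free_component X n (j + m)" "x \<in> supp u" for u x j
  proof -
    have x: "x \<in> gens X n" "coord u x \<in> shifted (gdeg X n x) (j + m)"
      using u by (auto simp: free_component_iff free_module_def)
    show ?thesis
    proof (cases "m \<le> gdeg X n x \<and> gdeg X n x \<le> j + m")
      case True
      then have "coord u x \<in> G (j + m - gdeg X n x)" using x by (simp add: shifted_def)
      from free_component_smult[OF this assms(1)[OF x(1)]] show ?thesis using True by simp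
    next
      case False
      then have "W x = 0 \<or> coord u x = 0"
        using assms(2)[OF x(1)] x(2) by (auto simp: shifted_def)
      then show ?thesis by auto
    qed
  qed
  have term_zero: "smult (coord u x) (W x) = 0"
    if u: "u \<in> free_component X n j" "x \<in> supp u" "j < m" for u x j
  proof -
    have x: "x \<in> gens X n" "coord u x \<in> shifted (gdeg X n x) j"
      using u by (auto simp: free_component_iff free_module_def)
    have "gdeg X n x \<le> j"
    proof (rule ccontr)
      assume "\<not> gdeg X n x \<le> j"
      then have "coord u x = 0" using x(2) by (simp add: shifted_def)
      then show False using u(2) by (simp add: in_keys_iff)
    qed
    then show ?thesis using assms(2)[OF x(1)] u(3) by simp
  qed
  show ?thesis
    unfolding graded_hom_def
  proof (intro conjI ballI allI impI)
    fix u assume "u \<in> free_module X n"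
    then show "extend_linear W u \<in> free_module Y i"
      by (auto simp: extend_linear_def free_module_def[of X n] intro!: free_module_sum free_module_smult W)
  next
    fix j u assume "u \<in> free_component X n (j + m)"
    then show "extend_linear W u \<in> free_component Y i j"
      by (auto simp: extend_linear_def intro!: free_component_sum term_in)
  next
    fix j u assume "j < m" "u \<in> free_component X n j"
    then show "extend_linear W u = 0" by (simp add: extend_linear_def term_zero)
  qed (simp_all add: extend_linear_add extend_linear_smult)
qed

text \<open>
  Lift basis elements and extend linearly.  A preimage of the image of a basis element need not be
  homogeneous, but its component of the expected degree is a preimage as well.
\<close>

lemma free_module_projective:
  assumes T: "graded_hom X n Y i m T" and D: "graded_hom Z k Y i 0 D"
    and img: "\<And>u. u \<in> free_module X n \<Longrightarrow> T u \<in> D ` free_module Z k"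
  shows "\<exists>H. graded_hom X n Z k m H \<and> (\<forall>u\<in>free_module X n. D (H u) = T u)"
proof -
  have "\<exists>w. (x \<in> gens X n \<longrightarrow> D w = T (basis x) \<and> w \<in> free_module Z k \<and>
      (if m \<le> gdeg X n x then w \<in> free_component Z k (gdeg X n x - m) else w = 0))" for x
  proof (cases "x \<in> gens X n")
    case x: True
    then obtain v where v: "v \<in> free_module Z k" "D v = T (basis x)"
      using img[OF basis_in_free_module] by force
    note b = basis_in_free_component[OF x]
    show ?thesis
    proof (cases "m \<le> gdeg X n x")
      case True
      let ?j = "gdeg X n x - m"
      have "T (basis x) \<in> free_component Y i ?j"
        using graded_homD(4)[OF T, of "basis x" ?j] b True by simp
      then have "D (module_part Z k ?j v) = T (basis x)"
        using graded_hom_module_part[OF D v(1), of ?j] v(2) by (simp add: module_part_homogeneous)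
      then show ?thesis using module_part_in[OF v(1), of ?j] free_component_subset True by auto
    next
      case False
      then have "T (basis x) = 0" using graded_homD(5)[OF T b] by simp
      then show ?thesis using False graded_homD(6)[OF D] by auto
    qed
  qed auto
  then obtain W where W: "\<And>x. x \<in> gens X n \<Longrightarrow> D (W x) = T (basis x) \<and> W x \<in> free_module Z k \<and>
      (if m \<le> gdeg X n x then W x \<in> free_component Z k (gdeg X n x - m) else W x = 0)"
    by metis
  have L: "graded_hom X n Z k m (extend_linear W)"
    using W by (intro graded_hom_extend_linear) (auto split: if_splits)
  have "D (extend_linear W u) = T u" if u: "u \<in> free_module X n" for u
  proof -
    have g: "x \<in> gens X n" if "x \<in> supp u" for x
      using that u by (auto simp: free_module_def)
    have "D (extend_linear W u) = (\<Sum>x\<in>supp u. D (smult (coord u x) (W x)))"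
      unfolding extend_linear_def using W g by (intro graded_hom_sum[OF D]) (auto intro: free_module_smult)
    also have "\<dots> = (\<Sum>x\<in>supp u. smult (coord u x) (T (basis x)))"
      using W g by (intro sum.cong) (auto simp: graded_homD(3)[OF D])
    also have "\<dots> = T u" by (rule graded_hom_basis[OF T u, symmetric])
    finally show ?thesis .
  qed
  then show ?thesis using L by blast
qed

section \<open>Functionals, cocycles and classes\<close>

lemma module_hom_KD:
  assumes "module_hom_K X n f"
  shows "\<And>u v. u \<in> free_module X n \<Longrightarrow> v \<in> free_module X n \<Longrightarrow> f (u + v) = f u + f v"
    and "\<And>a u. u \<in> free_module X n \<Longrightarrow> f (smult a u) = aug a * f u"
    and "f 0 = 0"
    and "\<And>u v. u \<in> free_module X n \<Longrightarrow> v \<in> free_module X n \<Longrightarrow> f (u - v) = f u - f v"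
proof -
  show *: "\<And>u v. u \<in> free_module X n \<Longrightarrow> v \<in> free_module X n \<Longrightarrow> f (u + v) = f u + f v"
    "\<And>a u. u \<in> free_module X n \<Longrightarrow> f (smult a u) = aug a * f u"
    using assms unfolding module_hom_K_def by blast+
  show "f 0 = 0" using *(2)[of 0 0] by simp
  show "f (u - v) = f u - f v" if "u \<in> free_module X n" "v \<in> free_module X n" for u v
    using *(1)[of "u - v" v] that by (simp add: free_module_diff)
qed

lemma module_hom_K_sum:
  assumes "module_hom_K X n f" "\<And>x. x \<in> S \<Longrightarrow> u x \<in> free_module X n"
  shows "f (sum u S) = (\<Sum>x\<in>S. f (u x))"
  using assms(2)
  by (induction S rule: infinite_finite_induct)
    (auto simp: module_hom_KD[OF assms(1)] free_module_sum)

definition extend_functional :: "(nat \<Rightarrow> 'k) \<Rightarrow> (nat \<Rightarrow>\<^sub>0 'a) \<Rightarrow> 'k" where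
  "extend_functional c u = (\<Sum>x\<in>supp u. aug (coord u x) * c x)"

lemma extend_functional_superset:
  assumes "finite S" "supp u \<subseteq> S"
  shows "extend_functional c u = (\<Sum>x\<in>S. aug (coord u x) * c x)"
  unfolding extend_functional_def using assms by (intro sum.mono_neutral_left) (auto simp: in_keys_iff)

lemma extend_functional_add: "extend_functional c (u + v) = extend_functional c u + extend_functional c v"
proof -
  have "supp (u + v) \<subseteq> supp u \<union> supp v" by (rule keys_add)
  then show ?thesis
    using extend_functional_superset[of "supp u \<union> supp v"]
    by (simp add: lookup_add aug_add sum.distrib algebra_simps)
qed

lemma extend_functional_smult: "extend_functional c (smult a u) = aug a * extend_functional c u"
proof -
  have "supp (smult a u) \<subseteq> supp u" by (auto simp: in_keys_iff)
  then show ?thesis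
    using extend_functional_superset[of "supp u"] by (simp add: aug_mult sum_distrib_left algebra_simps)
qed

lemma extend_functional_basis: "extend_functional c (basis x) = c x"
  by (simp add: extend_functional_def)

lemma extend_functional_hom: "module_hom_K X n (extend_functional c)"
  by (simp add: module_hom_K_def extend_functional_add extend_functional_smult)

lemma module_hom_K_basis:
  assumes "module_hom_K X n f" "u \<in> free_module X n"
  shows "f u = extend_functional (\<lambda>x. f (basis x)) u"
proof -
  have b: "basis x \<in> free_module X n" if "x \<in> supp u" for x
    using that assms(2) by (auto intro: basis_in_free_module simp: free_module_def)
  have "f u = f (\<Sum>x\<in>supp u. smult (coord u x) (basis x))"
    using basis_expansion[of "supp u" u] by simp
  also have "\<dots> = (\<Sum>x\<in>supp u. f (smult (coord u x) (basis x)))"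
    by (rule module_hom_K_sum[OF assms(1)]) (simp add: b free_module_smult)
  also have "\<dots> = extend_functional (\<lambda>x. f (basis x)) u"
    unfolding extend_functional_def
    by (rule sum.cong) (simp_all add: b module_hom_KD(2)[OF assms(1)])
  finally show ?thesis .
qed

lemma restrict0_in [simp]: "u \<in> free_module X n \<Longrightarrow> restrict0 X n f u = f u"
  by (simp add: restrict0_def)

lemma restrict0_idem [simp]: "restrict0 X n (restrict0 X n f) = restrict0 X n f"
  by (auto simp: restrict0_def)

lemma module_hom_K_restrict0 [simp]: "module_hom_K X n (restrict0 X n f) \<longleftrightarrow> module_hom_K X n f"
  by (simp add: module_hom_K_def free_module_add free_module_smult)

text \<open>
  A functional only sees the constant terms of the coordinates, hence its degree can be read off
  the degrees of the generators on which it does not vanish.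
\<close>

lemma cochainsI:
  assumes f: "module_hom_K X n f" and deg: "\<And>x. x \<in> gens X n \<Longrightarrow> gdeg X n x \<noteq> m \<Longrightarrow> f (basis x) = 0"
  shows "restrict0 X n f \<in> cochains X n m"
proof -
  have "f u = 0" if u: "u \<in> free_component X n j" and "j \<noteq> m" for u j
  proof -
    have "aug (coord u x) * f (basis x) = 0" if "x \<in> supp u" for x
    proof (cases "gdeg X n x = m")
      case True
      have "coord u x \<in> shifted m j"
        using u True by (auto simp: free_component_iff)
      then have "aug (coord u x) = 0"
        using \<open>j \<noteq> m\<close> aug_pos[of "coord u x" "j - m"] by (auto simp: shifted_def split: if_splits)
      then show ?thesis by simp
    next
      case False
      then show ?thesis
        using deg[of x] that free_component_subset[OF u] by (auto simp: free_module_def)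
    qed
    then show ?thesis
      using module_hom_K_basis[OF f free_component_subset[OF u]]
      unfolding extend_functional_def by (metis (no_types, lifting) sum.neutral)
  qed
  then show ?thesis
    using f by (simp add: cochains_def free_component_subset)
qed

lemma cochainsD:
  assumes "f \<in> cochains X n m"
  shows "module_hom_K X n f" "restrict0 X n f = f"
    "\<And>u j. u \<in> free_component X n j \<Longrightarrow> j \<noteq> m \<Longrightarrow> f u = 0"
  using assms unfolding cochains_def by auto

lemma cochains_eqI:
  assumes "f \<in> cochains X n m" "h \<in> cochains X n m'"
    and "\<And>u. u \<in> free_module X n \<Longrightarrow> f u = h u"
  shows "f = h"
proof -
  have "f = restrict0 X n f" "h = restrict0 X n h"
    using cochainsD(2)[OF assms(1)] cochainsD(2)[OF assms(2)] by auto
  moreover have "restrict0 X n f = restrict0 X n h"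
    using assms(3) by (auto simp: restrict0_def fun_eq_iff)
  ultimately show ?thesis by simp
qed

lemma cochain_comp:
  assumes f: "f \<in> cochains Y i l" and \<phi>: "graded_hom X n Y i m \<phi>"
  shows "restrict0 X n (f \<circ> \<phi>) \<in> cochains X n (l + m)"
proof (rule cochainsI)
  note f' = cochainsD[OF f]
  show "module_hom_K X n (f \<circ> \<phi>)"
    by (simp add: module_hom_K_def graded_homD[OF \<phi>] module_hom_KD[OF f'(1)])
  fix x assume x: "x \<in> gens X n" "gdeg X n x \<noteq> l + m"
  note b = basis_in_free_component[OF x(1)]
  show "(f \<circ> \<phi>) (basis x) = 0"
  proof (cases "gdeg X n x < m")
    case True
    then show ?thesis using graded_homD(5)[OF \<phi> b] module_hom_KD(3)[OF f'(1)] by simp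
  next
    case False
    then have "\<phi> (basis x) \<in> free_component Y i (gdeg X n x - m)"
      using graded_homD(4)[OF \<phi>, of "basis x" "gdeg X n x - m"] b by simp
    then show ?thesis using f'(3) x(2) False by simp
  qed
qed

lemma cochains_lincomb:
  assumes "f \<in> cochains X n m" "h \<in> cochains X n m"
  shows "(\<lambda>u. a * f u + b * h u) \<in> cochains X n m"
proof -
  have "restrict0 X n (\<lambda>u. a * f u + b * h u) = (\<lambda>u. a * f u + b * h u)"
    using cochainsD(2)[OF assms(1)] cochainsD(2)[OF assms(2)]
    by (auto simp: restrict0_def fun_eq_iff) (metis add_0 mult_zero_right)
  then show ?thesis
    using assms unfolding cochains_def module_hom_K_def by (simp add: algebra_simps)
qed

lemma cochains_zero: "(\<lambda>u. 0) \<in> cochains X n m"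
  by (simp add: cochains_def module_hom_K_def restrict0_def fun_eq_iff)

lemma cocycles_lincomb:
  assumes "f \<in> cocycles X n m" "h \<in> cocycles X n m"
  shows "(\<lambda>u. a * f u + b * h u) \<in> cocycles X n m"
  using assms cochains_lincomb by (auto simp: cocycles_def)

lemma coboundaries_zero: "(\<lambda>u. 0) \<in> coboundaries X n m"
proof (cases n)
  case (Suc k)
  have "restrict0 X (Suc k) ((\<lambda>u. 0) \<circ> diff X k) = (\<lambda>u. 0 :: 'k)" by (simp add: restrict0_def fun_eq_iff)
  then show ?thesis
    using cochains_zero[of X k m] unfolding Suc coboundaries.simps by (metis image_eqI)
qed simp

lemma coboundaries_lincomb:
  assumes "f \<in> coboundaries X n m" "h \<in> coboundaries X n m"
  shows "(\<lambda>u. a * f u + b * h u) \<in> coboundaries X n m"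
proof (cases n)
  case (Suc k)
  then obtain f' h' where *: "f' \<in> cochains X k m" "h' \<in> cochains X k m"
      "f = restrict0 X n (f' \<circ> diff X k)" "h = restrict0 X n (h' \<circ> diff X k)"
    using assms by auto
  have "(\<lambda>u. a * f u + b * h u) = restrict0 X n ((\<lambda>u. a * f' u + b * h' u) \<circ> diff X k)"
    by (auto simp: *(3,4) restrict0_def fun_eq_iff)
  then show ?thesis using cochains_lincomb[OF *(1,2)] unfolding Suc by auto
qed (use assms in auto)

lemma coboundaries_add:
  "f \<in> coboundaries X n m \<Longrightarrow> h \<in> coboundaries X n m \<Longrightarrow> (\<lambda>u. f u + h u) \<in> coboundaries X n m"
  using coboundaries_lincomb[of f X n m h 1 1] by simp

lemma coboundaries_diff:
  "f \<in> coboundaries X n m \<Longrightarrow> h \<in> coboundaries X n m \<Longrightarrow> (\<lambda>u. f u - h u) \<in> coboundaries X n m"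
  using coboundaries_lincomb[of f X n m h 1 "-1"] by simp

lemma ext_class_self: "f \<in> cocycles X n m \<Longrightarrow> f \<in> ext_class X n m f"
  by (simp add: ext_class_def coboundaries_zero)

lemma ext_class_eqI:
  assumes "(\<lambda>u. f u - h u) \<in> coboundaries X n m"
  shows "ext_class X n m f = ext_class X n m h"
proof -
  have "(\<lambda>u. z u - f u) \<in> coboundaries X n m \<longleftrightarrow> (\<lambda>u. z u - h u) \<in> coboundaries X n m" for z
    using coboundaries_add[OF _ assms, of "\<lambda>u. z u - f u"]
      coboundaries_diff[OF _ assms, of "\<lambda>u. z u - h u"] by auto
  then show ?thesis by (auto simp: ext_class_def)
qed

section \<open>The comparison theorem and the Yoneda product\<close>

lemma free_resolutionD:
  assumes "free_resolution P"
  shows "\<And>n. graded_hom P (Suc n) P n 0 (diff P n)"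
    and "module_hom_K P 0 (augm P)"
    and "\<And>j u. j > 0 \<Longrightarrow> u \<in> free_component P 0 j \<Longrightarrow> augm P u = 0"
    and "\<And>c. \<exists>u \<in> free_module P 0. augm P u = c"
    and "\<And>u. u \<in> free_module P (Suc 0) \<Longrightarrow> augm P (diff P 0 u) = 0"
    and "\<And>u. u \<in> free_module P 0 \<Longrightarrow> augm P u = 0 \<Longrightarrow> u \<in> diff P 0 ` free_module P (Suc 0)"
    and "\<And>n u. u \<in> free_module P (Suc (Suc n)) \<Longrightarrow> diff P n (diff P (Suc n) u) = 0"
    and "\<And>n u. u \<in> free_module P (Suc n) \<Longrightarrow> diff P n u = 0 \<Longrightarrow>
           u \<in> diff P (Suc n) ` free_module P (Suc (Suc n))"
    and "\<And>n j. finite {x \<in> gens P n. gdeg P n x = j}"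
proof -
  note d = assms[unfolded free_resolution_def]
  show "graded_hom P (Suc n) P n 0 (diff P n)" for n
    using d unfolding graded_hom_def module_hom_def by (auto simp: image_subset_iff)
  have surj: "augm P ` free_module P 0 = UNIV"
    and ex0: "{u \<in> free_module P 0. augm P u = 0} = diff P 0 ` free_module P (Suc 0)"
    and ex: "\<And>n. {u \<in> free_module P (Suc n). diff P n u = 0} =
      diff P (Suc n) ` free_module P (Suc (Suc n))"
    using d by (elim conjE; blast)+
  show "\<exists>u \<in> free_module P 0. augm P u = c" for c
    using surj by (metis UNIV_I imageE)
  show "augm P (diff P 0 u) = 0" if "u \<in> free_module P (Suc 0)" for u
    using imageI[OF that, of "diff P 0"] ex0 by blast
  show "u \<in> diff P 0 ` free_module P (Suc 0)" if "u \<in> free_module P 0" "augm P u = 0" for u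
    using that ex0 by blast
  show "diff P n (diff P (Suc n) u) = 0" if "u \<in> free_module P (Suc (Suc n))" for n u
    using imageI[OF that, of "diff P (Suc n)"] ex by blast
  show "u \<in> diff P (Suc n) ` free_module P (Suc (Suc n))"
    if "u \<in> free_module P (Suc n)" "diff P n u = 0" for n u
    using that ex by blast
  show "module_hom_K P 0 (augm P)"
    using d by (elim conjE)
  show "augm P u = 0" if "j > 0" "u \<in> free_component P 0 j" for j u
    using d that by (elim conjE) blast
  show "finite {x \<in> gens P n. gdeg P n x = j}" for n j
    using d by (elim conjE) blast
qed

text \<open>
  This form makes the closure properties of graded homomorphisms available for chain lifts.
\<close>

lemma chain_lift_iff:
  "chain_lift P q m h \<Phi> \<longleftrightarrow>
     (\<forall>i. graded_hom P (i + q) P i m (\<Phi> i)) \<and>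
     (\<forall>u \<in> free_module P q. augm P (\<Phi> 0 u) = h u) \<and>
     (\<forall>i. \<forall>u \<in> free_module P (Suc i + q). diff P i (\<Phi> (Suc i) u) = \<Phi> i (diff P (i + q) u))"
  unfolding chain_lift_def graded_hom_def module_hom_def image_subset_iff by auto

text \<open>
  The analogue of \<open>free_module_projective\<close> one step further to the right.  Elements of positive degree
  are killed by the augmentation, so that scalars have preimages of degree 0.
\<close>

lemma augm_projective:
  assumes P: "free_resolution P" and f: "f \<in> cochains X n m"
  shows "\<exists>H. graded_hom X n P 0 m H \<and> (\<forall>u\<in>free_module X n. augm P (H u) = f u)"
proof -
  note R = free_resolutionD[OF P] and f' = cochainsD[OF f]
  have "\<exists>w. w \<in> free_component P 0 0 \<and> augm P w = c" for c
  proof -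
    obtain v where v: "v \<in> free_module P 0" "augm P v = c" using R(4) by blast
    obtain N where N: "\<And>M. M \<ge> N \<Longrightarrow> v = (\<Sum>j<M. module_part P 0 j v)"
      using module_part_expansion[where X = P and n = 0 and u = v] by blast
    have "augm P v = augm P (\<Sum>j<Suc N. module_part P 0 j v)" using N[of "Suc N"] by simp
    also have "\<dots> = (\<Sum>j<Suc N. augm P (module_part P 0 j v))"
      by (rule module_hom_K_sum[OF R(2)]) (rule free_component_subset[OF module_part_in[OF v(1)]])
    also have "\<dots> = (\<Sum>j<Suc N. if j = 0 then augm P (module_part P 0 0 v) else 0)"
      using R(3) module_part_in[OF v(1)] by (intro sum.cong) auto
    finally show ?thesis using v module_part_in[OF v(1), of 0] by (auto simp: sum.delta)
  qed
  then obtain S where S: "\<And>c. S c \<in> free_component P 0 0" "\<And>c. augm P (S c) = c" by metis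
  define W where "W x = (if gdeg X n x = m then S (f (basis x)) else 0)" for x
  have W: "augm P (W x) = f (basis x)" "W x \<in> free_module P 0" if "x \<in> gens X n" for x
    using S f'(3)[OF basis_in_free_component[OF that]] module_hom_KD(3)[OF R(2)]
      free_component_subset[OF S(1)] by (auto simp: W_def)
  have "graded_hom X n P 0 m (extend_linear W)"
    by (rule graded_hom_extend_linear) (auto simp: W_def S)
  moreover have "augm P (extend_linear W u) = f u" if u: "u \<in> free_module X n" for u
  proof -
    have g: "x \<in> gens X n" if "x \<in> supp u" for x
      using that u by (auto simp: free_module_def)
    have "augm P (extend_linear W u) = (\<Sum>x\<in>supp u. augm P (smult (coord u x) (W x)))"
      unfolding extend_linear_def by (rule module_hom_K_sum[OF R(2)]) (simp add: W g free_module_smult)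
    also have "\<dots> = extend_functional (\<lambda>x. f (basis x)) u"
      unfolding extend_functional_def by (rule sum.cong) (simp_all add: W g module_hom_KD(2)[OF R(2)])
    finally show ?thesis using module_hom_K_basis[OF f'(1) u] by simp
  qed
  ultimately show ?thesis by blast
qed

text \<open>
  One half of the comparison theorem.  The recursion carries along that the map constructed last,
  composed with the differential, lands in the boundaries, which is what exactness yields and the
  next step consumes.
\<close>

lemma chain_lift_exists:
  assumes P: "free_resolution P" and h: "h \<in> cocycles P q m"
  shows "\<exists>\<Phi>. chain_lift P q m h \<Phi>"
proof -
  note R = free_resolutionD[OF P]
  note D = R(1)
  let ?A = "\<lambda>i \<phi>. graded_hom P (i + q) P i m \<phi> \<and> (i = 0 \<longrightarrow> (\<forall>u \<in> free_module P q. augm P (\<phi> u) = h u)) \<and>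
      (\<forall>u \<in> free_module P (Suc i + q). \<phi> (diff P (i + q) u) \<in> diff P i ` free_module P (Suc i))"
  let ?B = "\<lambda>i \<phi> \<psi>. \<forall>u \<in> free_module P (Suc i + q). diff P i (\<psi> u) = \<phi> (diff P (i + q) u)"
  have "\<exists>\<Phi>. \<forall>i. ?A i (\<Phi> i) \<and> ?B i (\<Phi> i) (\<Phi> (Suc i))"
  proof (rule dependent_nat_choice)
    obtain H where H: "graded_hom P q P 0 m H" "\<And>u. u \<in> free_module P q \<Longrightarrow> augm P (H u) = h u"
      using augm_projective[OF P, of h P q m] h by (auto simp: cocycles_def)
    have "H (diff P q u) \<in> diff P 0 ` free_module P (Suc 0)" if "u \<in> free_module P (Suc q)" for u
      using that h R(6) graded_homD(1)[OF D, of u q] graded_homD(1)[OF H(1)] H(2)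
      by (simp add: cocycles_def)
    then show "\<exists>\<phi>. ?A 0 \<phi>" using H by auto
  next
    fix \<phi> i assume A: "?A i \<phi>"
    have "graded_hom P (Suc i + q) P i m (\<lambda>u. \<phi> (diff P (i + q) u))"
      using graded_hom_comp[OF D conjunct1[OF A]] by simp
    from free_module_projective[OF this D] A
    obtain \<psi> where \<psi>: "graded_hom P (Suc i + q) P (Suc i) m \<psi>"
        "\<And>u. u \<in> free_module P (Suc i + q) \<Longrightarrow> diff P i (\<psi> u) = \<phi> (diff P (i + q) u)"
      by blast
    have "\<psi> (diff P (Suc i + q) u) \<in> diff P (Suc i) ` free_module P (Suc (Suc i))"
      if u: "u \<in> free_module P (Suc (Suc i) + q)" for u
    proof (rule R(8))
      have v: "diff P (Suc i + q) u \<in> free_module P (Suc i + q)"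
        using graded_homD(1)[OF D] u by simp
      then show "\<psi> (diff P (Suc i + q) u) \<in> free_module P (Suc i)"
        using graded_homD(1)[OF \<psi>(1)] by blast
      show "diff P i (\<psi> (diff P (Suc i + q) u)) = 0"
        using \<psi>(2)[OF v] R(7)[of u "i + q"] u graded_homD(6)[OF conjunct1[OF A]] by simp
    qed
    then show "\<exists>\<psi>. ?A (Suc i) \<psi> \<and> ?B i \<phi> \<psi>" using \<psi> by auto
  qed
  then obtain \<Phi> where "\<forall>i. ?A i (\<Phi> i) \<and> ?B i (\<Phi> i) (\<Phi> (Suc i))" by blast
  then have "chain_lift P q m h \<Phi>" unfolding chain_lift_iff by auto
  then show ?thesis by blast
qed

text \<open>
  The other half of the comparison theorem, for a chain map whose bottom component agrees with \<open>C\<close> after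
  augmentation.  The map \<open>C\<close> plays the part of the lowest term \<open>H (-1) \<circ> diff\<close> of the homotopy, which the
  indexing by natural numbers cannot express; for \<open>q = 0\<close> it will be zero.
\<close>

lemma chain_homotopy:
  assumes P: "free_resolution P"
    and \<Psi>: "\<And>i. graded_hom P (i + q) P i m (\<Psi> i)"
      "\<And>i u. u \<in> free_module P (Suc i + q) \<Longrightarrow> diff P i (\<Psi> (Suc i) u) = \<Psi> i (diff P (i + q) u)"
    and C: "graded_hom P q P 0 m C" "\<And>u. u \<in> free_module P (Suc q) \<Longrightarrow> C (diff P q u) = 0"
      "\<And>u. u \<in> free_module P q \<Longrightarrow> augm P (\<Psi> 0 u) = augm P (C u)"
  shows "\<exists>H. (\<forall>i. graded_hom P (i + q) P (Suc i) m (H i)) \<and>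
      (\<forall>u \<in> free_module P q. \<Psi> 0 u = diff P 0 (H 0 u) + C u) \<and>
      (\<forall>i. \<forall>u \<in> free_module P (Suc i + q).
         \<Psi> (Suc i) u = diff P (Suc i) (H (Suc i) u) + H i (diff P (i + q) u))"
proof -
  note R = free_resolutionD[OF P]
  note D = R(1)
  let ?A = "\<lambda>i \<phi>. graded_hom P (i + q) P (Suc i) m \<phi> \<and>
      (i = 0 \<longrightarrow> (\<forall>u \<in> free_module P q. \<Psi> 0 u = diff P 0 (\<phi> u) + C u)) \<and>
      (\<forall>u \<in> free_module P (Suc i + q). \<Psi> i (diff P (i + q) u) = diff P i (\<phi> (diff P (i + q) u)))"
  let ?B = "\<lambda>i \<phi> \<psi>. \<forall>u \<in> free_module P (Suc i + q).
      \<Psi> (Suc i) u = diff P (Suc i) (\<psi> u) + \<phi> (diff P (i + q) u)"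
  have "\<exists>H. \<forall>i. ?A i (H i) \<and> ?B i (H i) (H (Suc i))"
  proof (rule dependent_nat_choice)
    have "graded_hom P q P 0 m (\<lambda>u. \<Psi> 0 u - C u)"
      using graded_hom_diff[OF \<Psi>(1)[of 0, simplified] C(1)] .
    moreover have "\<Psi> 0 u - C u \<in> diff P 0 ` free_module P (Suc 0)" if u: "u \<in> free_module P q" for u
      using u C(3) graded_homD(1)[OF \<Psi>(1)[of 0, simplified]] graded_homD(1)[OF C(1)]
      by (intro R(6)) (simp_all add: free_module_diff module_hom_KD(4)[OF R(2)])
    ultimately obtain H where H: "graded_hom P q P (Suc 0) m H"
        "\<And>u. u \<in> free_module P q \<Longrightarrow> diff P 0 (H u) = \<Psi> 0 u - C u"
      using free_module_projective[OF _ D] by blast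
    have "\<Psi> 0 (diff P q u) = diff P 0 (H (diff P q u))" if "u \<in> free_module P (Suc q)" for u
      using H(2)[OF graded_homD(1)[OF D that]] C(2)[OF that] by simp
    then show "\<exists>\<phi>. ?A 0 \<phi>" using H by (intro exI[of _ H]) auto
  next
    fix \<phi> i assume A: "?A i \<phi>"
    have T: "graded_hom P (Suc i + q) P (Suc i) m (\<lambda>u. \<Psi> (Suc i) u - \<phi> (diff P (i + q) u))"
      using graded_hom_comp[OF D conjunct1[OF A]] by (intro graded_hom_diff \<Psi>(1)) simp
    have "\<Psi> (Suc i) u - \<phi> (diff P (i + q) u) \<in> diff P (Suc i) ` free_module P (Suc (Suc i))"
      if u: "u \<in> free_module P (Suc i + q)" for u
    proof (rule R(8))
      show "\<Psi> (Suc i) u - \<phi> (diff P (i + q) u) \<in> free_module P (Suc i)"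
        by (rule graded_homD(1)[OF T u])
      have "\<Psi> (Suc i) u \<in> free_module P (Suc i)" "\<phi> (diff P (i + q) u) \<in> free_module P (Suc i)"
        using graded_homD(1)[OF \<Psi>(1)] graded_homD(1)[OF conjunct1[OF A]] graded_homD(1)[OF D] u
        by simp_all
      then show "diff P i (\<Psi> (Suc i) u - \<phi> (diff P (i + q) u)) = 0"
        using A u \<Psi>(2)[OF u] by (simp add: graded_homD(7)[OF D])
    qed
    from free_module_projective[OF T D this]
    obtain \<psi> where \<psi>: "graded_hom P (Suc i + q) P (Suc (Suc i)) m \<psi>"
        "\<And>u. u \<in> free_module P (Suc i + q) \<Longrightarrow>
           diff P (Suc i) (\<psi> u) = \<Psi> (Suc i) u - \<phi> (diff P (i + q) u)"
      by blast
    have "\<Psi> (Suc i) (diff P (Suc i + q) u) = diff P (Suc i) (\<psi> (diff P (Suc i + q) u))"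
      if u: "u \<in> free_module P (Suc (Suc i) + q)" for u
    proof -
      have v: "diff P (Suc i + q) u \<in> free_module P (Suc i + q)"
        using graded_homD(1)[OF D] u by simp
      show ?thesis
        using \<psi>(2)[OF v] R(7)[of u "i + q"] u graded_homD(6)[OF conjunct1[OF A]] by simp
    qed
    then show "\<exists>\<psi>. ?A (Suc i) \<psi> \<and> ?B i \<phi> \<psi>" using \<psi> by (intro exI[of _ \<psi>]) auto
  qed
  then obtain H where "\<forall>i. ?A i (H i) \<and> ?B i (H i) (H (Suc i))" by blast
  then show ?thesis by (intro exI[of _ H]) auto
qed

lemma cocyclesD:
  assumes "f \<in> cocycles P n m"
  shows "f \<in> cochains P n m" "\<And>u. u \<in> free_module P (Suc n) \<Longrightarrow> f (diff P n u) = 0"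
  using assms by (auto simp: cocycles_def)

lemma cocycle_comp_lift:
  assumes P: "free_resolution P" and f: "f \<in> cocycles P p l"
    and \<Psi>: "\<And>i. graded_hom P (i + q) P i m (\<Psi> i)"
      "\<And>i u. u \<in> free_module P (Suc i + q) \<Longrightarrow> diff P i (\<Psi> (Suc i) u) = \<Psi> i (diff P (i + q) u)"
  shows "restrict0 P (p + q) (f \<circ> \<Psi> p) \<in> cocycles P (p + q) (l + m)"
proof -
  note D = free_resolutionD(1)[OF P]
  have "f (\<Psi> p (diff P (p + q) u)) = 0" if "u \<in> free_module P (Suc (p + q))" for u
    using \<Psi>(2)[of u p] that cocyclesD(2)[OF f] graded_homD(1)[OF \<Psi>(1)[of "Suc p"]] by force
  then show ?thesis
    using cochain_comp[OF cocyclesD(1)[OF f] \<Psi>(1)] graded_homD(1)[OF D]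
    by (simp add: cocycles_def)
qed

text \<open>
  A lift of a coboundary \<open>b = c \<circ> diff\<close> is null-homotopic: a lift of \<open>c\<close> serves as lowest term of the
  homotopy \<open>H\<close>.  Composing with the cocycle \<open>f\<close> kills the terms \<open>diff \<circ> H\<close>, and those of the form
  \<open>H \<circ> diff\<close> give coboundaries.
\<close>

lemma null_lift_coboundary:
  assumes P: "free_resolution P" and f: "f \<in> cocycles P p l"
    and \<Psi>: "\<And>i. graded_hom P (i + q) P i m (\<Psi> i)"
      "\<And>i u. u \<in> free_module P (Suc i + q) \<Longrightarrow> diff P i (\<Psi> (Suc i) u) = \<Psi> i (diff P (i + q) u)"
    and b: "b \<in> coboundaries P q m" "\<And>u. u \<in> free_module P q \<Longrightarrow> augm P (\<Psi> 0 u) = b u"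
  shows "restrict0 P (p + q) (f \<circ> \<Psi> p) \<in> coboundaries P (p + q) (l + m)"
proof -
  note R = free_resolutionD[OF P]
  note D = R(1)
  have "\<exists>C. graded_hom P q P 0 m C \<and> (\<forall>u \<in> free_module P (Suc q). C (diff P q u) = 0) \<and>
      (\<forall>u \<in> free_module P q. augm P (C u) = b u) \<and>
      (\<forall>e \<in> cochains P 0 l. restrict0 P q (e \<circ> C) \<in> coboundaries P q (l + m))"
  proof (cases q)
    case 0
    have "restrict0 P 0 (e \<circ> (\<lambda>u. 0)) = (\<lambda>u. 0)" if "e \<in> cochains P 0 l" for e
      using module_hom_KD(3)[OF cochainsD(1)[OF that]] by (auto simp: restrict0_def fun_eq_iff)
    then show ?thesis
      using b(1) graded_hom_zero module_hom_KD(3)[OF R(2)] unfolding 0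
      by (intro exI[of _ "\<lambda>u. 0"]) auto
  next
    case (Suc k)
    then obtain c where c: "c \<in> cochains P k m" "b = restrict0 P q (c \<circ> diff P k)"
      using b(1) by auto
    obtain B where B: "graded_hom P k P 0 m B" "\<And>u. u \<in> free_module P k \<Longrightarrow> augm P (B u) = c u"
      using augm_projective[OF P c(1)] by blast
    have "restrict0 P q (e \<circ> (\<lambda>u. B (diff P k u))) \<in> coboundaries P q (l + m)"
      if e: "e \<in> cochains P 0 l" for e
    proof -
      have "restrict0 P q (e \<circ> (\<lambda>u. B (diff P k u))) = restrict0 P q (restrict0 P k (e \<circ> B) \<circ> diff P k)"
        using graded_homD(1)[OF D] Suc by (auto simp: restrict0_def fun_eq_iff)
      then show ?thesis using cochain_comp[OF e B(1)] Suc by simp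
    qed
    then show ?thesis
      using graded_hom_comp[OF D B(1)] R(7) graded_homD(6)[OF B(1)] graded_homD(1)[OF D] B(2) c(2) Suc
      by (intro exI[of _ "\<lambda>u. B (diff P k u)"]) auto
  qed
  then obtain C where C: "graded_hom P q P 0 m C" "\<And>u. u \<in> free_module P (Suc q) \<Longrightarrow> C (diff P q u) = 0"
      "\<And>u. u \<in> free_module P q \<Longrightarrow> augm P (C u) = b u"
      "\<And>e. e \<in> cochains P 0 l \<Longrightarrow> restrict0 P q (e \<circ> C) \<in> coboundaries P q (l + m)"
    by blast
  obtain H where H: "\<And>i. graded_hom P (i + q) P (Suc i) m (H i)"
      "\<And>u. u \<in> free_module P q \<Longrightarrow> \<Psi> 0 u = diff P 0 (H 0 u) + C u"
      "\<And>i u. u \<in> free_module P (Suc i + q) \<Longrightarrow>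
         \<Psi> (Suc i) u = diff P (Suc i) (H (Suc i) u) + H i (diff P (i + q) u)"
    using chain_homotopy[OF P \<Psi> C(1,2)] b(2) C(3) by metis
  have kill: "f (diff P p (H p u) + v) = f v" if "u \<in> free_module P (p + q)" "v \<in> free_module P p" for u v
  proof -
    have "H p u \<in> free_module P (Suc p)" using graded_homD(1)[OF H(1)] that(1) by blast
    then show ?thesis
      using module_hom_KD(1)[OF cochainsD(1)[OF cocyclesD(1)[OF f]]] cocyclesD(2)[OF f] that(2)
        graded_homD(1)[OF D] by simp
  qed
  show ?thesis
  proof (cases p)
    case 0
    have "restrict0 P q (f \<circ> \<Psi> 0) = restrict0 P q (f \<circ> C)"
      using kill H(2) graded_homD(1)[OF C(1)] 0 by (auto simp: restrict0_def fun_eq_iff)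
    then show ?thesis using C(4)[of f] cocyclesD(1)[OF f] 0 by simp
  next
    case (Suc i)
    have "restrict0 P (p + q) (f \<circ> \<Psi> p) =
        restrict0 P (Suc (i + q)) (restrict0 P (i + q) (f \<circ> H i) \<circ> diff P (i + q))"
      using kill H(3)[of _ i] graded_homD(1)[OF H(1)[of i]] graded_homD(1)[OF D] Suc
      by (auto simp: restrict0_def fun_eq_iff)
    moreover have "restrict0 P (i + q) (f \<circ> H i) \<in> cochains P (i + q) (l + m)"
      using cochain_comp[OF _ H(1)] cocyclesD(1)[OF f] Suc by simp
    ultimately show ?thesis using Suc by auto
  qed
qed

lemma chain_lift_comp_cocycle:
  assumes "free_resolution P" "f \<in> cocycles P p l" "chain_lift P q m h \<Phi>"
  shows "restrict0 P (p + q) (f \<circ> \<Phi> p) \<in> cocycles P (p + q) (l + m)"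
  using assms(3) unfolding chain_lift_iff by (intro cocycle_comp_lift[OF assms(1,2)]) auto

text \<open>
  The product is well defined: two choices of representatives and lifts change the composite by
  \<open>f (\<Phi>' - \<Phi>) + (f' - f) \<Phi>'\<close>.  The first term is a coboundary by the comparison theorem, the second because
  \<open>\<Phi>'\<close> commutes with the differentials.
\<close>

theorem yoneda_product_class:
  assumes P: "free_resolution P" and f: "f \<in> cocycles P p l" and h: "h \<in> cocycles P q m"
    and \<Phi>: "chain_lift P q m h \<Phi>"
  shows "yoneda_product P p l (ext_class P p l f) q m (ext_class P q m h) =
    ext_class P (p + q) (l + m) (restrict0 P (p + q) (f \<circ> \<Phi> p))"
proof -
  note D = free_resolutionD(1)[OF P]
  note L = \<Phi>[unfolded chain_lift_iff]
  have "ext_class P (p + q) (l + m) (restrict0 P (p + q) (f' \<circ> \<Phi>' p)) =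
      ext_class P (p + q) (l + m) (restrict0 P (p + q) (f \<circ> \<Phi> p))"
    if f': "f' \<in> ext_class P p l f" and h': "h' \<in> ext_class P q m h" and \<Phi>': "chain_lift P q m h' \<Phi>'"
    for f' h' \<Phi>'
  proof (rule ext_class_eqI)
    note L' = \<Phi>'[unfolded chain_lift_iff]
    have fc: "f' \<in> cocycles P p l" "(\<lambda>u. f' u - f u) \<in> coboundaries P p l"
      and hc: "(\<lambda>u. h' u - h u) \<in> coboundaries P q m"
      using f' h' by (auto simp: ext_class_def)
    have "restrict0 P (p + q) (f \<circ> (\<lambda>u. \<Phi>' p u - \<Phi> p u)) \<in> coboundaries P (p + q) (l + m)"
    proof (rule null_lift_coboundary[OF P f _ _ hc, where \<Psi> = "\<lambda>i u. \<Phi>' i u - \<Phi> i u"])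
      show "graded_hom P (i + q) P i m (\<lambda>u. \<Phi>' i u - \<Phi> i u)" for i
        using L L' by (intro graded_hom_diff) auto
      show "diff P i (\<Phi>' (Suc i) u - \<Phi> (Suc i) u) = \<Phi>' i (diff P (i + q) u) - \<Phi> i (diff P (i + q) u)"
        if "u \<in> free_module P (Suc i + q)" for i u
      proof -
        have "\<Phi>' (Suc i) u \<in> free_module P (Suc i)" "\<Phi> (Suc i) u \<in> free_module P (Suc i)"
          using that L L' graded_homD(1) by blast+
        then show ?thesis using L L' that by (simp add: graded_homD(7)[OF D])
      qed
      show "augm P (\<Phi>' 0 u - \<Phi> 0 u) = h' u - h u" if "u \<in> free_module P q" for u
      proof -
        have "\<Phi>' 0 u \<in> free_module P 0" "\<Phi> 0 u \<in> free_module P 0"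
          using that L L' graded_homD(1) by (metis add_0)+
        then show ?thesis
          using L L' that by (simp add: module_hom_KD(4)[OF free_resolutionD(2)[OF P]])
      qed
    qed
    moreover have "restrict0 P (p + q) ((\<lambda>u. f' u - f u) \<circ> \<Phi>' p) \<in> coboundaries P (p + q) (l + m)"
    proof (cases p)
      case 0
      then have "restrict0 P (p + q) ((\<lambda>u. f' u - f u) \<circ> \<Phi>' p) = (\<lambda>u. 0)"
        using fc(2) by (auto simp: restrict0_def fun_eq_iff)
      then show ?thesis using coboundaries_zero by metis
    next
      case (Suc k)
      then obtain c where c: "c \<in> cochains P k l" "(\<lambda>u. f' u - f u) = restrict0 P p (c \<circ> diff P k)"
        using fc(2) by auto
      have "f' (\<Phi>' p u) - f (\<Phi>' p u) = c (\<Phi>' k (diff P (k + q) u))" if "u \<in> free_module P (Suc k + q)" for u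
      proof -
        have "\<Phi>' (Suc k) u \<in> free_module P (Suc k)"
          using graded_homD(1)[OF conjunct1[OF L', THEN spec, of "Suc k"] that] .
        then have "f' (\<Phi>' p u) - f (\<Phi>' p u) = c (diff P k (\<Phi>' (Suc k) u))"
          using fun_cong[OF c(2), of "\<Phi>' p u"] Suc by simp
        then show ?thesis using L' that by simp
      qed
      then have "restrict0 P (p + q) ((\<lambda>u. f' u - f u) \<circ> \<Phi>' p) =
          restrict0 P (Suc (k + q)) (restrict0 P (k + q) (c \<circ> \<Phi>' k) \<circ> diff P (k + q))"
        using Suc graded_homD(1)[OF D] by (auto simp: restrict0_def fun_eq_iff)
      moreover have "restrict0 P (k + q) (c \<circ> \<Phi>' k) \<in> cochains P (k + q) (l + m)"
        using cochain_comp[OF c(1)] L' by blast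
      ultimately show ?thesis using Suc by auto
    qed
    moreover have "f (\<Phi>' p u - \<Phi> p u) = f (\<Phi>' p u) - f (\<Phi> p u)" if "u \<in> free_module P (p + q)" for u
    proof -
      have "\<Phi>' p u \<in> free_module P p" "\<Phi> p u \<in> free_module P p"
        using that L L' graded_homD(1) by blast+
      then show ?thesis using module_hom_KD(4)[OF cochainsD(1)[OF cocyclesD(1)[OF f]]] by simp
    qed
    then have "(\<lambda>u. restrict0 P (p + q) (f' \<circ> \<Phi>' p) u - restrict0 P (p + q) (f \<circ> \<Phi> p) u) =
        (\<lambda>u. restrict0 P (p + q) (f \<circ> (\<lambda>u. \<Phi>' p u - \<Phi> p u)) u +
          restrict0 P (p + q) ((\<lambda>u. f' u - f u) \<circ> \<Phi>' p) u)"
      by (auto simp: restrict0_def fun_eq_iff)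
    ultimately show "(\<lambda>u. restrict0 P (p + q) (f' \<circ> \<Phi>' p) u - restrict0 P (p + q) (f \<circ> \<Phi> p) u)
        \<in> coboundaries P (p + q) (l + m)"
      using coboundaries_add by simp
  qed
  then show ?thesis
    using ext_class_self[OF f] ext_class_self[OF h] \<Phi> unfolding yoneda_product_def by blast
qed

end

section \<open>Direct sums of free modules\<close>

text \<open>
  Generators are indexed by natural numbers, so a direct sum of two free modules needs a coding of
  the disjoint union: generators of the first summand get even indices, those of the second odd ones.
\<close>

definition interleave :: "(nat \<Rightarrow>\<^sub>0 'a::zero) \<Rightarrow> (nat \<Rightarrow>\<^sub>0 'a) \<Rightarrow> (nat \<Rightarrow>\<^sub>0 'a)" where
  "interleave u v = Abs_poly_mapping (\<lambda>k. if even k then coord u (k div 2) else coord v (k div 2))"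

lemma all_nat_parity: "(\<forall>k. R k) \<longleftrightarrow> (\<forall>x. R (2 * x)) \<and> (\<forall>x. R (Suc (2 * x)))"
  by (metis evenE oddE Suc_eq_plus1)

definition evens :: "(nat \<Rightarrow>\<^sub>0 'a::zero) \<Rightarrow> (nat \<Rightarrow>\<^sub>0 'a)" where
  "evens w = Poly_Mapping.map_key (\<lambda>x. 2 * x) w"

definition odds :: "(nat \<Rightarrow>\<^sub>0 'a::zero) \<Rightarrow> (nat \<Rightarrow>\<^sub>0 'a)" where
  "odds w = Poly_Mapping.map_key (\<lambda>x. Suc (2 * x)) w"

lemma coord_interleave:
  "coord (interleave u v) k = (if even k then coord u (k div 2) else coord v (k div 2))"
proof -
  have "{k. (if even k then coord u (k div 2) else coord v (k div 2)) \<noteq> 0} \<subseteq>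
      (\<lambda>x. 2 * x) ` supp u \<union> (\<lambda>x. Suc (2 * x)) ` supp v"
  proof
    fix k assume k: "k \<in> {k. (if even k then coord u (k div 2) else coord v (k div 2)) \<noteq> 0}"
    show "k \<in> (\<lambda>x. 2 * x) ` supp u \<union> (\<lambda>x. Suc (2 * x)) ` supp v"
    proof (cases "even k")
      case True
      then show ?thesis using k by (intro UnI1 image_eqI[of _ _ "k div 2"]) (auto simp: in_keys_iff)
    next
      case False
      then show ?thesis using k by (intro UnI2 image_eqI[of _ _ "k div 2"]) (auto simp: in_keys_iff)
    qed
  qed
  then have "finite {k. (if even k then coord u (k div 2) else coord v (k div 2)) \<noteq> 0}"
    by (rule finite_subset) auto
  then show ?thesis unfolding interleave_def by simp
qed

lemma coord_evens: "coord (evens w) x = coord w (2 * x)"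
  by (simp add: evens_def map_key.rep_eq inj_def)

lemma coord_odds: "coord (odds w) x = coord w (Suc (2 * x))"
  by (simp add: odds_def map_key.rep_eq inj_def)

lemmas coord_halves = coord_interleave coord_evens coord_odds

lemma interleave_halves [simp]:
  "evens (interleave u v) = u" "odds (interleave u v) = v" "interleave (evens w) (odds w) = w"
  by (auto simp: poly_mapping_eq_iff fun_eq_iff coord_halves elim!: oddE)

lemma halves_add:
  "evens (w + w') = evens w + evens w'" "odds (w + w') = odds w + odds w'"
  "interleave (u + u') (v + v') = interleave u v + interleave u' v'"
  by (simp_all add: poly_mapping_eq_iff fun_eq_iff coord_halves lookup_add)

lemma interleave_zero [simp]: "interleave 0 0 = 0" "evens 0 = 0" "odds 0 = 0"
  by (simp_all add: poly_mapping_eq_iff fun_eq_iff coord_halves)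

context connected_graded_algebra
begin

lemma halves_smult:
  "evens (smult a w) = smult a (evens w)" "odds (smult a w) = smult a (odds w)"
  "interleave (smult a u) (smult a v) = smult a (interleave u v)"
  by (simp_all add: poly_mapping_eq_iff fun_eq_iff coord_halves)

definition direct_sum :: "('a, 'k) free_complex \<Rightarrow> ('a, 'k) free_complex \<Rightarrow> ('a, 'k) free_complex \<Rightarrow> bool"
  where "direct_sum X Y S \<longleftrightarrow>
    (\<forall>n. gens S n = (\<lambda>x. 2 * x) ` gens X n \<union> (\<lambda>x. Suc (2 * x)) ` gens Y n) \<and>
    (\<forall>n x. gdeg S n (2 * x) = gdeg X n x \<and> gdeg S n (Suc (2 * x)) = gdeg Y n x)"

lemma direct_sum_module:
  assumes "direct_sum X Y S"
  shows "w \<in> free_module S n \<longleftrightarrow> evens w \<in> free_module X n \<and> odds w \<in> free_module Y n"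
proof -
  have g: "2 * x \<in> gens S n \<longleftrightarrow> x \<in> gens X n" "Suc (2 * x) \<in> gens S n \<longleftrightarrow> x \<in> gens Y n" for x
    using assms by (auto simp: direct_sum_def image_iff) presburger+
  show ?thesis
    unfolding free_module_iff
    by (subst all_nat_parity[where R = "\<lambda>k. coord w k \<noteq> 0 \<longrightarrow> k \<in> gens S n"])
      (simp add: coord_halves g)
qed

lemma direct_sum_component:
  assumes "direct_sum X Y S"
  shows "w \<in> free_component S n j \<longleftrightarrow> evens w \<in> free_component X n j \<and> odds w \<in> free_component Y n j"
proof -
  have g: "gdeg S n (2 * x) = gdeg X n x" "gdeg S n (Suc (2 * x)) = gdeg Y n x" for x
    using assms by (auto simp: direct_sum_def)
  have "(\<forall>k. coord w k \<in> shifted (gdeg S n k) j) \<longleftrightarrow>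
      (\<forall>x. coord (evens w) x \<in> shifted (gdeg X n x) j) \<and> (\<forall>x. coord (odds w) x \<in> shifted (gdeg Y n x) j)"
    by (subst all_nat_parity) (simp add: coord_halves g)
  then show ?thesis unfolding free_component_iff direct_sum_module[OF assms] by blast
qed

lemma graded_hom_halves:
  assumes "direct_sum X Y S"
  shows "graded_hom S n X n 0 evens" "graded_hom S n Y n 0 odds"
  by (simp_all add: graded_hom_def halves_add halves_smult direct_sum_module[OF assms]
      direct_sum_component[OF assms])

lemma graded_hom_interleave:
  assumes "direct_sum X Y S" "graded_hom Z k X n m \<phi>" "graded_hom Z k Y n m \<psi>"
  shows "graded_hom Z k S n m (\<lambda>u. interleave (\<phi> u) (\<psi> u))"
  using assms(2,3)
  by (simp add: graded_hom_def halves_add halves_smult direct_sum_module[OF assms(1)]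
      direct_sum_component[OF assms(1)])

end

section \<open>Reduction modulo a regular normal element of degree 1\<close>

text \<open>
  Normality enters as equality of the kernel \<open>gA\<close> with \<open>Ag\<close>.  Right multiplication by \<open>g\<close> on coordinates
  is a homomorphism of left modules, which left multiplication is not; this is why multiples of the
  form \<open>b * g\<close> are used.
\<close>

locale regular_normal_quotient =
  A: connected_graded_algebra sA GA + B: connected_graded_algebra sB GB
  for sA :: "'k::field \<Rightarrow> 'a::ring_1 \<Rightarrow> 'a" and GA :: "nat \<Rightarrow> 'a set"
    and sB :: "'k \<Rightarrow> 'b::ring_1 \<Rightarrow> 'b" and GB :: "nat \<Rightarrow> 'b set" +
  fixes \<pi> :: "'a \<Rightarrow> 'b" and g :: 'a and Q :: "('b, 'k) free_complex"
  assumes pi_one: "\<pi> 1 = 1"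
    and pi_add: "\<pi> (a + b) = \<pi> a + \<pi> b"
    and pi_mult: "\<pi> (a * b) = \<pi> a * \<pi> b"
    and pi_scale: "\<pi> (sA c a) = sB c (\<pi> a)"
    and pi_surj: "surj \<pi>"
    and pi_kernel: "\<pi> a = 0 \<longleftrightarrow> (\<exists>b. a = b * g)"
    and GB_eq: "GB n = \<pi> ` GA n"
    and g_degree: "g \<in> GA 1"
    and g_regular: "a * g = 0 \<Longrightarrow> a = 0"
    and Q: "B.free_resolution Q"
begin

lemma pi_zero [simp]: "\<pi> 0 = 0"
  using pi_add[of 0 0] by simp

lemma pi_uminus: "\<pi> (- a) = - \<pi> a"
  using pi_add[of a "- a"] by (simp add: eq_neg_iff_add_eq_0 add.commute)

lemma pi_sum: "\<pi> (sum f S) = (\<Sum>x\<in>S. \<pi> (f x))"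
  by (induction S rule: infinite_finite_induct) (auto simp: pi_add)

lemma hpart_pi: "B.hpart (\<pi> a) n = \<pi> (A.hpart a n)"
proof -
  have "B.hpart (\<pi> a) = (\<lambda>n. \<pi> (A.hpart a n))"
  proof (rule B.hpart_eqI[OF _ A.hpart_finite[of a]])
    show "\<pi> a = (\<Sum>n\<in>{n. A.hpart a n \<noteq> 0}. \<pi> (A.hpart a n))"
      by (subst A.hpart_sum[symmetric]) (rule pi_sum)
  qed (auto simp: GB_eq A.hpart_in)
  then show ?thesis by simp
qed

lemma aug_pi: "B.aug (\<pi> a) = A.aug a"
  by (rule B.aug_eqI) (simp add: hpart_pi A.hpart_0_eq pi_scale pi_one)

lemma g_mult_eq_0: "a * g = 0 \<longleftrightarrow> a = 0"
  using g_regular by auto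

lemma g_cancel: "a * g = b * g \<Longrightarrow> a = b"
  using g_regular[of "a - b"] by (simp add: left_diff_distrib)

text \<open>
  A product with the homogeneous regular element \<open>g\<close> is homogeneous only if the other factor is, as
  the components of the product are those of the factor times \<open>g\<close>.
\<close>

lemma shifted_times_g: "a * g \<in> A.shifted d j \<longleftrightarrow> a \<in> A.shifted (Suc d) j"
proof
  assume a: "a * g \<in> A.shifted d j"
  show "a \<in> A.shifted (Suc d) j"
  proof (cases "d \<le> j")
    case True
    then have ag: "A.hpart (a * g) k = (if k = j - d then a * g else 0)" for k
      using a A.hpart_homogeneous by (simp add: A.shifted_def)
    have "A.hpart a k = 0" if "Suc k \<noteq> j - d" for k
      by (rule g_regular) (use ag[of "Suc k"] that in \<open>simp add: A.hpart_mult_right[OF g_degree]\<close>)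
    then have *: "Suc n = j - d \<Longrightarrow> a \<in> GA n" "j = d \<Longrightarrow> a = 0" for n
      using A.homogeneousI[of n a] A.hpart_sum[of a] by auto
    show ?thesis
    proof (cases "d = j")
      case False
      then have "Suc (j - Suc d) = j - d" using True by simp
      then show ?thesis using *(1) True False by (simp add: A.shifted_def)
    qed (use *(2) in simp)
  next
    case False
    then show ?thesis using a g_regular by (simp add: A.shifted_def)
  qed
next
  assume a: "a \<in> A.shifted (Suc d) j"
  show "a * g \<in> A.shifted d j"
  proof (cases "Suc d \<le> j")
    case True
    then have "a \<in> GA (j - Suc d)" using a by (simp add: A.shifted_def)
    from A.component_mult[OF this g_degree] show ?thesis using True by (simp add: A.shifted_def Suc_diff_Suc)
  qed (use a in \<open>auto simp: A.shifted_def\<close>)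
qed

text \<open>
  The endomorphism \<open>a \<mapsto> a'\<close> of \<open>A\<close> with \<open>a' g = g a\<close> fixes constant terms: compare the components of
  degree 1.
\<close>

lemma aug_commute_g: "a' * g = g * a \<Longrightarrow> A.aug a' = A.aug a"
proof -
  assume "a' * g = g * a"
  then have "A.hpart (a' * g) 1 = A.hpart (g * a) 1" by simp
  then have "sA (A.aug a') g = sA (A.aug a) g"
    by (simp add: A.hpart_mult_right[OF g_degree] A.hpart_mult_left[OF g_degree] A.hpart_0_eq
        A.scale_mult_left A.scale_mult_right)
  moreover have "g \<noteq> 0" using g_regular[of 1] by auto
  ultimately show ?thesis by simp
qed

text \<open>
  The modules over \<open>A\<close> on the generators of \<open>Q\<close>, and a copy of them with the homological and the internal
  degree raised by 1, as bookkeeping for gradings.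
\<close>

definition F :: "('a, 'k) free_complex" where
  "F = \<lparr>gens = gens Q, gdeg = gdeg Q, diff = (\<lambda>n u. 0), augm = (\<lambda>u. 0)\<rparr>"

definition E :: "('a, 'k) free_complex" where
  "E = \<lparr>gens = case_nat {} (gens Q), gdeg = (\<lambda>n x. Suc (gdeg Q (n - 1) x)),
        diff = (\<lambda>n u. 0), augm = (\<lambda>u. 0)\<rparr>"

text \<open>
  Reduction modulo \<open>g\<close>, multiplication by \<open>g\<close> on the right, and division by \<open>g\<close>, which is meaningful on
  the kernel of the reduction.
\<close>

definition \<rho> :: "(nat \<Rightarrow>\<^sub>0 'a) \<Rightarrow> (nat \<Rightarrow>\<^sub>0 'b)" where
  "\<rho> u = Poly_Mapping.map \<pi> u"

definition \<theta> :: "(nat \<Rightarrow>\<^sub>0 'a) \<Rightarrow> (nat \<Rightarrow>\<^sub>0 'a)" where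
  "\<theta> u = Poly_Mapping.map (\<lambda>a. a * g) u"

definition gdiv :: "(nat \<Rightarrow>\<^sub>0 'a) \<Rightarrow> (nat \<Rightarrow>\<^sub>0 'a)" where
  "gdiv u = (SOME v. \<theta> v = u)"

lemma F_simps [simp]: "gens F n = gens Q n" "gdeg F n x = gdeg Q n x"
  and E_simps [simp]: "gens E (Suc n) = gens Q n" "gens E 0 = {}" "gdeg E (Suc n) x = Suc (gdeg Q n x)"
  by (simp_all add: F_def E_def)

lemma E_0: "u \<in> A.free_module E 0 \<longleftrightarrow> u = 0"
  by (auto simp: A.free_module_iff poly_mapping_eq_iff fun_eq_iff)

lemma coord_rho [simp]: "coord (\<rho> u) x = \<pi> (coord u x)"
  by (simp add: \<rho>_def Poly_Mapping.map.rep_eq when_def)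

lemma coord_theta [simp]: "coord (\<theta> u) x = coord u x * g"
  by (simp add: \<theta>_def Poly_Mapping.map.rep_eq when_def)

lemma rho_add: "\<rho> (u + v) = \<rho> u + \<rho> v"
  by (simp add: poly_mapping_eq_iff fun_eq_iff lookup_add pi_add)

lemma rho_zero [simp]: "\<rho> 0 = 0"
  by (simp add: poly_mapping_eq_iff fun_eq_iff)

lemma rho_uminus: "\<rho> (- u) = - \<rho> u"
  by (simp add: poly_mapping_eq_iff fun_eq_iff pi_uminus)

lemma rho_diff: "\<rho> (u - v) = \<rho> u - \<rho> v"
  using rho_add[of "u - v" v] by (simp add: algebra_simps)

lemma rho_smult: "\<rho> (A.smult a u) = B.smult (\<pi> a) (\<rho> u)"
  by (simp add: poly_mapping_eq_iff fun_eq_iff pi_mult)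

lemma rho_basis: "\<rho> (basis x) = basis x"
  by (simp add: poly_mapping_eq_iff fun_eq_iff lookup_single when_def pi_one)

lemma rho_in: "u \<in> A.free_module F n \<Longrightarrow> \<rho> u \<in> B.free_module Q n"
  by (auto simp: A.free_module_iff B.free_module_iff) (metis pi_zero)

lemma rho_component: "u \<in> A.free_component F n j \<Longrightarrow> \<rho> u \<in> B.free_component Q n j"
  using rho_in[of u n]
  by (auto simp: A.free_component_iff B.free_component_iff A.shifted_def B.shifted_def GB_eq split: if_splits)

lemma rho_lift:
  assumes "w \<in> B.free_module Q n"
  shows "\<exists>u \<in> A.free_module F n. \<rho> u = w"
proof -
  let ?u = "Poly_Mapping.mapp (\<lambda>x b. inv \<pi> b) w"
  have "\<rho> ?u = w"
    by (auto simp: poly_mapping_eq_iff fun_eq_iff lookup_mapp when_def in_keys_iff surj_f_inv_f[OF pi_surj])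
  moreover have "?u \<in> A.free_module F n"
    using assms keys_mapp_subset[of "\<lambda>x b. inv \<pi> b" w]
    by (auto simp: A.free_module_def B.free_module_def)
  ultimately show ?thesis by blast
qed

lemma rho_lift_component:
  assumes "w \<in> B.free_component Q n j"
  shows "\<exists>u \<in> A.free_component F n j. \<rho> u = w"
proof -
  obtain u where u: "u \<in> A.free_module F n" "\<rho> u = w"
    using rho_lift B.free_component_subset[OF assms] by blast
  have "B.module_part Q n j w = \<rho> (A.module_part F n j u)"
    by (simp add: poly_mapping_eq_iff fun_eq_iff A.coord_module_part B.coord_module_part hpart_pi flip: u(2))
  then have "\<rho> (A.module_part F n j u) = w" using B.module_part_homogeneous[OF assms] by simp
  then show ?thesis using A.module_part_in[OF u(1)] by blast
qed

text \<open>
  Lift the images of the basis elements to homogeneous elements of the right degree.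
\<close>

lemma graded_hom_lift:
  assumes \<phi>: "B.graded_hom Q n Q i m \<phi>"
  shows "\<exists>\<Phi>. A.graded_hom F n F i m \<Phi> \<and> (\<forall>u \<in> A.free_module F n. \<rho> (\<Phi> u) = \<phi> (\<rho> u))"
proof -
  have "\<exists>w. x \<in> gens Q n \<longrightarrow> \<rho> w = \<phi> (basis x) \<and>
      (if m \<le> gdeg Q n x then w \<in> A.free_component F i (gdeg Q n x - m) else w = 0)" for x
  proof (cases "x \<in> gens Q n")
    case True
    note b = B.basis_in_free_component[OF True]
    show ?thesis
    proof (cases "m \<le> gdeg Q n x")
      case True
      then have "\<phi> (basis x) \<in> B.free_component Q i (gdeg Q n x - m)"
        using B.graded_homD(4)[OF \<phi>, of "basis x" "gdeg Q n x - m"] b by simp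
      from rho_lift_component[OF this] show ?thesis using True by auto
    next
      case False
      then show ?thesis using B.graded_homD(5)[OF \<phi> b] by (intro exI[of _ 0]) auto
    qed
  qed auto
  then obtain W where W: "\<And>x. x \<in> gens Q n \<Longrightarrow> \<rho> (W x) = \<phi> (basis x) \<and>
      (if m \<le> gdeg Q n x then W x \<in> A.free_component F i (gdeg Q n x - m) else W x = 0)"
    by metis
  have "A.graded_hom F n F i m (A.extend_linear W)"
    using W by (intro A.graded_hom_extend_linear) (auto split: if_splits)
  moreover have "\<rho> (A.extend_linear W u) = \<phi> (\<rho> u)" if u: "u \<in> A.free_module F n" for u
    using u
  proof (induction rule: A.free_module_induct)
    case zero
    then show ?case by (simp add: A.extend_linear_def B.graded_homD(6)[OF \<phi>])
  next
    case (basis a x)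
    then show ?case
      using W B.basis_in_free_module[of x Q n]
      by (simp add: A.extend_linear_smult A.extend_linear_basis rho_smult rho_basis B.graded_homD(3)[OF \<phi>])
  next
    case (add u v)
    then show ?case by (simp add: A.extend_linear_add rho_add B.graded_homD(2)[OF \<phi>] rho_in)
  qed
  ultimately show ?thesis by blast
qed

lemma theta_add: "\<theta> (u + v) = \<theta> u + \<theta> v"
  by (simp add: poly_mapping_eq_iff fun_eq_iff lookup_add algebra_simps)

lemma theta_zero [simp]: "\<theta> 0 = 0"
  by (simp add: poly_mapping_eq_iff fun_eq_iff)

lemma theta_smult: "\<theta> (A.smult a u) = A.smult a (\<theta> u)"
  by (simp add: poly_mapping_eq_iff fun_eq_iff algebra_simps)

lemma theta_basis: "\<theta> (basis x) = A.smult g (basis x)"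
  by (simp add: poly_mapping_eq_iff fun_eq_iff lookup_single when_def)

lemma theta_inj: "\<theta> u = \<theta> v \<Longrightarrow> u = v"
  by (auto simp: poly_mapping_eq_iff fun_eq_iff intro: g_cancel)

lemma rho_theta [simp]: "\<rho> (\<theta> u) = 0"
  using pi_kernel by (auto simp: poly_mapping_eq_iff fun_eq_iff)

lemma rho_kernel:
  assumes "\<rho> u = 0"
  shows "\<exists>v. \<theta> v = u"
proof -
  have "\<exists>b. coord u x = b * g" for x
    using assms pi_kernel[of "coord u x"] by (auto simp: poly_mapping_eq_iff fun_eq_iff)
  then obtain b where "\<And>x. coord u x = b x * g" by metis
  then have "\<theta> (Poly_Mapping.mapp (\<lambda>x _. b x) u) = u"
    by (auto simp: poly_mapping_eq_iff fun_eq_iff lookup_mapp when_def in_keys_iff)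
  then show ?thesis by blast
qed

lemma theta_gdiv: "\<rho> u = 0 \<Longrightarrow> \<theta> (gdiv u) = u"
  unfolding gdiv_def using rho_kernel by (metis (mono_tags, lifting) someI_ex)

lemma gdiv_theta: "gdiv (\<theta> v) = v"
  by (rule theta_inj) (simp add: theta_gdiv)

lemma gdiv_add: "\<rho> u = 0 \<Longrightarrow> \<rho> v = 0 \<Longrightarrow> gdiv (u + v) = gdiv u + gdiv v"
  by (rule theta_inj) (simp add: theta_add theta_gdiv rho_add)

lemma gdiv_smult: "\<rho> u = 0 \<Longrightarrow> gdiv (A.smult a u) = A.smult a (gdiv u)"
  by (rule theta_inj) (simp add: theta_smult theta_gdiv rho_smult)

lemma theta_module: "\<theta> v \<in> A.free_module F n \<longleftrightarrow> v \<in> A.free_module E (Suc n)"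
  by (simp add: A.free_module_iff g_mult_eq_0)

text \<open>
  The degree shift of \<open>E\<close> is chosen so that multiplication by \<open>g\<close> becomes homogeneous of degree 0.
\<close>

lemma theta_component: "\<theta> v \<in> A.free_component F n j \<longleftrightarrow> v \<in> A.free_component E (Suc n) j"
  by (simp add: A.free_component_iff theta_module shifted_times_g)

lemma graded_hom_theta: "A.graded_hom E (Suc n) F n 0 \<theta>"
  by (simp add: A.graded_hom_def theta_module theta_component theta_add theta_smult)

text \<open>
  Division is linear because multiplication by \<open>g\<close> is linear and injective.
\<close>

lemma graded_hom_gdiv:
  assumes U: "A.graded_hom X n F i m U" and z: "\<And>u. u \<in> A.free_module X n \<Longrightarrow> \<rho> (U u) = 0"
  shows "A.graded_hom X n E (Suc i) m (\<lambda>u. gdiv (U u))"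
proof -
  have t: "\<theta> (gdiv (U u)) = U u" if "u \<in> A.free_module X n" for u
    by (rule theta_gdiv[OF z[OF that]])
  show ?thesis
    unfolding A.graded_hom_def
  proof (intro conjI ballI allI impI)
    fix u v assume "u \<in> A.free_module X n" "v \<in> A.free_module X n"
    then show "gdiv (U (u + v)) = gdiv (U u) + gdiv (U v)"
      by (simp add: gdiv_add z A.graded_homD(2)[OF U])
  next
    fix u a assume "u \<in> A.free_module X n"
    then show "gdiv (U (A.smult a u)) = A.smult a (gdiv (U u))"
      by (simp add: gdiv_smult z A.graded_homD(3)[OF U])
  next
    fix u assume "u \<in> A.free_module X n"
    then show "gdiv (U u) \<in> A.free_module E (Suc i)"
      by (simp add: t A.graded_homD(1)[OF U] flip: theta_module)
  next
    fix u j assume "u \<in> A.free_component X n (j + m)"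
    then show "gdiv (U u) \<in> A.free_component E (Suc i) j"
      using A.graded_homD(4)[OF U] A.free_component_subset by (simp add: t flip: theta_component)
  next
    fix u j assume "j < m" "u \<in> A.free_component X n j"
    then show "gdiv (U u) = 0"
      using A.graded_homD(5)[OF U] gdiv_theta[of 0] by simp
  qed
qed

section \<open>A resolution over the larger algebra\<close>

definition lifted_diff :: "nat \<Rightarrow> (nat \<Rightarrow>\<^sub>0 'a) \<Rightarrow> (nat \<Rightarrow>\<^sub>0 'a)" where
  "lifted_diff n = (SOME \<Phi>. A.graded_hom F (Suc n) F n 0 \<Phi> \<and>
     (\<forall>u \<in> A.free_module F (Suc n). \<rho> (\<Phi> u) = diff Q n (\<rho> u)))"

lemma lifted_diff_props:
  "A.graded_hom F (Suc n) F n 0 (lifted_diff n) \<and> (\<forall>u \<in> A.free_module F (Suc n). \<rho> (lifted_diff n u) = diff Q n (\<rho> u))"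
  unfolding lifted_diff_def by (rule someI_ex[OF graded_hom_lift[OF B.free_resolutionD(1)[OF Q]]])

lemma lifted_diff_hom: "A.graded_hom F (Suc n) F n 0 (lifted_diff n)"
  and rho_lifted_diff: "u \<in> A.free_module F (Suc n) \<Longrightarrow> \<rho> (lifted_diff n u) = diff Q n (\<rho> u)"
  using lifted_diff_props by blast+

text \<open>
  The differential of the resolution over \<open>A\<close> is \<open>\<zeta> \<circ> \<eta>\<close>.  Here \<open>\<eta>\<close> is its even part: the lifted differential
  on the even part plus \<open>g\<close> times the odd part.  The odd part is then forced by the requirement that
  \<open>\<eta> \<circ> \<zeta>\<close> vanish; it is a quotient by \<open>g\<close>, which exists when the reduction of the argument is a cycle.
  In degree 0 there is no odd part.
\<close>

definition \<eta> :: "nat \<Rightarrow> (nat \<Rightarrow>\<^sub>0 'a) \<Rightarrow> (nat \<Rightarrow>\<^sub>0 'a)" where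
  "\<eta> n w = lifted_diff n (evens w) + \<theta> (odds w)"

definition \<zeta> :: "nat \<Rightarrow> (nat \<Rightarrow>\<^sub>0 'a) \<Rightarrow> (nat \<Rightarrow>\<^sub>0 'a)" where
  "\<zeta> n y = interleave y (case n of 0 \<Rightarrow> 0 | Suc k \<Rightarrow> gdiv (- lifted_diff k y))"

definition P :: "('a, 'k) free_complex" where
  "P = \<lparr>gens = (\<lambda>n. (\<lambda>x. 2 * x) ` gens F n \<union> (\<lambda>x. Suc (2 * x)) ` gens E n),
        gdeg = (\<lambda>n k. if even k then gdeg F n (k div 2) else gdeg E n (k div 2)),
        diff = (\<lambda>n w. \<zeta> n (\<eta> n w)),
        augm = (\<lambda>w. augm Q (\<rho> (evens w)))\<rparr>"

lemma P_simps [simp]: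
  "diff P n w = \<zeta> n (\<eta> n w)" "augm P w = augm Q (\<rho> (evens w))"
  by (simp_all add: P_def)

lemma P_sum: "A.direct_sum F E P"
  by (simp add: A.direct_sum_def P_def)

lemmas P_module = A.direct_sum_module[OF P_sum]
lemmas P_component = A.direct_sum_component[OF P_sum]
lemmas P_halves = A.graded_hom_halves[OF P_sum]

lemma evens_zeta [simp]: "evens (\<zeta> n y) = y"
  by (simp add: \<zeta>_def)

lemma evens_P: "w \<in> A.free_module P n \<Longrightarrow> evens w \<in> A.free_module F n"
  and odds_P: "w \<in> A.free_module P n \<Longrightarrow> odds w \<in> A.free_module E n"
  by (simp_all add: P_module)

lemma eta_hom: "A.graded_hom P (Suc n) F n 0 (\<eta> n)"
  using A.graded_hom_add[OF A.graded_hom_comp[OF P_halves(1) lifted_diff_hom, of n]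
      A.graded_hom_comp[OF P_halves(2) graded_hom_theta, of n]]
  unfolding \<eta>_def by simp

lemma rho_eta: "w \<in> A.free_module P (Suc n) \<Longrightarrow> \<rho> (\<eta> n w) = diff Q n (\<rho> (evens w))"
  by (simp add: \<eta>_def rho_add rho_lifted_diff evens_P)

lemma rho_lifted_diff_eta: "w \<in> A.free_module P (Suc (Suc n)) \<Longrightarrow> \<rho> (lifted_diff n (\<eta> (Suc n) w)) = 0"
  using rho_lifted_diff[OF A.graded_homD(1)[OF eta_hom]] rho_eta[of w "Suc n"]
    B.free_resolutionD(7)[OF Q rho_in[OF evens_P]] by simp

lemma eta_zeta:
  assumes "y \<in> A.free_module F (Suc n)" "diff Q n (\<rho> y) = 0"
  shows "\<eta> n (\<zeta> (Suc n) y) = 0"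
  using assms by (simp add: \<eta>_def \<zeta>_def theta_gdiv rho_uminus rho_lifted_diff)

text \<open>
  An element killed by \<open>\<eta>\<close> is determined by its even part, since \<open>g\<close> is regular.  This is why exactness
  of \<open>P\<close> needs to be checked on even parts only.
\<close>

lemma zeta_eta:
  assumes "w \<in> A.free_module P (Suc n)" "\<eta> n w = 0"
  shows "w = \<zeta> (Suc n) (evens w)"
proof -
  have "\<theta> (odds w) = - lifted_diff n (evens w)"
    using assms(2) by (simp add: \<eta>_def eq_neg_iff_add_eq_0 add.commute)
  then have "odds w = gdiv (- lifted_diff n (evens w))" using gdiv_theta[of "odds w"] by simp
  then show ?thesis by (simp add: \<zeta>_def) (metis interleave_halves(3))
qed

lemma zeta_zero: "\<zeta> n 0 = 0"
  using A.graded_homD(6)[OF lifted_diff_hom] gdiv_theta[of 0] by (simp add: \<zeta>_def split: nat.split)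

lemma diff_P_hom: "A.graded_hom P (Suc n) P n 0 (\<lambda>w. \<zeta> n (\<eta> n w))"
proof (cases n)
  case 0
  then show ?thesis
    using A.graded_hom_interleave[OF P_sum eta_hom A.graded_hom_zero, of 0] by (simp add: \<zeta>_def)
next
  case (Suc k)
  have "A.graded_hom P (Suc (Suc k)) F k 0 (\<lambda>w. - lifted_diff k (\<eta> (Suc k) w))"
    using A.graded_hom_uminus[OF A.graded_hom_comp[OF eta_hom lifted_diff_hom]] by simp
  then have "A.graded_hom P (Suc (Suc k)) E (Suc k) 0 (\<lambda>w. gdiv (- lifted_diff k (\<eta> (Suc k) w)))"
    by (rule graded_hom_gdiv) (simp add: rho_uminus rho_lifted_diff_eta)
  from A.graded_hom_interleave[OF P_sum eta_hom this] show ?thesis by (simp add: Suc \<zeta>_def)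
qed

lemma diff_diff_P: "w \<in> A.free_module P (Suc (Suc n)) \<Longrightarrow> \<zeta> n (\<eta> n (\<zeta> (Suc n) (\<eta> (Suc n) w))) = 0"
  using eta_zeta[OF A.graded_homD(1)[OF eta_hom]] rho_eta[of w "Suc n"]
    B.free_resolutionD(7)[OF Q rho_in[OF evens_P]] by (simp add: zeta_zero)

text \<open>
  Lift a preimage of \<open>\<rho> y\<close>; the error vanishes modulo \<open>g\<close> and is absorbed by the odd part.
\<close>

lemma eta_onto:
  assumes "y \<in> A.free_module F n" "\<rho> y \<in> diff Q n ` B.free_module Q (Suc n)"
  shows "\<exists>w \<in> A.free_module P (Suc n). \<eta> n w = y"
proof -
  obtain x where x: "x \<in> A.free_module F (Suc n)" "\<rho> y = diff Q n (\<rho> x)"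
    using assms(2) rho_lift by blast
  have m: "y - lifted_diff n x \<in> A.free_module F n"
    using assms(1) A.graded_homD(1)[OF lifted_diff_hom x(1)] by (rule A.free_module_diff)
  have z: "\<theta> (gdiv (y - lifted_diff n x)) = y - lifted_diff n x"
    by (rule theta_gdiv) (simp add: rho_diff rho_lifted_diff x)
  then have "interleave x (gdiv (y - lifted_diff n x)) \<in> A.free_module P (Suc n)"
    using x(1) m by (simp add: P_module flip: theta_module)
  moreover have "\<eta> n (interleave x (gdiv (y - lifted_diff n x))) = y" by (simp add: \<eta>_def z)
  ultimately show ?thesis by blast
qed

text \<open>
  A cycle of \<open>P\<close> is \<open>\<zeta>\<close> of its even part, whose reduction is a cycle of \<open>Q\<close>, hence a boundary; by
  \<open>eta_onto\<close> the even part is a value of \<open>\<eta>\<close>, and so the cycle is a boundary.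
\<close>

theorem P_resolution: "A.free_resolution P"
proof -
  note R = B.free_resolutionD[OF Q]
  have fin: "finite {x \<in> gens P n. gdeg P n x = j}" for n j
  proof -
    have "finite {x \<in> gens E n. gdeg E n x = j}"
    proof (cases n)
      case (Suc k)
      have "{x \<in> gens E n. gdeg E n x = j} \<subseteq> {x \<in> gens Q k. gdeg Q k x = j - 1}"
        by (auto simp: Suc)
      then show ?thesis using R(9) finite_subset by blast
    qed simp
    moreover have "{x \<in> gens P n. gdeg P n x = j} \<subseteq>
        (\<lambda>x. 2 * x) ` {x \<in> gens Q n. gdeg Q n x = j} \<union> (\<lambda>x. Suc (2 * x)) ` {x \<in> gens E n. gdeg E n x = j}"
      by (auto simp: P_def)
    ultimately show ?thesis using R(9) by (meson finite_UnI finite_imageI finite_subset)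
  qed
  have augm_hom: "A.module_hom_K P 0 (augm P)"
    by (simp add: A.module_hom_K_def halves_add A.halves_smult rho_add rho_smult aug_pi
        B.module_hom_KD[OF R(2)] rho_in evens_P)
  have augm_deg: "augm P u = 0" if "j > 0" "u \<in> A.free_component P 0 j" for j u
    using that R(3) rho_component by (simp add: P_component)
  have "\<exists>u \<in> A.free_module P 0. augm P u = c" for c
  proof -
    obtain u where "u \<in> A.free_module F 0" "augm Q (\<rho> u) = c" using R(4)[of c] rho_lift by metis
    then show ?thesis by (intro bexI[of _ "interleave u 0"]) (simp_all add: P_module)
  qed
  then have surj: "augm P ` A.free_module P 0 = UNIV" by (metis UNIV_eq_I image_iff)
  have ex0: "{u \<in> A.free_module P 0. augm P u = 0} = diff P 0 ` A.free_module P (Suc 0)"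
  proof (intro equalityI subsetI)
    fix u assume "u \<in> {u \<in> A.free_module P 0. augm P u = 0}"
    then have u: "u \<in> A.free_module P 0" "augm Q (\<rho> (evens u)) = 0" by auto
    obtain w where w: "w \<in> A.free_module P (Suc 0)" "\<eta> 0 w = evens u"
      using eta_onto[OF evens_P[OF u(1)]] R(6)[OF rho_in[OF evens_P[OF u(1)]] u(2)] by blast
    have "odds u = 0" using odds_P[OF u(1)] by (simp add: E_0)
    then have "u = diff P 0 w" using w(2) interleave_halves(3)[of u] by (simp add: \<zeta>_def)
    then show "u \<in> diff P 0 ` A.free_module P (Suc 0)" using w(1) by blast
  next
    fix u assume "u \<in> diff P 0 ` A.free_module P (Suc 0)"
    then obtain w where w: "w \<in> A.free_module P (Suc 0)" "u = \<zeta> 0 (\<eta> 0 w)" by auto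
    then show "u \<in> {u \<in> A.free_module P 0. augm P u = 0}"
      using A.graded_homD(1)[OF diff_P_hom w(1)] rho_eta[OF w(1)] R(5)[OF rho_in[OF evens_P[OF w(1)]]]
      by simp
  qed
  have ex: "{u \<in> A.free_module P (Suc n). diff P n u = 0} =
      diff P (Suc n) ` A.free_module P (Suc (Suc n))" for n
  proof (intro equalityI subsetI)
    fix u assume "u \<in> {u \<in> A.free_module P (Suc n). diff P n u = 0}"
    then have u: "u \<in> A.free_module P (Suc n)" "\<eta> n u = 0"
      by auto (metis evens_zeta interleave_zero(2))
    then have "diff Q n (\<rho> (evens u)) = 0" using rho_eta[OF u(1)] by simp
    then obtain w where w: "w \<in> A.free_module P (Suc (Suc n))" "\<eta> (Suc n) w = evens u"
      using eta_onto[OF evens_P[OF u(1)]] R(8)[OF rho_in[OF evens_P[OF u(1)]]] by blast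
    then have "u = diff P (Suc n) w" using zeta_eta[OF u] by simp
    then show "u \<in> diff P (Suc n) ` A.free_module P (Suc (Suc n))" using w(1) by blast
  next
    fix u assume "u \<in> diff P (Suc n) ` A.free_module P (Suc (Suc n))"
    then show "u \<in> {u \<in> A.free_module P (Suc n). diff P n u = 0}"
      using A.graded_homD(1)[OF diff_P_hom] diff_diff_P by auto
  qed
  note d = diff_P_hom[unfolded A.graded_hom_def]
  have "A.module_hom P (Suc n) n (diff P n)" for n
    using d[of n] by (simp add: A.module_hom_def)
  moreover have "diff P n ` A.free_component P (Suc n) j \<subseteq> A.free_component P n j" for n j
    using d[of n] by auto
  ultimately show ?thesis
    unfolding A.free_resolution_def using fin augm_hom augm_deg surj ex0 ex by blast
qed

section \<open>Inflation\<close>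

text \<open>
  Composition with the chain map \<open>P \<rightarrow> Q\<close> that forgets the odd part and reduces modulo \<open>g\<close>.
\<close>

definition inflate :: "nat \<Rightarrow> ((nat \<Rightarrow>\<^sub>0 'b) \<Rightarrow> 'k) \<Rightarrow> (nat \<Rightarrow>\<^sub>0 'a) \<Rightarrow> 'k" where
  "inflate n f = A.restrict0 P n (\<lambda>w. f (\<rho> (evens w)))"

lemma inflate_in [simp]: "w \<in> A.free_module P n \<Longrightarrow> inflate n f w = f (\<rho> (evens w))"
  by (simp add: inflate_def)

lemma inflate_cochain: "f \<in> B.cochains Q n m \<Longrightarrow> inflate n f \<in> A.cochains P n m"
  unfolding inflate_def
proof (rule A.cochainsI)
  assume f: "f \<in> B.cochains Q n m"
  note f' = B.cochainsD[OF f]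
  show "A.module_hom_K P n (\<lambda>w. f (\<rho> (evens w)))"
    by (simp add: A.module_hom_K_def halves_add A.halves_smult rho_add rho_smult aug_pi
        B.module_hom_KD[OF f'(1)] rho_in evens_P)
  fix x assume x: "x \<in> gens P n" "gdeg P n x \<noteq> m"
  have "\<rho> (evens (basis x)) \<in> B.free_component Q n (gdeg P n x)"
    using A.basis_in_free_component[OF x(1)] rho_component by (simp add: P_component)
  then show "f (\<rho> (evens (basis x))) = 0" using f'(3) x(2) by blast
qed

lemma inflate_cocycle: "f \<in> B.cocycles Q n m \<Longrightarrow> inflate n f \<in> A.cocycles P n m"
  using inflate_cochain A.graded_homD(1)[OF diff_P_hom] rho_eta rho_in evens_P
  by (simp add: A.cocycles_def B.cocycles_def)

lemma inflate_coboundary: "b \<in> B.coboundaries Q n m \<Longrightarrow> inflate n b \<in> A.coboundaries P n m"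
proof (cases n)
  case 0
  assume "b \<in> B.coboundaries Q n m"
  then have "inflate n b = (\<lambda>u. 0)" using 0 by (auto simp: inflate_def A.restrict0_def fun_eq_iff)
  then show ?thesis using A.coboundaries_zero by metis
next
  case (Suc k)
  assume "b \<in> B.coboundaries Q n m"
  then obtain c where c: "c \<in> B.cochains Q k m" "b = B.restrict0 Q n (c \<circ> diff Q k)"
    using Suc by auto
  have "inflate n b = A.restrict0 P (Suc k) (inflate k c \<circ> diff P k)"
    using A.graded_homD(1)[OF diff_P_hom] rho_eta rho_in evens_P c(2) Suc
    by (auto simp: inflate_def A.restrict0_def fun_eq_iff)
  then show ?thesis using inflate_cochain[OF c(1)] Suc by auto
qed

lemma inflate_ext_class:
  assumes "f' \<in> B.ext_class Q n m f"
  shows "A.ext_class P n m (inflate n f') = A.ext_class P n m (inflate n f)"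
proof (rule A.ext_class_eqI)
  have "(\<lambda>u. f' u - f u) \<in> B.coboundaries Q n m" using assms by (simp add: B.ext_class_def)
  moreover have "inflate n (\<lambda>u. f' u - f u) = (\<lambda>u. inflate n f' u - inflate n f u)"
    by (auto simp: inflate_def A.restrict0_def fun_eq_iff)
  ultimately show "(\<lambda>u. inflate n f' u - inflate n f u) \<in> A.coboundaries P n m"
    using inflate_coboundary by metis
qed

text \<open>
  The even part of the new lift \<open>\<Phi>h\<close> is a lift \<open>\<Phi>t\<close> of the matrices of \<open>\<Phi>\<close> to \<open>A\<close>, so \<open>\<Phi>h\<close> reduces to \<open>\<Phi>\<close> on
  the nose and not just up to homotopy.  The odd part is the quotient by \<open>g\<close> that makes \<open>\<Phi>h\<close> intertwine
  the maps \<open>\<eta>\<close>; as \<open>\<eta>\<close> determines the differential, the chain map property follows.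
\<close>

lemma chain_lift_inflate:
  assumes \<Phi>: "B.chain_lift Q q m h \<Phi>"
  shows "\<exists>\<Phi>t \<Phi>h. (\<forall>i. A.graded_hom F (i + q) F i m (\<Phi>t i)) \<and>
      (\<forall>i. \<forall>u \<in> A.free_module F (i + q). \<rho> (\<Phi>t i u) = \<Phi> i (\<rho> u)) \<and>
      A.chain_lift P q m (inflate q h) \<Phi>h \<and>
      (\<forall>i w. evens (\<Phi>h i w) = \<Phi>t i (evens w)) \<and>
      (\<forall>i. \<forall>w \<in> A.free_module P (Suc i + q). \<eta> i (\<Phi>h (Suc i) w) = \<Phi>t i (\<eta> (i + q) w))"
proof -
  note L = \<Phi>[unfolded B.chain_lift_iff]
  have "\<exists>T. A.graded_hom F (i + q) F i m T \<and> (\<forall>u \<in> A.free_module F (i + q). \<rho> (T u) = \<Phi> i (\<rho> u))" for i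
    using L by (intro graded_hom_lift) blast
  then obtain T where T: "\<And>i. A.graded_hom F (i + q) F i m (T i)"
      "\<And>i u. u \<in> A.free_module F (i + q) \<Longrightarrow> \<rho> (T i u) = \<Phi> i (\<rho> u)"
    by metis
  \<comment> \<open>The numerator is what the odd part, times \<open>g\<close>, must contribute to \<open>\<eta> k (H (Suc k) w)\<close>.\<close>
  define H where "H i w = interleave (T i (evens w))
      (case i of 0 \<Rightarrow> 0 | Suc k \<Rightarrow> gdiv (T k (\<eta> (k + q) w) - lifted_diff k (T (Suc k) (evens w))))" for i w
  have evens_H: "evens (H i w) = T i (evens w)" for i w by (simp add: H_def)
  have div: "\<rho> (T k (\<eta> (k + q) w) - lifted_diff k (T (Suc k) (evens w))) = 0"
    if w: "w \<in> A.free_module P (Suc k + q)" for k w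
  proof -
    have "\<eta> (k + q) w \<in> A.free_module F (k + q)" "T (Suc k) (evens w) \<in> A.free_module F (Suc k)"
      using A.graded_homD(1)[OF eta_hom] A.graded_homD(1)[OF T(1)] w evens_P by simp_all
    then show ?thesis
      using w L evens_P[OF w] rho_in[OF evens_P[OF w]] rho_eta[of w "k + q"]
      by (simp add: rho_diff rho_lifted_diff T(2))
  qed
  have eta_H: "\<eta> k (H (Suc k) w) = T k (\<eta> (k + q) w)" if "w \<in> A.free_module P (Suc k + q)" for k w
    by (simp add: \<eta>_def[of k] H_def theta_gdiv div[OF that])
  have hom: "A.graded_hom P (i + q) P i m (H i)" for i
  proof -
    have e: "A.graded_hom P (i + q) F i m (\<lambda>w. T i (evens w))" for i
      using A.graded_hom_comp[OF P_halves(1) T(1)] by simp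
    show ?thesis
    proof (cases i)
      case 0
      then show ?thesis
        using A.graded_hom_interleave[OF P_sum e[of 0] A.graded_hom_zero] by (simp add: H_def[abs_def])
    next
      case (Suc k)
      have "A.graded_hom P (Suc k + q) F k m (\<lambda>w. T k (\<eta> (k + q) w) - lifted_diff k (T (Suc k) (evens w)))"
        using A.graded_hom_diff A.graded_hom_comp[OF eta_hom T(1)] A.graded_hom_comp[OF e[of "Suc k"] lifted_diff_hom]
        by simp
      then have "A.graded_hom P (Suc k + q) E (Suc k) m
          (\<lambda>w. gdiv (T k (\<eta> (k + q) w) - lifted_diff k (T (Suc k) (evens w))))"
        by (rule graded_hom_gdiv) (rule div)
      from A.graded_hom_interleave[OF P_sum e[of "Suc k"] this]
      show ?thesis by (simp add: Suc H_def[abs_def])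
    qed
  qed
  have comm: "diff P i (H (Suc i) w) = H i (diff P (i + q) w)" if w: "w \<in> A.free_module P (Suc i + q)" for i w
  proof -
    define y where "y = \<eta> (i + q) w"
    have "\<zeta> i (T i y) = H i (\<zeta> (i + q) y)"
    proof (cases i)
      case 0
      then show ?thesis by (simp add: H_def \<zeta>_def[of 0])
    next
      case (Suc k)
      have "\<eta> (k + q) (\<zeta> (Suc (k + q)) y) = 0"
        unfolding y_def using w Suc A.graded_homD(1)[OF eta_hom] rho_eta[of w "i + q"]
          B.free_resolutionD(7)[OF Q rho_in[OF evens_P]]
        by (intro eta_zeta) simp_all
      then show ?thesis
        using A.graded_homD(6)[OF T(1)[of k]] by (simp add: Suc H_def \<zeta>_def[of "Suc k"])
    qed
    then show ?thesis using eta_H[OF w] by (simp add: y_def)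
  qed
  have "A.chain_lift P q m (inflate q h) H"
    unfolding A.chain_lift_iff
  proof (intro conjI allI ballI hom)
    fix u assume u: "u \<in> A.free_module P q"
    then show "augm P (H 0 u) = inflate q h u"
      using T(2)[of "evens u" 0] L evens_P[OF u] rho_in[OF evens_P[OF u]] by (simp add: evens_H)
  next
    fix i u assume "u \<in> A.free_module P (Suc i + q)"
    then show "diff P i (H (Suc i) u) = H i (diff P (i + q) u)" by (rule comm)
  qed
  then show ?thesis using T evens_H eta_H by blast
qed

text \<open>
  Each constructor of the generated subalgebra is matched by the same constructor over \<open>A\<close>.  For
  products this rests on \<open>chain_lift_inflate\<close> and on the independence of the product over \<open>A\<close> of the
  lift.  The claim about cocycles ensures that members of \<open>\<alpha>\<close> represent classes in the product case.
\<close>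

lemma inflate_generated:
  assumes "B.generated Q n m \<alpha>" "f \<in> \<alpha>"
  shows "f \<in> B.cocycles Q n m \<and> A.generated P n m (A.ext_class P n m (inflate n f))"
  using assms
proof (induction arbitrary: f rule: B.generated.induct)
  case one
  have "inflate 0 (B.restrict0 Q 0 (augm Q)) = A.restrict0 P 0 (augm P)"
    by (auto simp: inflate_def A.restrict0_def fun_eq_iff rho_in evens_P)
  then show ?case
    using inflate_ext_class[OF one] A.generated.one one by (simp add: B.ext_class_def)
next
  case (E1 \<alpha> m)
  then have f: "f \<in> B.cocycles Q 1 m" by (auto simp: B.Ext_def B.ext_class_def)
  then have "A.ext_class P 1 m (inflate 1 f) \<in> A.Ext P 1 m"
    using inflate_cocycle unfolding A.Ext_def by blast
  then show ?case using A.generated.E1 f by blast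
next
  case (E2 \<alpha> m)
  then have f: "f \<in> B.cocycles Q 2 m" by (auto simp: B.Ext_def B.ext_class_def)
  then have "A.ext_class P 2 m (inflate 2 f) \<in> A.Ext P 2 m"
    using inflate_cocycle unfolding A.Ext_def by blast
  then show ?case using A.generated.E2 f by blast
next
  case (zero n m)
  have "inflate n (\<lambda>u. 0) = (\<lambda>u. 0)" by (auto simp: inflate_def A.restrict0_def fun_eq_iff)
  then show ?case
    using inflate_ext_class[OF zero] A.generated.zero zero by (simp add: B.ext_class_def)
next
  case (lincomb f1 n m f2 a b)
  have g: "A.generated P n m (A.ext_class P n m (inflate n f1))"
    "A.generated P n m (A.ext_class P n m (inflate n f2))"
    using lincomb.IH lincomb.hyps B.ext_class_self by blast+
  have "inflate n (\<lambda>u. a * f1 u + b * f2 u) = (\<lambda>u. a * inflate n f1 u + b * inflate n f2 u)"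
    by (auto simp: inflate_def A.restrict0_def fun_eq_iff)
  then show ?case
    using A.generated.lincomb[OF inflate_cocycle inflate_cocycle g] lincomb.hyps lincomb.prems
      inflate_ext_class[OF lincomb.prems] by (simp add: B.ext_class_def)
next
  case (mult p l \<alpha> q m \<beta>)
  then obtain e h \<Phi> where *: "e \<in> \<alpha>" "h \<in> \<beta>" "B.chain_lift Q q m h \<Phi>"
      "f \<in> B.ext_class Q (p + q) (l + m) (B.restrict0 Q (p + q) (e \<circ> \<Phi> p))"
    by (auto simp: B.yoneda_product_def)
  note e = mult.IH(1)[OF *(1)] and h = mult.IH(2)[OF *(2)]
  obtain T H where TH: "\<And>i. A.graded_hom F (i + q) F i m (T i)"
      "\<And>i u. u \<in> A.free_module F (i + q) \<Longrightarrow> \<rho> (T i u) = \<Phi> i (\<rho> u)"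
      "A.chain_lift P q m (inflate q h) H" "\<And>i w. evens (H i w) = T i (evens w)"
    using chain_lift_inflate[OF *(3)] by blast
  have "H p w \<in> A.free_module P p" if "w \<in> A.free_module P (p + q)" for w
    using TH(3) that unfolding A.chain_lift_iff by (meson A.graded_homD(1))
  then have "inflate (p + q) (B.restrict0 Q (p + q) (e \<circ> \<Phi> p)) =
      A.restrict0 P (p + q) (inflate p e \<circ> H p)"
    using TH(2,4) by (auto simp: inflate_def A.restrict0_def fun_eq_iff rho_in evens_P)
  moreover have "A.generated P (p + q) (l + m) (A.ext_class P (p + q) (l + m)
      (A.restrict0 P (p + q) (inflate p e \<circ> H p)))"
    using A.generated.mult[OF conjunct2[OF e] conjunct2[OF h]] inflate_cocycle e h TH(3)
    by (simp add: A.yoneda_product_class[OF P_resolution])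
  ultimately show ?case
    using inflate_ext_class[OF *(4)] *(4) by (simp add: B.ext_class_def)
qed

section \<open>The class dual to g\<close>

lemma ex_functional:
  "\<exists>\<phi> :: 'a \<Rightarrow> 'k. (\<forall>a b. \<phi> (a + b) = \<phi> a + \<phi> b) \<and> (\<forall>c a. \<phi> (sA c a) = c * \<phi> a) \<and> \<phi> g = 1"
proof -
  interpret K: vector_space "(*) :: 'k \<Rightarrow> 'k \<Rightarrow> 'k"
    by unfold_locales (auto simp: algebra_simps)
  interpret vp: vector_space_pair sA "(*) :: 'k \<Rightarrow> 'k \<Rightarrow> 'k" ..
  have "g \<noteq> 0" using g_regular[of 1] by auto
  then have "A.independent {g}" by simp
  from vp.linear_independent_extend[OF this, of "\<lambda>_. 1"]
  obtain \<phi> where \<phi>: "Vector_Spaces.linear sA (*) \<phi>" "\<phi> g = 1" by auto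
  then show ?thesis
    using vp.linear_add vp.linear_scale by blast
qed

text \<open>
  A derivation of \<open>A\<close> into the trivial bimodule \<open>K\<close> with value 1 at \<open>g\<close>, that is, a class in \<open>E\<^sup>1\<^sup>,\<^sup>1(A)\<close>
  computed by the bar resolution.
\<close>

definition \<delta> :: "'a \<Rightarrow> 'k" where
  "\<delta> = (SOME l. (\<forall>a b. l (a + b) = l a + l b) \<and>
     (\<forall>a b. l (a * b) = A.aug a * l b + l a * A.aug b) \<and> l g = 1 \<and> (\<forall>n a. a \<in> GA n \<longrightarrow> n \<noteq> 1 \<longrightarrow> l a = 0))"

text \<open>
  A linear functional with value 1 at \<open>g\<close>, applied to the component of degree 1, is such a derivation,
  since \<open>(a b)\<^sub>1 = a\<^sub>0 b\<^sub>1 + a\<^sub>1 b\<^sub>0\<close>.  The degree of \<open>g\<close> is used here: an element of degree at least 2 may be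
  a product of elements of positive degree, and then every such derivation kills it.
\<close>

lemma delta_props:
  "(\<forall>a b. \<delta> (a + b) = \<delta> a + \<delta> b) \<and> (\<forall>a b. \<delta> (a * b) = A.aug a * \<delta> b + \<delta> a * A.aug b) \<and>
     \<delta> g = 1 \<and> (\<forall>n a. a \<in> GA n \<longrightarrow> n \<noteq> 1 \<longrightarrow> \<delta> a = 0)"
proof -
  obtain \<phi> :: "'a \<Rightarrow> 'k" where \<phi>: "\<And>a b. \<phi> (a + b) = \<phi> a + \<phi> b" "\<And>c a. \<phi> (sA c a) = c * \<phi> a" "\<phi> g = 1"
    using ex_functional by blast
  have z: "\<phi> 0 = 0" using \<phi>(2)[of 0 0] by simp
  show ?thesis
    unfolding \<delta>_def
  proof (rule someI[of _ "\<lambda>a. \<phi> (A.hpart a 1)"], intro conjI allI impI)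
    show "\<phi> (A.hpart g 1) = 1" using \<phi>(3) A.hpart_homogeneous[OF g_degree] by simp
    show "\<phi> (A.hpart a 1) = 0" if "a \<in> GA n" "n \<noteq> 1" for a n
      using A.hpart_homogeneous[OF that(1)] that(2) z by simp
    show "\<phi> (A.hpart (a * b) 1) = A.aug a * \<phi> (A.hpart b 1) + \<phi> (A.hpart a 1) * A.aug b" for a b
    proof -
      have "A.hpart (a * b) 1 = sA (A.aug a) (A.hpart b 1) + sA (A.aug b) (A.hpart a 1)"
        by (simp add: A.hpart_mult_1[unfolded One_nat_def] A.hpart_0_eq A.scale_mult_left A.scale_mult_right)
      then show ?thesis by (simp add: \<phi> mult.commute)
    qed
  qed (simp add: A.hpart_add \<phi>(1))
qed

lemma delta_add: "\<delta> (a + b) = \<delta> a + \<delta> b"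
  and delta_mult: "\<delta> (a * b) = A.aug a * \<delta> b + \<delta> a * A.aug b"
  and delta_g: "\<delta> g = 1"
  and delta_homogeneous: "a \<in> GA n \<Longrightarrow> n \<noteq> 1 \<Longrightarrow> \<delta> a = 0"
  using delta_props by blast+

lemma delta_zero [simp]: "\<delta> 0 = 0"
  using delta_homogeneous[OF A.G_zero[of 0]] by simp

lemma aug_g: "A.aug g = 0"
  using A.aug_pos[OF g_degree] by simp

text \<open>
  The extension of \<open>\<delta>\<close> to \<open>F 0\<close>.  By \<open>Lambda_smult\<close> it fails to be linear over \<open>A\<close> only by a term that
  vanishes on the kernel of the augmentation.
\<close>

definition \<Lambda> :: "(nat \<Rightarrow>\<^sub>0 'a) \<Rightarrow> 'k" where
  "\<Lambda> u = (\<Sum>x\<in>supp u. \<delta> (coord u x) * augm Q (basis x))"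

lemma Lambda_superset:
  assumes "finite S" "supp u \<subseteq> S"
  shows "\<Lambda> u = (\<Sum>x\<in>S. \<delta> (coord u x) * augm Q (basis x))"
  unfolding \<Lambda>_def using assms by (intro sum.mono_neutral_left) (auto simp: in_keys_iff)

lemma Lambda_add: "\<Lambda> (u + v) = \<Lambda> u + \<Lambda> v"
proof -
  have "supp (u + v) \<subseteq> supp u \<union> supp v" by (rule keys_add)
  then show ?thesis
    using Lambda_superset[of "supp u \<union> supp v"]
    by (simp add: lookup_add delta_add sum.distrib algebra_simps)
qed

lemma extend_functional_rho: "B.extend_functional c (\<rho> u) = A.extend_functional c u"
proof -
  have "supp (\<rho> u) \<subseteq> supp u" by (auto simp: in_keys_iff)
  then show ?thesis
    using B.extend_functional_superset[of "supp u" "\<rho> u" c] by (simp add: A.extend_functional_def aug_pi)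
qed

lemma Lambda_smult:
  assumes "u \<in> A.free_module F 0"
  shows "\<Lambda> (A.smult a u) = A.aug a * \<Lambda> u + \<delta> a * augm Q (\<rho> u)"
proof -
  have "supp (A.smult a u) \<subseteq> supp u" by (auto simp: in_keys_iff)
  then have "\<Lambda> (A.smult a u) = A.aug a * \<Lambda> u + \<delta> a * A.extend_functional (\<lambda>x. augm Q (basis x)) u"
    using Lambda_superset[of "supp u" "A.smult a u"]
    by (simp add: \<Lambda>_def A.extend_functional_def delta_mult sum.distrib sum_distrib_left algebra_simps)
  then show ?thesis
    using B.module_hom_K_basis[OF B.free_resolutionD(2)[OF Q] rho_in[OF assms]] by (simp add: extend_functional_rho)
qed

lemma Lambda_component:
  assumes "u \<in> A.free_component F 0 d" "d \<noteq> 1"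
  shows "\<Lambda> u = 0"
proof -
  have "\<delta> (coord u x) * augm Q (basis x) = 0" if x: "x \<in> supp u" for x
  proof (cases "gdeg Q 0 x = 0")
    case True
    have "coord u x \<in> A.shifted (gdeg Q 0 x) d" using assms(1) by (simp add: A.free_component_iff)
    then have "coord u x \<in> GA d" using True by (simp add: A.shifted_def)
    then show ?thesis using delta_homogeneous assms(2) by simp
  next
    case False
    have "x \<in> gens Q 0" using x A.free_component_subset[OF assms(1)] by (auto simp: A.free_module_def)
    then show ?thesis
      using B.free_resolutionD(3)[OF Q _ B.basis_in_free_component] False by simp
  qed
  then show ?thesis unfolding \<Lambda>_def by (rule sum.neutral[OF ballI])
qed

text \<open>
  The cocycle of \<open>P\<close> belonging to \<open>\<delta>\<close>.  On the odd part it is the augmentation, because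
  \<open>\<delta> (a * g) = aug a\<close>; on the even part it makes up for the odd part of the differential.
\<close>

definition \<gamma> :: "(nat \<Rightarrow>\<^sub>0 'a) \<Rightarrow> 'k" where
  "\<gamma> = A.restrict0 P 1 (\<lambda>w. \<Lambda> (\<eta> 0 w))"

text \<open>
  Linearity holds as \<open>\<eta> 0\<close> takes values in the kernel of the augmentation, and the cocycle condition
  as \<open>\<eta> 0\<close> composed with the differential is zero.
\<close>

lemma gamma_cocycle: "\<gamma> \<in> A.cocycles P 1 1"
proof -
  have "\<gamma> \<in> A.cochains P 1 1"
    unfolding \<gamma>_def
  proof (rule A.cochainsI)
    have "augm Q (\<rho> (\<eta> 0 w)) = 0" if "w \<in> A.free_module P (Suc 0)" for w
      using rho_eta[OF that] B.free_resolutionD(5)[OF Q rho_in[OF evens_P[OF that]]] by simp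
    then show "A.module_hom_K P 1 (\<lambda>w. \<Lambda> (\<eta> 0 w))"
      by (simp add: A.module_hom_K_def A.graded_homD[OF eta_hom] Lambda_add Lambda_smult)
    fix x assume x: "x \<in> gens P 1" "gdeg P 1 x \<noteq> 1"
    have "\<eta> 0 (basis x) \<in> A.free_component F 0 (gdeg P 1 x)"
      using A.graded_homD(4)[OF eta_hom, of "basis x" 0] A.basis_in_free_component[OF x(1)] by simp
    then show "\<Lambda> (\<eta> 0 (basis x)) = 0" using x(2) by (rule Lambda_component)
  qed
  moreover have "\<gamma> (diff P 1 w) = 0" if w: "w \<in> A.free_module P (Suc 1)" for w
  proof -
    have "\<eta> 0 (\<zeta> 1 (\<eta> 1 w)) = 0"
      using w A.graded_homD(1)[OF eta_hom] rho_eta[of w 1] B.free_resolutionD(7)[OF Q rho_in[OF evens_P]]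
      by (simp add: eta_zeta)
    moreover have "\<zeta> 1 (\<eta> 1 w) \<in> A.free_module P 1"
      using A.graded_homD(1)[OF diff_P_hom w] .
    ultimately show ?thesis by (simp add: \<gamma>_def \<Lambda>_def)
  qed
  ultimately show ?thesis by (simp add: A.cocycles_def)
qed

text \<open>
  The bases of \<open>F n\<close> and of the \<open>n\<close>-th module of \<open>Q\<close> agree, and functionals only depend on constant terms of
  coordinates, so functionals over \<open>A\<close> and over \<open>B\<close> are the same thing.
\<close>

lemma functional_descends:
  assumes h: "A.module_hom_K F n h"
  defines "h' \<equiv> B.restrict0 Q n (B.extend_functional (\<lambda>x. h (basis x)))"
  shows "B.module_hom_K Q n h'" "\<And>u. u \<in> A.free_module F n \<Longrightarrow> h' (\<rho> u) = h u"
    "(\<And>x. x \<in> gens Q n \<Longrightarrow> gdeg Q n x \<noteq> m \<Longrightarrow> h (basis x) = 0) \<Longrightarrow> h' \<in> B.cochains Q n m"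
  unfolding h'_def
  by (simp_all add: B.extend_functional_hom rho_in extend_functional_rho A.module_hom_K_basis[OF h, symmetric] B.cochainsI B.extend_functional_basis)

section \<open>Splitting off the odd part\<close>

lemma theta_uminus: "\<theta> (- u) = - \<theta> u"
  by (simp add: poly_mapping_eq_iff fun_eq_iff)

lemma interleave_parts:
  "interleave (u + v) 0 = interleave u 0 + interleave v 0"
  "interleave 0 (u + v) = interleave 0 u + interleave 0 v"
  "interleave (A.smult a u) 0 = A.smult a (interleave u 0)"
  "interleave 0 (A.smult a u) = A.smult a (interleave 0 u)"
  using halves_add(3)[of u v 0 0] halves_add(3)[of 0 0 u v]
    A.halves_smult(3)[of a u 0] A.halves_smult(3)[of a 0 u] by simp_all

lemma E_Suc_module: "A.free_module E (Suc k) = A.free_module F k"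
  by (simp add: A.free_module_def)

lemma interleave_in_P [simp]:
  "interleave u 0 \<in> A.free_module P n \<longleftrightarrow> u \<in> A.free_module F n"
  "interleave 0 v \<in> A.free_module P n \<longleftrightarrow> v \<in> A.free_module E n"
  by (simp_all add: P_module)

lemma module_hom_K_parts:
  assumes "A.module_hom_K P n f"
  shows "A.module_hom_K F n (\<lambda>u. f (interleave u 0))" "A.module_hom_K E n (\<lambda>v. f (interleave 0 v))"
  by (simp_all add: A.module_hom_K_def interleave_parts A.module_hom_KD(1,2)[OF assms])

text \<open>
  Exactness of the Gysin sequence in the middle, on cocycles.
\<close>

lemma uninflate:
  assumes f: "f \<in> A.cocycles P n m"
    and z: "\<And>v. v \<in> A.free_module E n \<Longrightarrow> f (interleave 0 v) = 0"
  shows "\<exists>f' \<in> B.cocycles Q n m. f = inflate n f'"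
proof -
  note fD = A.cocyclesD[OF f] and fc = A.cochainsD[OF A.cocyclesD(1)[OF f]]
  define h where "h u = f (interleave u 0)" for u
  have split: "f w = h (evens w)" if w: "w \<in> A.free_module P n" for w
  proof -
    have "w = interleave (evens w) 0 + interleave 0 (odds w)" by (simp flip: halves_add(3))
    then have "f w = f (interleave (evens w) 0) + f (interleave 0 (odds w))"
      using A.module_hom_KD(1)[OF fc(1), of "interleave (evens w) 0" "interleave 0 (odds w)"] w
      by (simp add: P_module)
    then show ?thesis using z odds_P[OF w] by (simp add: h_def)
  qed
  have hom: "A.module_hom_K F n h"
    unfolding h_def by (rule module_hom_K_parts(1)[OF fc(1)])
  define f' where "f' = B.restrict0 Q n (B.extend_functional (\<lambda>x. h (basis x)))"
  have f'_rho: "f' (\<rho> u) = h u" if "u \<in> A.free_module F n" for u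
    unfolding f'_def by (rule functional_descends(2)[OF hom that])
  have "f' \<in> B.cochains Q n m"
    unfolding f'_def
  proof (rule functional_descends(3)[OF hom])
    fix x assume x: "x \<in> gens Q n" "gdeg Q n x \<noteq> m"
    then have "interleave (basis x) 0 \<in> A.free_component P n (gdeg Q n x)"
      using A.basis_in_free_component[of x F n] by (simp add: P_component)
    then show "h (basis x) = 0" using fc(3) x(2) by (simp add: h_def)
  qed
  moreover have "f' (diff Q n y) = 0" if y: "y \<in> B.free_module Q (Suc n)" for y
  proof -
    obtain u where u: "u \<in> A.free_module F (Suc n)" "\<rho> u = y" using rho_lift[OF y] by blast
    have w: "interleave u 0 \<in> A.free_module P (Suc n)" using u(1) by (simp add: P_module)
    have "f' (diff Q n y) = h (lifted_diff n u)"
      using f'_rho[OF A.graded_homD(1)[OF lifted_diff_hom u(1)]] rho_lifted_diff[OF u(1)] u(2) by simp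
    also have "\<dots> = f (diff P n (interleave u 0))"
      using split[OF A.graded_homD(1)[OF diff_P_hom w]] by (simp add: \<eta>_def)
    finally show ?thesis using fD(2)[OF w] by simp
  qed
  ultimately have f': "f' \<in> B.cocycles Q n m" by (simp add: B.cocycles_def)
  have "f = inflate n f'"
    by (rule A.cochains_eqI[OF fD(1) A.cocyclesD(1)[OF inflate_cocycle[OF f']]])
      (simp add: split f'_rho evens_P)
  then show ?thesis using f' by blast
qed

text \<open>
  The map \<open>E\<^sup>n(A) \<rightarrow> E\<^sup>n\<^sup>-\<^sup>1(B)\<close> of the Gysin sequence, on cocycles.  On the odd part, the differential of
  \<open>P\<close> is, up to sign and even terms in \<open>A g\<close>, the lifted differential twisted by the endomorphism
  \<open>a \<mapsto> a'\<close> with \<open>a' g = g a\<close>.  Functionals do not notice the twist, by \<open>aug_commute_g\<close>.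
\<close>

lemma odd_part_cocycle:
  assumes f: "f \<in> A.cocycles P (Suc k) (Suc m)"
  shows "\<exists>f' \<in> B.cocycles Q k m. \<forall>v \<in> A.free_module F k. f (interleave 0 v) = f' (\<rho> v)"
proof -
  note fD = A.cocyclesD[OF f] and fc = A.cochainsD[OF A.cocyclesD(1)[OF f]]
  have EF: "A.free_module E (Suc k) = A.free_module F k" by (simp add: A.free_module_def)
  define h where "h v = f (interleave 0 v)" for v
  have hom: "A.module_hom_K F k h"
    using module_hom_K_parts(2)[OF fc(1)]
    by (simp add: h_def[abs_def] A.module_hom_K_def E_Suc_module)
  define f' where "f' = B.restrict0 Q k (B.extend_functional (\<lambda>x. h (basis x)))"
  have f'_rho: "f' (\<rho> u) = h u" if "u \<in> A.free_module F k" for u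
    unfolding f'_def by (rule functional_descends(2)[OF hom that])
  have "f' \<in> B.cochains Q k m"
    unfolding f'_def
  proof (rule functional_descends(3)[OF hom])
    fix x assume x: "x \<in> gens Q k" "gdeg Q k x \<noteq> m"
    then have "interleave 0 (basis x) \<in> A.free_component P (Suc k) (Suc (gdeg Q k x))"
      using A.basis_in_free_component[of x E "Suc k"] by (simp add: P_component)
    then show "h (basis x) = 0" using fc(3) x(2) by (simp add: h_def)
  qed
  moreover have vanishes_on_basis: "h (lifted_diff k (basis x)) = 0" if x: "x \<in> gens Q (Suc k)" for x
  proof -
    let ?e = "basis x"
    have e: "?e \<in> A.free_module F (Suc k)" using A.basis_in_free_module[of x F "Suc k"] x by simp
    \<comment> \<open>\<open>y\<close> is the lifted differential of the basis element with coordinates twisted; up to sign it is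
    the odd part of the boundary of the corresponding odd generator.\<close>
    define y where "y = gdiv (lifted_diff k (\<theta> ?e))"
    have t: "\<theta> ?e \<in> A.free_module F (Suc k)" using e by (auto simp: theta_basis A.free_module_smult)
    have y: "\<theta> y = lifted_diff k (\<theta> ?e)"
      unfolding y_def by (rule theta_gdiv)
        (use rho_lifted_diff[OF t] B.graded_homD(6)[OF B.free_resolutionD(1)[OF Q]] in simp)
    also have "\<dots> = A.smult g (lifted_diff k ?e)"
      using A.graded_homD(3)[OF lifted_diff_hom e] by (simp add: theta_basis)
    finally have "A.aug (coord y z) = A.aug (coord (lifted_diff k ?e) z)" for z
      by (intro aug_commute_g) (simp add: poly_mapping_eq_iff fun_eq_iff)
    moreover have yF: "y \<in> A.free_module F k"
      using A.graded_homD(1)[OF lifted_diff_hom t] y EF theta_module by metis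
    moreover have dF: "lifted_diff k ?e \<in> A.free_module F k" by (rule A.graded_homD(1)[OF lifted_diff_hom e])
    ultimately have "h y = h (lifted_diff k ?e)"
      using A.module_hom_K_basis[OF hom] A.extend_functional_superset[of "supp y \<union> supp (lifted_diff k ?e)"] by simp
    moreover have "h y = 0"
    proof -
      have w: "interleave 0 ?e \<in> A.free_module P (Suc (Suc k))"
        using x by (simp add: P_module A.basis_in_free_module)
      have "gdiv (- \<theta> y) = - y"
        using gdiv_theta[of "- y"] by (simp add: theta_uminus)
      then have "diff P (Suc k) (interleave 0 ?e) = interleave (\<theta> ?e) (- y)"
        using A.graded_homD(6)[OF lifted_diff_hom] by (simp add: \<eta>_def \<zeta>_def flip: y)
      also have "\<dots> = A.smult g (interleave ?e 0) + A.smult (- 1) (interleave 0 y)"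
        by (simp add: theta_basis flip: interleave_parts(3,4) halves_add(3)) (simp add: A.smult_minus_one)
      finally have "f (A.smult g (interleave ?e 0) + A.smult (- 1) (interleave 0 y)) = 0"
        using fD(2)[OF w] by simp
      moreover have "interleave ?e 0 \<in> A.free_module P (Suc k)" "interleave 0 y \<in> A.free_module P (Suc k)"
        using e yF EF by (simp_all add: P_module)
      moreover have "A.aug (- 1) * c = 0 \<longleftrightarrow> c = 0" for c
        using A.aug_mult[of "- 1" "- 1"] by auto
      ultimately show ?thesis
        by (simp add: A.module_hom_KD[OF fc(1)] A.free_module_smult aug_g h_def)
    qed
    ultimately show ?thesis by simp
  qed
  have "h (lifted_diff k u) = 0" if "u \<in> A.free_module F (Suc k)" for u
    using that
  proof (induction rule: A.free_module_induct)
    case (basis a x)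
    have e: "basis x \<in> A.free_module F (Suc k)" using A.basis_in_free_module[of x F "Suc k"] basis by simp
    then show ?case
      using basis vanishes_on_basis[of x] A.graded_homD(3)[OF lifted_diff_hom e] A.module_hom_KD(2)[OF hom A.graded_homD(1)[OF lifted_diff_hom e]] by simp
  next
    case (add u v)
    then show ?case
      by (simp add: A.graded_homD(1,2)[OF lifted_diff_hom] A.module_hom_KD(1)[OF hom])
  qed (use A.graded_homD(6)[OF lifted_diff_hom] A.module_hom_KD(3)[OF hom] in simp)
  then have "f' (diff Q k y) = 0" if y: "y \<in> B.free_module Q (Suc k)" for y
    using rho_lift[OF y] f'_rho rho_lifted_diff A.graded_homD(1)[OF lifted_diff_hom] by metis
  ultimately have "f' \<in> B.cocycles Q k m" by (simp add: B.cocycles_def)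
  then show ?thesis using f'_rho by (intro bexI[of _ f']) (simp_all add: h_def)
qed

text \<open>
  The product is computed with the lift of \<open>chain_lift_inflate\<close>.  On the odd part it sends \<open>v\<close> to
  \<open>\<Lambda> (\<Phi>t 0 (\<theta> v))\<close>, and the factor \<open>g\<close> in \<open>\<theta> v\<close> lets \<open>\<Lambda>\<close> return the augmentation of what is left.
\<close>

lemma gamma_times_inflate:
  assumes h: "h \<in> B.cocycles Q k m"
    and gen: "A.generated P k m (A.ext_class P k m (inflate k h))"
  shows "\<exists>f \<in> A.cocycles P (Suc k) (Suc m). A.generated P (Suc k) (Suc m) (A.ext_class P (Suc k) (Suc m) f) \<and>
    (\<forall>v \<in> A.free_module F k. f (interleave 0 v) = h (\<rho> v))"
proof -
  obtain \<Phi> where \<Phi>: "B.chain_lift Q k m h \<Phi>" using B.chain_lift_exists[OF Q h] by blast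
  obtain T H where TH: "\<And>i. A.graded_hom F (i + k) F i m (T i)"
      "\<And>i u. u \<in> A.free_module F (i + k) \<Longrightarrow> \<rho> (T i u) = \<Phi> i (\<rho> u)"
      "A.chain_lift P k m (inflate k h) H"
      "\<And>i w. w \<in> A.free_module P (Suc i + k) \<Longrightarrow> \<eta> i (H (Suc i) w) = T i (\<eta> (i + k) w)"
    using chain_lift_inflate[OF \<Phi>] by blast
  define f where "f = A.restrict0 P (1 + k) (\<gamma> \<circ> H 1)"
  have "A.ext_class P 1 1 \<gamma> \<in> A.Ext P 1 1" using gamma_cocycle unfolding A.Ext_def by blast
  from A.generated.mult[OF A.generated.E1[OF this] gen]
  have "A.generated P (1 + k) (1 + m) (A.ext_class P (1 + k) (1 + m) f)"
    unfolding f_def A.yoneda_product_class[OF P_resolution gamma_cocycle inflate_cocycle[OF h] TH(3)] .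
  moreover have "f \<in> A.cocycles P (1 + k) (1 + m)"
    unfolding f_def by (rule A.chain_lift_comp_cocycle[OF P_resolution gamma_cocycle TH(3)])
  moreover have "f (interleave 0 v) = h (\<rho> v)" if v: "v \<in> A.free_module F k" for v
  proof -
    have EF: "A.free_module E (Suc k) = A.free_module F k" by (simp add: A.free_module_def)
    have w: "interleave 0 v \<in> A.free_module P (Suc 0 + k)" using v EF by (simp add: P_module)
    have "H (Suc 0) (interleave 0 v) \<in> A.free_module P (Suc 0)"
      using TH(3) w unfolding A.chain_lift_iff by (meson A.graded_homD(1))
    then have "f (interleave 0 v) = \<Lambda> (T 0 (\<theta> v))"
      using TH(4)[OF w] w A.graded_homD(6)[OF lifted_diff_hom] by (simp add: f_def \<gamma>_def \<eta>_def[of k])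
    also have "\<dots> = h (\<rho> v)"
      using v
    proof (induction rule: A.free_module_induct)
      case zero
      then show ?case
        using A.graded_homD(6)[OF TH(1)] B.module_hom_KD(3)[OF B.cochainsD(1)[OF B.cocyclesD(1)[OF h]]]
        by (simp add: \<Lambda>_def)
    next
      case (basis a x)
      let ?e = "basis x"
      have e: "?e \<in> A.free_module F k" using A.basis_in_free_module[of x F k] basis by simp
      have T0: "A.graded_hom F k F 0 m (T 0)" using TH(1)[of 0] by simp
      have "augm Q (\<rho> (T 0 ?e)) = h (\<rho> ?e)"
        using TH(2)[of ?e 0] e \<Phi> rho_in[OF e] unfolding B.chain_lift_iff by simp
      moreover have "T 0 (\<theta> (A.smult a ?e)) = A.smult (a * g) (T 0 ?e)"
        using A.graded_homD(3)[OF T0 e] by (simp add: theta_smult theta_basis A.smult_smult)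
      ultimately have "\<Lambda> (T 0 (\<theta> (A.smult a ?e))) = A.aug a * h (\<rho> ?e)"
        using A.graded_homD(1)[OF T0 e] by (simp add: Lambda_smult A.aug_mult aug_g delta_mult delta_g)
      also have "\<dots> = h (\<rho> (A.smult a ?e))"
        using B.module_hom_KD(2)[OF B.cochainsD(1)[OF B.cocyclesD(1)[OF h]] rho_in[OF e]]
        by (simp add: rho_smult aug_pi)
      finally show ?case .
    next
      case (add u v)
      have T0: "A.graded_hom F k F 0 m (T 0)" using TH(1)[of 0] by simp
      have "\<theta> u \<in> A.free_module F k" "\<theta> v \<in> A.free_module F k" using add by (simp_all add: theta_module EF)
      then show ?case
        using add by (simp add: theta_add A.graded_homD(2)[OF T0] Lambda_add rho_add rho_in
            B.module_hom_KD(1)[OF B.cochainsD(1)[OF B.cocyclesD(1)[OF h]]])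
    qed
    finally show ?thesis .
  qed
  ultimately show ?thesis by auto
qed

text \<open>
  Subtract from a cocycle the product of \<open>\<gamma>\<close> with the inflation of its odd part.  The difference is
  inflated, so both summands are generated.  In homological or internal degree 0 there is no odd
  part, the generators of \<open>E n\<close> having positive degree.
\<close>

theorem resolution_Ext_generated:
  assumes gen: "\<And>n m \<alpha>. \<alpha> \<in> B.Ext Q n m \<Longrightarrow> B.generated Q n m \<alpha>" and f: "f \<in> A.cocycles P n m"
  shows "A.generated P n m (A.ext_class P n m f)"
proof -
  have infl: "A.generated P n m (A.ext_class P n m (inflate n h))" if h: "h \<in> B.cocycles Q n m" for h n m
  proof -
    have "B.generated Q n m (B.ext_class Q n m h)" using gen h unfolding B.Ext_def by blast
    then show ?thesis using inflate_generated B.ext_class_self[OF h] by blast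
  qed
  have even_case: ?thesis if "\<And>v. v \<in> A.free_module E n \<Longrightarrow> f (interleave 0 v) = 0"
    using uninflate[OF f that] infl by blast
  note fc = A.cochainsD[OF A.cocyclesD(1)[OF f]]
  show ?thesis
  proof (cases "n = 0 \<or> m = 0")
    case True
    show ?thesis
    proof (rule even_case)
      fix v assume "v \<in> A.free_module E n"
      then show "f (interleave 0 v) = 0"
      proof (induction rule: A.free_module_induct)
        case zero
        then show ?case using A.module_hom_KD(3)[OF fc(1)] by simp
      next
        case (basis a x)
        then obtain k where k: "n = Suc k" by (cases n) auto
        then have "interleave 0 (basis x) \<in> A.free_component P n (Suc (gdeg Q k x))"
          using A.basis_in_free_component[OF basis] by (simp add: P_component)
        then have "interleave 0 (basis x) \<in> A.free_module P n" "f (interleave 0 (basis x)) = 0"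
          using fc(3) True k A.basis_in_free_module[OF basis] by auto
        then show ?case
          using A.module_hom_KD(2)[OF fc(1), of "interleave 0 (basis x)" a] A.halves_smult(3)[of a 0 "basis x"]
          by simp
      next
        case (add u v)
        then show ?case
          using A.module_hom_KD(1)[OF fc(1), of "interleave 0 u" "interleave 0 v"] halves_add(3)[of 0 0 u v]
          by (simp add: P_module)
      qed
    qed
  next
    case False
    then obtain k l where kl: "n = Suc k" "m = Suc l" by (metis not0_implies_Suc)
    obtain h where h: "h \<in> B.cocycles Q k l" "\<And>v. v \<in> A.free_module F k \<Longrightarrow> f (interleave 0 v) = h (\<rho> v)"
      using odd_part_cocycle f kl by blast
    obtain f2 where f2: "f2 \<in> A.cocycles P n m" "A.generated P n m (A.ext_class P n m f2)"
        "\<And>v. v \<in> A.free_module F k \<Longrightarrow> f2 (interleave 0 v) = h (\<rho> v)"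
      using gamma_times_inflate[OF h(1) infl[OF h(1)]] kl by blast
    define f3 where "f3 = (\<lambda>u. 1 * f u + (- 1) * f2 u)"
    have f3: "f3 \<in> A.cocycles P n m" unfolding f3_def by (rule A.cocycles_lincomb[OF f f2(1)])
    have "f3 (interleave 0 v) = 0" if "v \<in> A.free_module E n" for v
    proof -
      have "v \<in> A.free_module F k" using that kl by (simp add: A.free_module_def)
      then show ?thesis using h(2) f2(3) by (simp add: f3_def)
    qed
    then have "A.generated P n m (A.ext_class P n m f3)"
      using uninflate[OF f3] infl by blast
    from A.generated.lincomb[OF f3 f2(1) this f2(2), of 1 1]
    show ?thesis by (simp add: f3_def)
  qed
qed

end

theorem (in regular_normal_quotient) K2_lifts:
  assumes "\<And>n m \<alpha>. \<alpha> \<in> B.Ext Q n m \<Longrightarrow> B.generated Q n m \<alpha>"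
  shows "K2_algebra sA GA"
  unfolding K2_algebra_def
  using P_resolution resolution_Ext_generated[OF assms] A.connected_graded_algebra_axioms
  by (auto simp: A.Ext_def)

section \<open>Quotients of the tensor algebra\<close>

lemma coord_tensor_scale: "coord (tensor_scale c t) w = c * coord t w"
  unfolding tensor_scale_def by (simp add: Poly_Mapping.map.rep_eq when_def)

definition tensor_part :: "nat \<Rightarrow> ('x, 'k::field) tensor_algebra \<Rightarrow> ('x, 'k) tensor_algebra" where
  "tensor_part n t = Poly_Mapping.mapp (\<lambda>w a. if length (letters w) = n then a else 0) t"

lemma coord_tensor_part: "coord (tensor_part n t) w = (if length (letters w) = n then coord t w else 0)"
  by (simp add: tensor_part_def lookup_mapp when_def in_keys_iff)

lemma tensor_component_iff:
  "t \<in> tensor_component n \<longleftrightarrow> (\<forall>w. coord t w \<noteq> 0 \<longrightarrow> length (letters w) = n)"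
  by (auto simp: tensor_component_def in_keys_iff)

lemma tensor_part_in: "tensor_part n t \<in> tensor_component n"
  by (simp add: tensor_component_iff coord_tensor_part)

lemma tensor_part_homogeneous: "t \<in> tensor_component m \<Longrightarrow> tensor_part n t = (if n = m then t else 0)"
  by (auto simp: poly_mapping_eq_iff fun_eq_iff coord_tensor_part tensor_component_iff)

lemma tensor_part_add: "tensor_part n (s + t) = tensor_part n s + tensor_part n t"
  by (simp add: poly_mapping_eq_iff fun_eq_iff coord_tensor_part lookup_add)

lemma tensor_part_zero [simp]: "tensor_part n 0 = 0"
  by (simp add: poly_mapping_eq_iff fun_eq_iff coord_tensor_part)

lemma tensor_part_sum: "tensor_part n (sum f S) = (\<Sum>x\<in>S. tensor_part n (f x))"
  by (induction S rule: infinite_finite_induct) (auto simp: tensor_part_add)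

lemma tensor_expansion: "\<exists>N. t = (\<Sum>n<N. tensor_part n t) \<and> (\<forall>n\<ge>N. tensor_part n t = 0)"
proof -
  define N where "N = Suc (Max (insert 0 ((length \<circ> letters) ` supp t)))"
  have b: "length (letters w) < N" if "coord t w \<noteq> 0" for w
    using that by (auto simp: N_def less_Suc_eq_le in_keys_iff intro!: Max_ge)
  have "coord t w = coord (\<Sum>n<N. tensor_part n t) w" for w
  proof -
    have "coord (\<Sum>n<N. tensor_part n t) w = (\<Sum>n<N. if n = length (letters w) then coord t w else 0)"
      unfolding lookup_sum by (rule sum.cong) (auto simp: coord_tensor_part)
    then show ?thesis using b by (auto simp: sum.delta)
  qed
  then have "t = (\<Sum>n<N. tensor_part n t)" by (rule poly_mapping_eqI)
  moreover have "\<forall>n\<ge>N. tensor_part n t = 0"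
    using b by (auto simp: poly_mapping_eq_iff fun_eq_iff coord_tensor_part) (metis leD)
  ultimately show ?thesis by blast
qed

lemma tensor_component_mult:
  assumes "s \<in> tensor_component m" "t \<in> tensor_component n"
  shows "s * t \<in> tensor_component (m + n)"
  using assms keys_mult[of s t] by (fastforce simp: tensor_component_def plus_fword_def)

lemma tensor_part_mult_left:
  assumes "s \<in> tensor_component m"
  shows "tensor_part n (s * t) = (if m \<le> n then s * tensor_part (n - m) t else 0)"
proof -
  obtain N where N: "t = (\<Sum>k<N. tensor_part k t)" "\<forall>k\<ge>N. tensor_part k t = 0"
    using tensor_expansion by blast
  have "tensor_part n (s * t) = (\<Sum>k<N. tensor_part n (s * tensor_part k t))"
    by (subst N(1)) (simp add: sum_distrib_left tensor_part_sum)
  also have "\<dots> = (\<Sum>k<N. if k = n - m then (if m \<le> n then s * tensor_part (n - m) t else 0) else 0)"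
    by (rule sum.cong)
      (auto simp: tensor_part_homogeneous[OF tensor_component_mult[OF assms tensor_part_in]])
  also have "\<dots> = (if m \<le> n then s * tensor_part (n - m) t else 0)"
    using N(2) by (auto simp: sum.delta)
  finally show ?thesis .
qed

lemma tensor_part_mult_right:
  assumes "s \<in> tensor_component m"
  shows "tensor_part n (t * s) = (if m \<le> n then tensor_part (n - m) t * s else 0)"
proof -
  obtain N where N: "t = (\<Sum>k<N. tensor_part k t)" "\<forall>k\<ge>N. tensor_part k t = 0"
    using tensor_expansion by blast
  have "tensor_part n (t * s) = (\<Sum>k<N. tensor_part n (tensor_part k t * s))"
    by (subst N(1)) (simp add: sum_distrib_right tensor_part_sum)
  also have "\<dots> = (\<Sum>k<N. if k = n - m then (if m \<le> n then tensor_part (n - m) t * s else 0) else 0)"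
    by (rule sum.cong)
      (auto simp: tensor_part_homogeneous[OF tensor_component_mult[OF tensor_part_in assms]])
  also have "\<dots> = (if m \<le> n then tensor_part (n - m) t * s else 0)"
    using N(2) by (auto simp: sum.delta)
  finally show ?thesis .
qed

text \<open>
  The elements all of whose components lie in the ideal form an ideal, and it contains \<open>R\<close>.
\<close>

lemma homogeneous_ideal:
  fixes R :: "('x, 'k::field) tensor_algebra set"
  assumes ideal: "two_sided_ideal (two_sided_ideal hull R)"
    and R: "\<And>r. r \<in> R \<Longrightarrow> \<exists>d. r \<in> tensor_component d"
    and t: "t \<in> two_sided_ideal hull R"
  shows "tensor_part n t \<in> two_sided_ideal hull R"
proof -
  let ?I = "two_sided_ideal hull R"
  let ?J = "{t. \<forall>n. tensor_part n t \<in> ?I}"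
  have I: "0 \<in> ?I" "\<And>x y. x \<in> ?I \<Longrightarrow> y \<in> ?I \<Longrightarrow> x + y \<in> ?I"
    "\<And>a x. x \<in> ?I \<Longrightarrow> a * x \<in> ?I" "\<And>a x. x \<in> ?I \<Longrightarrow> x * a \<in> ?I"
    using ideal unfolding two_sided_ideal_def by blast+
  have sum_in: "sum f S \<in> ?I" if "\<And>x. x \<in> S \<Longrightarrow> f x \<in> ?I" for f :: "nat \<Rightarrow> _" and S
    using that by (induction S rule: infinite_finite_induct) (simp_all add: I(1,2))
  have "a * x \<in> ?J \<and> x * a \<in> ?J" if x: "x \<in> ?J" for a x
  proof -
    obtain N where N: "a = (\<Sum>k<N. tensor_part k a)" using tensor_expansion by blast
    have "a * x = (\<Sum>k<N. tensor_part k a * x)" "x * a = (\<Sum>k<N. x * tensor_part k a)"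
      by (subst N, simp add: sum_distrib_left sum_distrib_right)+
    then show ?thesis
      using x by (simp add: tensor_part_sum tensor_part_mult_left[OF tensor_part_in]
          tensor_part_mult_right[OF tensor_part_in] sum_in I)
  qed
  then have "two_sided_ideal ?J"
    using I by (simp add: two_sided_ideal_def tensor_part_add)
  moreover have "R \<subseteq> ?J"
  proof
    fix r assume r: "r \<in> R"
    then obtain d where "r \<in> tensor_component d" using R by blast
    moreover have "r \<in> ?I" using r by (rule hull_inc)
    ultimately show "r \<in> ?J" using I(1) by (simp add: tensor_part_homogeneous)
  qed
  ultimately have "?I \<subseteq> ?J" by (rule hull_minimal[rotated])
  then show ?thesis using t by blast
qed

lemma algebra_hom_kernel_ideal:
  assumes "algebra_hom sA sB f"
  shows "two_sided_ideal {x. f x = 0}"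
proof -
  note f = assms[unfolded algebra_hom_def]
  have "f 0 = f 0 + f 0" using f by (metis add_0)
  then show ?thesis using f by (auto simp: two_sided_ideal_def)
qed

text \<open>
  The components of the quotient are independent because the ideal, being generated by homogeneous
  elements, contains the components of its elements.
\<close>

lemma quotient_of_tensor_algebra:
  fixes p :: "('x, 'k::field) tensor_algebra \<Rightarrow> 'a::ring_1"
  assumes p: "quotient_map tensor_scale scale p (two_sided_ideal hull R)"
    and R: "\<And>r. r \<in> R \<Longrightarrow> \<exists>d. r \<in> tensor_component d"
  shows "connected_graded_algebra scale (\<lambda>n. p ` tensor_component n)"
proof -
  let ?G = "\<lambda>n. p ` tensor_component n"
  have ph: "algebra_hom tensor_scale scale p" and ps: "surj p"
    and ker: "{t. p t = 0} = two_sided_ideal hull R"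
    using p by (auto simp: quotient_map_def)
  note h = ph[unfolded algebra_hom_def]
  have p_one: "p 1 = 1" and p_add: "p (s + t) = p s + p t" and p_mult: "p (s * t) = p s * p t"
    and p_scale: "p (tensor_scale c t) = scale c (p t)" for c s t using h by auto
  have p_zero: "p 0 = 0" using p_add[of 0 0] by simp
  have p_sum: "p (sum f S) = (\<Sum>x\<in>S. p (f x))" for f :: "nat \<Rightarrow> _" and S
    by (induction S rule: infinite_finite_induct) (auto simp: p_zero p_add)
  have lift: "\<exists>t. a = p t" for a using ps by (metis surjD)
  interpret vector_space scale
  proof
    fix a b :: 'k and x y :: 'a
    obtain s t where st: "x = p s" "y = p t" using lift by metis
    have "tensor_scale a (s + t) = tensor_scale a s + tensor_scale a t"
      "tensor_scale (a + b) s = tensor_scale a s + tensor_scale b s"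
      "tensor_scale a (tensor_scale b s) = tensor_scale (a * b) s" "tensor_scale 1 s = s"
      by (simp_all add: poly_mapping_eq_iff fun_eq_iff coord_tensor_scale lookup_add algebra_simps)
    then show "scale a (x + y) = scale a x + scale a y" "scale (a + b) x = scale a x + scale b x"
      "scale a (scale b x) = scale (a * b) x" "scale 1 x = x"
      unfolding st by (metis p_scale p_add)+
  qed
  have G_add: "a + b \<in> ?G n" if ab: "a \<in> ?G n" "b \<in> ?G n" for a b n
  proof -
    obtain s t where "s \<in> tensor_component n" "a = p s" "t \<in> tensor_component n" "b = p t" using ab by blast
    moreover from this have "s + t \<in> tensor_component n"
      unfolding tensor_component_iff lookup_add by (metis add_0)
    ultimately show ?thesis using p_add by (metis imageI)
  qed
  have G_scale: "scale c a \<in> ?G n" if a: "a \<in> ?G n" for a c n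
  proof -
    obtain s where "s \<in> tensor_component n" "a = p s" using a by blast
    moreover from this have "tensor_scale c s \<in> tensor_component n"
      unfolding tensor_component_iff coord_tensor_scale by (metis mult_zero_right)
    ultimately show ?thesis using p_scale by (metis imageI)
  qed
  have G_zero: "0 \<in> ?G n" for n
    using p_zero by (metis image_eqI tensor_component_iff lookup_zero)
  have unique: "f n = 0" if f: "\<And>n. f n \<in> ?G n" "finite S" "(\<Sum>n\<in>S. f n) = 0" "n \<in> S" for f n S
  proof -
    obtain t where t: "\<And>n. t n \<in> tensor_component n" "\<And>n. f n = p (t n)"
      using f(1) unfolding image_iff by metis
    have "p (sum t S) = 0" using f(3) by (simp add: t(2) p_sum)
    then have "sum t S \<in> two_sided_ideal hull R" using ker by blast
    then have "tensor_part n (sum t S) \<in> two_sided_ideal hull R"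
      using algebra_hom_kernel_ideal[OF ph] unfolding ker by (intro homogeneous_ideal[OF _ R])
    moreover have "tensor_part n (sum t S) = t n"
      using f(2,4) by (simp add: tensor_part_sum tensor_part_homogeneous[OF t(1)] sum.delta)
    ultimately have "t n \<in> {t. p t = 0}" using ker by simp
    then show ?thesis by (simp add: t(2))
  qed
  show ?thesis
  proof (unfold_locales)
    fix c and a b :: 'a
    obtain s t where st: "a = p s" "b = p t" using lift by metis
    have c: "tensor_scale c s = Poly_Mapping.single 0 c * s" for s :: "('x, 'k) tensor_algebra"
      by (simp add: tensor_scale_def mult_map_scale_conv_mult)
    have c': "scale c (p s) = p (tensor_scale c 1) * p s" for s
      using c[of s] c[of 1] by (simp flip: p_scale p_mult)
    show "scale c a * b = scale c (a * b)"
      unfolding st c' p_mult[symmetric] by (simp add: mult.assoc)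
    have comm: "tensor_scale c 1 * t = t * tensor_scale c 1" for t :: "('x, 'k) tensor_algebra"
    proof (induction t rule: update_induct)
      case const
      then show ?case by simp
    next
      case (update f w b)
      have "Poly_Mapping.update w b f = f + Poly_Mapping.single w b"
        using update.hyps by (auto simp: poly_mapping_eq_iff fun_eq_iff lookup_update lookup_add
            lookup_single when_def in_keys_iff)
      then show ?case
        using update.IH by (simp add: algebra_simps c mult_single mult.commute)
    qed
    have "s * (tensor_scale c 1 * t) = tensor_scale c 1 * (s * t)"
      using comm[of s] by (simp flip: mult.assoc)
    then show "a * scale c b = scale c (a * b)"
      unfolding st c' p_mult[symmetric] by simp
  next
    show "subspace (?G n)" for n using G_zero G_add G_scale by (simp add: subspace_def)
  next
    show "a * b \<in> ?G (m + n)" if "a \<in> ?G m" "b \<in> ?G n" for a b m n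
    proof -
      obtain s t where "s \<in> tensor_component m" "a = p s" "t \<in> tensor_component n" "b = p t"
        using \<open>a \<in> ?G m\<close> \<open>b \<in> ?G n\<close> by blast
      then show ?thesis using imageI[OF tensor_component_mult, of s m t n p] p_mult[of s t] by simp
    qed
  next
    fix a
    obtain t where t: "a = p t" using lift by blast
    obtain N where N: "t = (\<Sum>n<N. tensor_part n t)" "\<forall>n\<ge>N. tensor_part n t = 0"
      using tensor_expansion by blast
    let ?f = "\<lambda>n. p (tensor_part n t)"
    have sub: "{n. ?f n \<noteq> 0} \<subseteq> {..<N}" using N(2) p_zero by (auto simp: not_le[symmetric])
    have "a = (\<Sum>n<N. ?f n)" unfolding t by (subst N(1)) (rule p_sum)
    also have "\<dots> = (\<Sum>n\<in>{n. ?f n \<noteq> 0}. ?f n)"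
      using sub by (intro sum.mono_neutral_right) auto
    finally have *: "a = (\<Sum>n\<in>{n. ?f n \<noteq> 0}. ?f n)" .
    have fin: "finite {n. ?f n \<noteq> 0}" using sub finite_subset by blast
    show "\<exists>!f. (\<forall>n. f n \<in> ?G n) \<and> finite {n. f n \<noteq> 0} \<and> a = (\<Sum>n\<in>{n. f n \<noteq> 0}. f n)"
    proof (rule ex1I[of _ ?f])
      show "(\<forall>n. ?f n \<in> ?G n) \<and> finite {n. ?f n \<noteq> 0} \<and> a = (\<Sum>n\<in>{n. ?f n \<noteq> 0}. ?f n)"
        using * fin tensor_part_in by blast
    next
      fix f assume f: "(\<forall>n. f n \<in> ?G n) \<and> finite {n. f n \<noteq> 0} \<and> a = (\<Sum>n\<in>{n. f n \<noteq> 0}. f n)"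
      let ?S = "{n. f n \<noteq> 0} \<union> {n. ?f n \<noteq> 0}"
      have S: "finite ?S" using f fin by blast
      have "a = (\<Sum>n\<in>?S. f n)"
        using f S by (intro trans[OF conjunct2[OF conjunct2[OF f]]] sum.mono_neutral_left) auto
      moreover have "a = (\<Sum>n\<in>?S. ?f n)"
        using S by (intro trans[OF *] sum.mono_neutral_left) auto
      ultimately have "(\<Sum>n\<in>?S. f n) = (\<Sum>n\<in>?S. ?f n)" by simp
      then have z: "(\<Sum>n\<in>?S. f n + scale (- 1) (?f n)) = 0"
        by (simp add: scale_minus_left sum_subtractf)
      have "f n + scale (- 1) (?f n) = 0" if "n \<in> ?S" for n
        by (rule unique[OF _ S z that]) (use f tensor_part_in in \<open>blast intro: G_add G_scale\<close>)
      then have "f n = ?f n" for n by (cases "n \<in> ?S") (auto simp: scale_minus_left)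
      then show "f = ?f" by blast
    qed
  next
    show "?G 0 = range (\<lambda>c. scale c 1)"
    proof (intro equalityI subsetI)
      fix a assume "a \<in> ?G 0"
      then obtain t where t: "t \<in> tensor_component 0" "a = p t" by blast
      have "letters w = [] \<longleftrightarrow> w = 0" for w :: "'x fword"
        by (cases w) (simp add: zero_fword_def)
      then have "t = tensor_scale (coord t 0) 1"
        using t(1) by (auto simp: poly_mapping_eq_iff fun_eq_iff coord_tensor_scale lookup_one when_def tensor_component_iff)
      then have "a = scale (coord t 0) 1" using t(2) p_scale p_one by metis
      then show "a \<in> range (\<lambda>c. scale c 1)" by blast
    next
      fix a assume "a \<in> range (\<lambda>c. scale c 1)"
      then obtain c where a: "a = scale c 1" by blast
      have "(1 :: ('x, 'k) tensor_algebra) \<in> tensor_component 0"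
        by (simp add: tensor_component_iff lookup_one when_def zero_fword_def)
      then have "1 \<in> ?G 0" using p_one by (metis imageI)
      then show "a \<in> ?G 0" using a G_scale by blast
    qed
  qed
qed

section \<open>Passing from the quotient to the algebra\<close>

theorem theorem8p1:
  fixes scaleA :: "'k::field \<Rightarrow> 'a::ring_1 \<Rightarrow> 'a"
    and scaleB :: "'k \<Rightarrow> 'b::ring_1 \<Rightarrow> 'b"
    and R :: "('x::finite, 'k) tensor_algebra set"
    and p :: "('x, 'k) tensor_algebra \<Rightarrow> 'a"
    and \<pi> :: "'a \<Rightarrow> 'b"
    and g :: 'a
  assumes "finite R"
    and "\<And>r. r \<in> R \<Longrightarrow> \<exists>d\<ge>2. r \<in> tensor_component d"
    and "\<And>S. S \<subset> R \<Longrightarrow> two_sided_ideal hull S \<noteq> two_sided_ideal hull R"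
    and "quotient_map tensor_scale scaleA p (two_sided_ideal hull R)"
    and "g \<in> p ` tensor_component 1"
    and "normal_element g"
    and "regular_element g"
    and "quotient_map scaleA scaleB \<pi> (range (\<lambda>a. g * a))"
    and "K2_algebra scaleB (\<lambda>n. \<pi> ` p ` tensor_component n)"
  shows "K2_algebra scaleA (\<lambda>n. p ` tensor_component n)"
proof -
  have A: "connected_graded_algebra scaleA (\<lambda>n. p ` tensor_component n)"
    using assms(2) by (intro quotient_of_tensor_algebra[OF assms(4)]) blast
  have B: "connected_graded_algebra scaleB (\<lambda>n. \<pi> ` p ` tensor_component n)"
    using assms(9) by (simp add: K2_algebra_def)
  obtain Q :: "('b, 'k) free_complex" where
    Q: "connected_graded_algebra.free_resolution scaleB (\<lambda>n. \<pi> ` p ` tensor_component n) Q"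
    and gen: "\<And>n m \<alpha>. \<alpha> \<in> connected_graded_algebra.Ext scaleB (\<lambda>n. \<pi> ` p ` tensor_component n) Q n m \<Longrightarrow>
      connected_graded_algebra.generated scaleB (\<lambda>n. \<pi> ` p ` tensor_component n) Q n m \<alpha>"
    using assms(9) unfolding K2_algebra_def by blast
  have \<pi>: "algebra_hom scaleA scaleB \<pi>" "surj \<pi>" "{x. \<pi> x = 0} = range (\<lambda>a. g * a)"
    using assms(8) by (auto simp: quotient_map_def)
  have ker: "\<pi> a = 0 \<longleftrightarrow> (\<exists>b. a = b * g)" for a
    using \<pi>(3) assms(6) unfolding normal_element_def by blast
  interpret regular_normal_quotient scaleA "\<lambda>n. p ` tensor_component n"
    scaleB "\<lambda>n. \<pi> ` p ` tensor_component n" \<pi> g Q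
  proof (intro regular_normal_quotient.intro regular_normal_quotient_axioms.intro A B Q ker \<pi>(2) refl)
    show "\<pi> 1 = 1" "\<pi> (a + b) = \<pi> a + \<pi> b" "\<pi> (a * b) = \<pi> a * \<pi> b"
      "\<pi> (scaleA c a) = scaleB c (\<pi> a)" for a b c
      using \<pi>(1) unfolding algebra_hom_def by blast+
    show "g \<in> p ` tensor_component 1" by (rule assms(5))
    show "a * g = 0 \<Longrightarrow> a = 0" for a
      using assms(7) unfolding regular_element_def by blast
  qed
  show ?thesis using gen by (rule K2_lifts)
qed

end
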